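(* Let $q$ take values in an infinite set of powers of two with $q>2$. For each $q$, let $f$ be a characteristic polynomial of a Gordon-Mills-Welch difference set in $\mathbb{F}_q^*$, and let $r$ and $t$ be integers with $t\ge 0$ (depending on $q$). Let $T>0$ be real. If $t/q\to T$ as $q\to\infty$, then $F(f_{r,t})\to\varphi_0(0,T)$ as $q\to\infty$.
   Context: Merit factor: for $f\in\mathbb{C}[z]$ and $1\le\alpha<\infty$ put $\|f\|_\alpha=\left(\frac{1}{2\pi}\int_0^{2\pi}|f(e^{i\phi})|^\alpha\,d\phi\right)^{1/\alpha}$. The merit factor of $f$ is $F(f)=\frac{\|f\|_2^4}{\|f\|_4^4-\|f\|_2^4}$, provided that the denominator is nonzero. Characteristic polynomials: let $G$ be a finite cyclic group of order $n$ (written multiplicatively) and $D\subseteq G$. Put $\mathbf{1}_D(y)=1$ for $y\in D$ and $\mathbf{1}_D(y)=-1$ for $y\in G\setminus D$. Fix a generator $\theta$ of $G$. For integers $r,t$ with $t\ge 0$, put $f_{r,t}(z)=\sum_{j=0}^{t-1}\mathbf{1}_D(\theta^{j+r})z^j$. The polynomial $f=f_{0,n}$ is called a characteristic polynomial of $D$ (it depends on the choice of $\theta$), and $f_{r,t}$ denotes the associated polynomial formed with the same $\theta$. Difference sets: a difference set with parameters $(n,k,\lambda)$ is a $k$-subset $D$ of a finite group $G$ of order $n$ such that the $k(k-1)$ nonzero differences (quotients, in multiplicative notation) of elements in $D$ hit every nonidentity element of $G$ exactly $\lambda$ times. Gordon-Mills-Welch difference sets: let $q>2$ be a power of two, let $\mathbb{F}_s$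 be a proper subfield of $\mathbb{F}_q$, let $A=\{a\in\mathbb{F}_q:\mathrm{Tr}_{q,s}(a)=1\}$, where $\mathrm{Tr}_{q,s}$ is the trace from $\mathbb{F}_q$ to $\mathbb{F}_s$, and let $B$ be a difference set in $\mathbb{F}_s^*$ with $|B|=s/2$ (the case $s=2$, in which $B$ is a trivial difference set, is allowed). A set of the form $\{ab:a\in A,\,b\in B\}$ is called a Gordon-Mills-Welch difference set in $\mathbb{F}_q^*$. The function $\varphi_\nu$: for real $\nu$, $R\in\mathbb{R}$ and $T>0$, $$\frac{1}{\varphi_\nu(R,T)}=1-\frac{2(1+\nu)T}{3}+4\sum_{m=1}^{\infty}\max\Big(0,1-\frac{m}{T}\Big)^2+\nu\sum_{m\in\mathbb{Z}}\max\Big(0,1-\Big|1+\frac{2R-m}{T}\Big|\Big)^2.$$ *)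

theory Defs
  imports
    "HOL-Analysis.Analysis"
    "HOL-Computational_Algebra.Polynomial"
    "HOL-Algebra.Multiplicative_Group"
    "HOL-Algebra.Embedded_Algebras"
begin

definition poly_norm :: "real \<Rightarrow> complex poly \<Rightarrow> real" where
  "poly_norm \<alpha> f =
     (1 / (2 * pi) * integral {0..2 * pi} (\<lambda>\<phi>. cmod (poly f (cis \<phi>)) powr \<alpha>)) powr (1 / \<alpha>)"

(* Takes the value 0 when the denominator vanishes. *)
definition merit_factor :: "complex poly \<Rightarrow> real" where
  "merit_factor f = poly_norm 2 f ^ 4 / (poly_norm 4 f ^ 4 - poly_norm 2 f ^ 4)"

definition pm_indicator :: "'a set \<Rightarrow> 'a \<Rightarrow> complex" where
  "pm_indicator D y = (if y \<in> D then 1 else - 1)"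

(* The polynomial f_{r,t}, formed with the element \<theta>. *)
definition shifted_poly ::
    "('a, 'b) monoid_scheme \<Rightarrow> 'a set \<Rightarrow> 'a \<Rightarrow> int \<Rightarrow> nat \<Rightarrow> complex poly" where
  "shifted_poly G D \<theta> r t =
     (\<Sum>j<t. Polynomial.monom (pm_indicator D (\<theta> [^]\<^bsub>G\<^esub> (int j + r))) j)"

(* The generator \<theta> is an explicit argument because f depends on it, and so that the
   associated polynomials can be formed with the same generator. *)
definition characteristic_poly ::
    "('a, 'b) monoid_scheme \<Rightarrow> 'a set \<Rightarrow> 'a \<Rightarrow> complex poly \<Rightarrow> bool" where
  "characteristic_poly G D \<theta> f \<longleftrightarrow>
     group G \<and> finite (carrier G) \<and>
     \<theta> \<in> carrier G \<and> generate G {\<theta>} = carrier G \<and>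
     D \<subseteq> carrier G \<and>
     f = shifted_poly G D \<theta> 0 (card (carrier G))"

definition difference_set ::
    "('a, 'b) monoid_scheme \<Rightarrow> nat \<Rightarrow> nat \<Rightarrow> nat \<Rightarrow> 'a set \<Rightarrow> bool" where
  "difference_set G n k l D \<longleftrightarrow>
     group G \<and> finite (carrier G) \<and> card (carrier G) = n \<and>
     D \<subseteq> carrier G \<and> card D = k \<and>
     (\<forall>g \<in> carrier G - {\<one>\<^bsub>G\<^esub>}.
        card {(x, y). x \<in> D \<and> y \<in> D \<and> x \<otimes>\<^bsub>G\<^esub> inv\<^bsub>G\<^esub> y = g} = l)"

(* The trace from a finite field R to its subfield S, as the sum of the conjugates
   a ^ (s ^ i) for i < [R : S], where s = |S|. *)
definition field_trace :: "('a, 'b) ring_scheme \<Rightarrow> 'a set \<Rightarrow> 'a \<Rightarrow> 'a" where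
  "field_trace R S a =
     (\<Oplus>\<^bsub>R\<^esub>i \<in> {..<ring.dim R S (carrier R)}. a [^]\<^bsub>R\<^esub> (card S ^ i))"

(* If |S| = 2, then B = {1} is a difference set in the trivial group for every value of l. *)
definition gmw_difference_set :: "('a, 'b) ring_scheme \<Rightarrow> 'a set \<Rightarrow> bool" where
  "gmw_difference_set R D \<longleftrightarrow>
     field R \<and> card (carrier R) > 2 \<and> (\<exists>k. card (carrier R) = 2 ^ k) \<and>
     (\<exists>S B k l.
        subfield S R \<and> S \<noteq> carrier R \<and>
        difference_set (mult_of (R\<lparr>carrier := S\<rparr>)) (card S - 1) k l B \<and> 2 * k = card S \<and>
        D = {a \<otimes>\<^bsub>R\<^esub> b | a b. a \<in> {a \<in> carrier R. field_trace R S a = \<one>\<^bsub>R\<^esub>} \<and> b \<in> B})"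

(* The two series have finite support whenever T > 0. *)
definition phi :: "real \<Rightarrow> real \<Rightarrow> real \<Rightarrow> real" where
  "phi \<nu> R T =
     1 / (1 - 2 * (1 + \<nu>) * T / 3
          + 4 * (\<Sum>m. (max 0 (1 - real (Suc m) / T))\<^sup>2)
          + \<nu> * (\<Sum>\<^sub>\<infinity>m::int. (max 0 (1 - \<bar>1 + (2 * R - real_of_int m) / T\<bar>))\<^sup>2))"

end

theory Submission
  imports
    "HOL-Algebra.Algebraic_Closure_Type"
    "HOL-Library.Z2"
    "HOL-Real_Asymp.Real_Asymp"
    Defs
    "HOL-Number_Theory.Cong"
begin

hide_const (open) Ring_Divisibility.mult_of

text \<open>
  Let \<open>n = q - 1\<close> and let \<open>F\<close> be the discrete Fourier transform of the \<open>n\<close>-periodic sequence of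
  signs of the difference set. The fourth power of the \<open>L\<^sup>4\<close> norm of \<open>f\<^sub>r\<^sub>,\<^sub>t\<close> is a mean over the
  roots of unity of order \<open>M n\<close> with \<open>2 t \<le> M n\<close>, hence a weighted sum of the moments
  \<open>\<Sum>\<^sub>k F(k + a) F(k + b) cnj (F(k + c)) cnj (F k)\<close>; the weights are products of Dirichlet kernels, whose
  \<open>L\<^sup>1\<close> norms only cost powers of \<open>ln n\<close>. If every moment differs by \<open>O(q\<^sup>1\<^sup>1\<^sup>/\<^sup>4)\<close> from its value
  for a sequence with all \<open>\<bar>F k\<bar>\<^sup>2 = n\<close> and otherwise independent phases, namely \<open>n\<^sup>3\<close> when the shifts
  cancel in pairs and \<open>0\<close> otherwise, then only lag sums remain, and these converge to
  \<open>1 + 1 / \<phi>\<^sub>0(0, T)\<close> after division by \<open>t\<^sup>2\<close>.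

  For a Gordon-Mills-Welch set, \<open>F k\<close> is a Gauss sum of the character \<open>\<chi>\<^sup>k\<close> times a character sum over the
  subfield \<open>GF s\<close>. Expanding the latter, the moments become sums of four Gauss sums over all \<open>k\<close>, which
  reduce to the sums \<open>\<Sum>\<^sub>u \<chi>\<^sup>a(u) \<chi>\<^sup>b(u + 1) \<chi>\<^sup>c(u + v)\<close>, bounded by \<open>2 \<surd>q\<close>. This instance of Weil's bound
  follows from the rationality of the associated L-function, of degree two, together with a bound
  for the sums over the extensions of even degree, where Stepanov's method applies because the order of
  the field is a square. All finite fields are realised inside the algebraic closure of the
  two-element field.
\<close>

section \<open>Kummer extensions\<close>

text \<open>Two losses must be avoided. One is the constant in Weil's bound: it may not depend on
  the order of the character, which can be as large as \<open>q - 1\<close>, whereas the constant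
  that Stepanov's method yields grows with this order. The L-function removes it: the sum over the
  extension of degree \<nu> is \<open>- (\<omega> ^ \<nu> + \<omega>' ^ \<nu>)\<close>, so a
  constant that is independent of \<nu> disappears as \<nu> grows and leaves
  \<open>norm \<omega> \<le> sqrt q\<close>. The other loss occurs in passing to the subfield.
  Paired moments have size \<open>q ^ 3\<close>, the unpaired sums of four Gauss sums are
  \<open>O(q ^ (5 / 2))\<close>, so the subfield factor must cost less than \<open>sqrt q\<close>.
  But \<open>s\<close> can be \<open>sqrt q\<close>, and bounding the \<open>s - 1\<close>
  coefficients by \<open>1\<close> each would lose everything. Parseval and Cauchy-Schwarz reduce
  the cost to \<open>sqrt s\<close>, at most \<open>q ^ (1 / 4)\<close>. This is the origin of the
  exponent \<open>11 / 4\<close>, and the remaining gap of \<open>q ^ (1 / 4)\<close> absorbs the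
  logarithms.\<close>

locale ring_map =
  fixes \<phi> :: "'r::idom \<Rightarrow> 's::idom"
  assumes one [simp]: "\<phi> 1 = 1"
    and add: "\<phi> (x + y) = \<phi> x + \<phi> y"
    and mult: "\<phi> (x * y) = \<phi> x * \<phi> y"
begin

lemma zero [simp]: "\<phi> 0 = 0"
  using add[of 0 0] by (metis add.right_neutral add_left_cancel)

lemma power: "\<phi> (x ^ n) = \<phi> x ^ n"
  by (induction n) (simp_all add: mult)

lemma sum: "\<phi> (sum f A) = (\<Sum>i\<in>A. \<phi> (f i))"
  by (induction A rule: infinite_finite_induct) (simp_all add: add)

lemma map_poly_add: "map_poly \<phi> (p + q) = map_poly \<phi> p + map_poly \<phi> q"
  by (rule poly_eqI) (simp add: coeff_map_poly add)

lemma map_poly_mult: "map_poly \<phi> (p * q) = map_poly \<phi> p * map_poly \<phi> q"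
  by (rule poly_eqI) (simp add: coeff_map_poly coeff_mult sum mult)

lemma map_poly_prod: "map_poly \<phi> (prod f A) = (\<Prod>i\<in>A. map_poly \<phi> (f i))"
  by (induction A rule: infinite_finite_induct) (simp_all add: map_poly_mult)

lemma poly_map_poly: "poly (map_poly \<phi> p) (\<phi> x) = \<phi> (poly p x)"
  by (induction p) (simp_all add: map_poly_pCons add mult)

lemma map_poly_scale: "map_poly \<phi> (p \<circ>\<^sub>p [:0, c:]) = map_poly \<phi> p \<circ>\<^sub>p [:0, \<phi> c:]"
  by (rule poly_eqI) (simp add: coeff_map_poly coeff_pcompose_linear mult power)

end

text \<open>The powers of \<open>\<eta>\<close> with exponent below \<open>d\<close> are already
  \<open>d\<close> distinct roots of \<open>X ^ d - 1\<close>, which has no more.\<close>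

lemma roots_of_unity_powers:
  fixes \<eta> r :: "'e::field"
  assumes "d > 0" and "\<eta> ^ d = 1" and prim: "\<And>i. 0 < i \<Longrightarrow> i < d \<Longrightarrow> \<eta> ^ i \<noteq> 1"
    and "r ^ d = 1"
  obtains i where "i < d" and "r = \<eta> ^ i"
proof -
  have nz: "\<eta> \<noteq> 0" using assms(1,2) by (auto simp: power_0_left)
  have "inj_on (\<lambda>i. \<eta> ^ i) {..<d}"
  proof (rule inj_onI)
    have *: "i = j" if "i \<le> j" "j < d" "\<eta> ^ i = \<eta> ^ j" for i j
    proof (rule ccontr)
      assume "i \<noteq> j"
      have "\<eta> ^ j = \<eta> ^ i * \<eta> ^ (j - i)" using that(1) by (simp flip: power_add)
      hence "\<eta> ^ (j - i) = 1" using that(3) nz by simp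
      thus False using prim[of "j - i"] that \<open>i \<noteq> j\<close> by simp
    qed
    show "i = j" if "i \<in> {..<d}" "j \<in> {..<d}" "\<eta> ^ i = \<eta> ^ j" for i j
      using *[of i j] *[of j i] that by (metis lessThan_iff nle_le)
  qed
  hence card: "card ((\<lambda>i. \<eta> ^ i) ` {..<d}) = d" by (simp add: card_image)
  let ?p = "Polynomial.monom 1 d - 1 :: 'e poly"
  have p0: "?p \<noteq> 0"
  proof
    assume "?p = 0"
    hence "poly.coeff ?p d = 0" by simp
    thus False using assms(1) by (simp add: coeff_1)
  qed
  have deg: "degree ?p \<le> d"
    by (intro degree_diff_le) (auto simp: degree_monom_eq)
  have fin: "finite {x. poly ?p x = 0}" using poly_roots_finite[OF p0] .
  have "(\<lambda>i. \<eta> ^ i) ` {..<d} \<subseteq> {x. poly ?p x = 0}"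
    using assms(2) by (auto simp: poly_monom) (metis mult.commute power_mult power_one)
  moreover have "card {x. poly ?p x = 0} \<le> d"
    using card_poly_roots_bound[OF p0] deg by simp
  ultimately have "(\<lambda>i. \<eta> ^ i) ` {..<d} = {x. poly ?p x = 0}"
    using card fin by (metis card_seteq)
  moreover have "r \<in> {x. poly ?p x = 0}" using assms(4) by (simp add: poly_monom)
  ultimately show ?thesis using that by blast
qed

interpretation to_ac: ring_map "to_ac :: 'e::field \<Rightarrow> 'e alg_closure"
  by standard simp_all

interpretation to_fract: ring_map "to_fract :: 'e::idom \<Rightarrow> 'e fract"
  by standard simp_all

text \<open>All roots of the minimal polynomial of \<open>y\<close> are multiples of \<open>y\<close> by roots of unity in the base
  field, so its constant coefficient is a multiple of a power of \<open>y\<close>.\<close>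

lemma kummer_power_in_base:
  fixes y :: "'e::field alg_closure" and p :: "'e poly" and \<eta> e :: 'e
  assumes "\<eta> ^ d = 1" and prim: "\<And>i. 0 < i \<Longrightarrow> i < d \<Longrightarrow> \<eta> ^ i \<noteq> 1"
    and "y ^ d = to_ac e" and "e \<noteq> 0"
    and "p \<noteq> 0" and "degree p < d" and "poly (map_poly to_ac p) y = 0"
  obtains k u where "0 < k" and "k < d" and "y ^ k = to_ac u"
proof -
  have d: "d > 0" using assms(6) by simp
  define P where "P g \<longleftrightarrow> g \<noteq> 0 \<and> poly (map_poly to_ac g) y = 0" for g :: "'e poly"
  have "P p" using assms by (simp add: P_def)
  then obtain g where g: "P g" and gmin: "\<And>h. P h \<Longrightarrow> degree g \<le> degree h"
    using ex_has_least_nat[of P p degree] by blast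
  have g0: "g \<noteq> 0" and gy: "poly (map_poly to_ac g) y = 0" using g by (auto simp: P_def)
  let ?k = "degree g"
  have "?k < d" using gmin[OF \<open>P p\<close>] assms(6) by simp
  have "?k > 0"
  proof (rule ccontr)
    assume "\<not> ?k > 0"
    then obtain c where "g = [:c:]" using degree_eq_zeroE by auto
    thus False using g0 gy by (simp add: map_poly_pCons)
  qed
  let ?f = "Polynomial.monom 1 d - [:e:] :: 'e poly"
  have fval: "poly (map_poly to_ac ?f) z = z ^ d - to_ac e" for z
  proof -
    have "map_poly to_ac ?f = Polynomial.monom 1 d - [:to_ac e:]"
      by (rule poly_eqI) (simp add: coeff_map_poly coeff_pCons split: nat.splits)
    thus ?thesis by (simp add: poly_monom)
  qed
  have "poly (map_poly to_ac ?f) y = 0" using assms(3) fval by simp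
  moreover have "?f = g * (?f div g) + ?f mod g" by simp
  hence "map_poly to_ac ?f = map_poly to_ac g * map_poly to_ac (?f div g) + map_poly to_ac (?f mod g)"
    by (metis to_ac.map_poly_add to_ac.map_poly_mult)
  ultimately have "poly (map_poly to_ac (?f mod g)) y = 0" using gy by simp
  hence "?f mod g = 0"
    using gmin[of "?f mod g"] degree_mod_less'[OF g0, of ?f] unfolding P_def
    by (metis not_le)
  hence fdiv: "map_poly to_ac ?f = map_poly to_ac g * map_poly to_ac (?f div g)"
    by (metis \<open>?f = g * (?f div g) + ?f mod g\<close> add.right_neutral to_ac.map_poly_mult)
  have y0: "y \<noteq> 0" using assms(3,4) d by (auto simp: power_0_left)
  have root: "\<exists>u. r = to_ac u * y" if "poly (map_poly to_ac g) r = 0" for r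
  proof -
    have "r ^ d = to_ac e" using that fval[of r] fdiv by simp
    hence "(r / y) ^ d = 1" using assms(3,4) by (simp add: power_divide)
    moreover have "to_ac \<eta> ^ d = 1" by (metis assms(1) to_ac.one to_ac_power)
    moreover have "to_ac \<eta> ^ i \<noteq> 1" if "0 < i" "i < d" for i
      using prim[OF that] by (metis to_ac_1 to_ac_eq_iff to_ac_power)
    ultimately obtain i where "r / y = to_ac \<eta> ^ i"
      using roots_of_unity_powers[OF d, of "to_ac \<eta>" "r / y"] by metis
    hence "r = to_ac (\<eta> ^ i) * y" using y0 by (simp add: field_simps)
    thus ?thesis by blast
  qed
  have mg0: "map_poly to_ac g \<noteq> 0" using g0 by (simp add: map_poly_eq_0_iff)
  have degmg: "degree (map_poly to_ac g) = ?k" by (rule degree_map_poly) simp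
  obtain A where A: "size A = ?k"
      "map_poly to_ac g = smult (lead_coeff (map_poly to_ac g)) (\<Prod>x\<in>#A. [:- x, 1:])"
    using alg_closed_imp_factorization[OF mg0] degmg by auto
  have rootA: "poly (map_poly to_ac g) r = 0" if "r \<in># A" for r
    using that by (subst A(2)) (auto simp: poly_prod_mset image_iff intro!: bexI[of _ r])
  have "\<exists>u. prod_mset (image_mset (\<lambda>x. - x) B) = to_ac u * y ^ size B" if "\<forall>r\<in>#B. \<exists>u. r = to_ac u * y" for B
    using that
  proof (induction B)
    case (add r B)
    then obtain u v where "prod_mset (image_mset (\<lambda>x. - x) B) = to_ac u * y ^ size B" "r = to_ac v * y" by auto
    thus ?case by (intro exI[of _ "- v * u"]) (simp add: mult_ac)
  qed (auto intro: exI[of _ 1])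
  then obtain u where u: "prod_mset (image_mset (\<lambda>x. - x) A) = to_ac u * y ^ ?k"
    using root rootA A(1) by metis
  have "to_ac (poly g 0) = poly (map_poly to_ac g) 0"
    using to_ac.poly_map_poly[of g 0] by simp
  also have "\<dots> = to_ac (lead_coeff g) * (to_ac u * y ^ ?k)"
    by (subst A(2)) (simp add: poly_prod_mset degmg coeff_map_poly u)
  finally have eq: "to_ac (poly g 0) = to_ac (lead_coeff g * u) * y ^ ?k" by simp
  have "prod_mset (image_mset (\<lambda>x. - x) A) \<noteq> 0"
  proof
    assume "prod_mset (image_mset (\<lambda>x. - x) A) = 0"
    hence "0 \<in># A" by auto
    hence "poly (map_poly to_ac ?f) 0 = 0" using rootA fdiv by simp
    thus False using fval[of 0] d assms(4) by (simp add: power_0_left)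
  qed
  hence "lead_coeff g * u \<noteq> 0" using u g0 by auto
  hence "y ^ ?k = to_ac (poly g 0 / (lead_coeff g * u))"
    using eq by (simp add: field_simps)
  thus ?thesis using that \<open>?k > 0\<close> \<open>?k < d\<close> by blast
qed

text \<open>Euclid's argument: the product of all \<open>X - a\<close>, increased by
  \<open>1\<close>, could have no root.\<close>

lemma infinite_UNIV_alg_closed: "infinite (UNIV :: 'a::alg_closed_field set)"
proof
  assume fin: "finite (UNIV :: 'a set)"
  let ?p = "(\<Prod>a\<in>(UNIV::'a set). [:- a, 1:]) + 1 :: 'a poly"
  have "degree (\<Prod>a\<in>(UNIV::'a set). [:- a, 1:]) = card (UNIV :: 'a set)"
    by (subst degree_prod_eq_sum_degree) auto
  moreover have "card (UNIV :: 'a set) > 0" using fin by (simp add: card_gt_0_iff)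
  ultimately have "degree ?p > 0" by (subst degree_add_eq_left) auto
  then obtain x where "poly ?p x = 0" using alg_closed_imp_poly_has_root by blast
  moreover have "(\<Prod>a\<in>UNIV. x - a) = 0" using fin by (intro prod_zero) auto
  ultimately show False by (simp add: poly_prod)
qed

section \<open>Resultants with a binomial \<open>G Y ^ d - F\<close>\<close>

lemma poly_eq_sum_lessThan:
  fixes p :: "'a::comm_semiring_1 poly"
  shows "degree p < N \<Longrightarrow> poly p x = (\<Sum>k<N. poly.coeff p k * x ^ k)"
  unfolding poly_altdef by (rule sum.mono_neutral_left) (auto simp: coeff_eq_0)

text \<open>The substitution of \<open>\<eta> X\<close> for \<open>X\<close> merely rotates the
  factors of the product, but it multiplies coefficient \<open>k\<close> by
  \<open>\<eta> ^ k\<close>.\<close>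

lemma coeff_root_of_unity_norm:
  fixes p :: "'r::idom poly"
  assumes "\<eta> ^ d = 1" and "\<eta> ^ k \<noteq> 1"
  shows "poly.coeff (\<Prod>i<d. p \<circ>\<^sub>p [:0, \<eta> ^ i:]) k = 0"
proof (cases "d = 0")
  case True
  have "k \<noteq> 0" using assms(2) by (intro notI) simp
  thus ?thesis using True by (simp add: coeff_1)
next
  case False
  let ?Q = "\<Prod>i<d. p \<circ>\<^sub>p [:0, \<eta> ^ i:]"
  have "?Q \<circ>\<^sub>p [:0, \<eta>:] = (\<Prod>i<d. p \<circ>\<^sub>p [:0, \<eta> ^ Suc i:])"
    by (simp add: pcompose_prod pcompose_assoc[symmetric] pcompose_pCons mult_ac)
  also have "\<dots> = (\<Prod>i\<in>{1..d}. p \<circ>\<^sub>p [:0, \<eta> ^ i:])"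
    by (rule prod.reindex_bij_witness[of _ "\<lambda>i. i - 1" Suc]) auto
  also have "{1..d} = insert d {1..<d}" using False by auto
  also have "(\<Prod>i\<in>insert d {1..<d}. p \<circ>\<^sub>p [:0, \<eta> ^ i:]) = (\<Prod>i\<in>insert 0 {1..<d}. p \<circ>\<^sub>p [:0, \<eta> ^ i:])"
    using assms(1) by simp
  also have "insert 0 {1..<d} = {..<d}" using False by auto
  finally have "poly.coeff ?Q k * \<eta> ^ k = poly.coeff ?Q k"
    by (metis coeff_pcompose_linear mult.commute)
  hence "poly.coeff ?Q k * (\<eta> ^ k - 1) = 0" by (simp add: algebra_simps)
  thus ?thesis using assms(2) by simp
qed

text \<open>The resultant in \<open>Y\<close> of \<open>p\<close> and \<open>G Y\<^sup>d - F\<close>, written by means of a primitive root of unity.\<close>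

definition kummer_resultant :: "'r::idom \<Rightarrow> nat \<Rightarrow> 'r \<Rightarrow> 'r \<Rightarrow> 'r poly \<Rightarrow> 'r" where
  "kummer_resultant \<eta> d F G p =
     (\<Sum>i<d. poly.coeff (\<Prod>j<d. p \<circ>\<^sub>p [:0, \<eta> ^ j:]) (d * i) * F ^ i * G ^ (d - 1 - i))"

text \<open>Only exponents divisible by \<open>d\<close> survive in the norm of \<open>p\<close>, so
  \<open>y\<close> enters through \<open>y ^ d\<close> alone, and \<open>G ^ (d - 1)\<close> clears
  the denominators of \<open>y ^ d = F / G\<close>. The ring map is arbitrary because one resultant
  is specialised twice: once to show that it vanishes, and once to draw a conclusion from
  that.\<close>

lemma (in ring_map) kummer_resultant_eq:
  fixes p :: "'r poly"
  assumes "\<eta> ^ d = 1" and prim: "\<And>i. 0 < i \<Longrightarrow> i < d \<Longrightarrow> \<eta> ^ i \<noteq> 1" and "degree p < d"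
    and "\<phi> G * y ^ d = \<phi> F"
  shows "\<phi> (kummer_resultant \<eta> d F G p) =
    \<phi> G ^ (d - 1) * (\<Prod>j<d. poly (map_poly \<phi> p) (\<phi> \<eta> ^ j * y))"
proof -
  have d: "d > 0" using assms(3) by simp
  define Q where "Q = (\<Prod>j<d. p \<circ>\<^sub>p [:0, \<eta> ^ j:])"
  have "degree Q \<le> (\<Sum>j<d. degree (p \<circ>\<^sub>p [:0, \<eta> ^ j:]))"
    unfolding Q_def using degree_prod_sum_le[of "{..<d}" "\<lambda>j. p \<circ>\<^sub>p [:0, \<eta> ^ j:]"] by (simp add: o_def)
  also have "\<dots> \<le> (\<Sum>j<d. d - 1)"
  proof (rule sum_mono)
    fix j
    have "degree (p \<circ>\<^sub>p [:0, \<eta> ^ j:]) \<le> degree p * degree [:0, \<eta> ^ j:]" by (rule degree_pcompose_le)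
    also have "\<dots> \<le> degree p * 1" by (intro mult_left_mono) auto
    finally show "degree (p \<circ>\<^sub>p [:0, \<eta> ^ j:]) \<le> d - 1" using assms(3) by simp
  qed
  \<comment> \<open>This caps the surviving exponents \<open>d * i\<close> at \<open>i < d\<close>,
    so the single power \<open>G ^ (d - 1)\<close> suffices for all of them.\<close>
  finally have "degree Q \<le> d * (d - 1)" by simp
  also have "\<dots> < d * d" using d by simp
  finally have degQ: "degree (map_poly \<phi> Q) < d * d" using map_poly_degree_leq[of \<phi> Q] by simp
  have Q0: "poly.coeff Q k = 0" if "\<not> d dvd k" for k
  proof -
    have "\<eta> ^ k = \<eta> ^ (k mod d) * (\<eta> ^ d) ^ (k div d)"
      by (metis add.commute mult_div_mod_eq power_add power_mult)
    also have "\<dots> = \<eta> ^ (k mod d)" using assms(1) by simp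
    finally have "\<eta> ^ k \<noteq> 1" using prim[of "k mod d"] that d
      by (metis mod_greater_zero_iff_not_dvd mod_less_divisor)
    thus ?thesis unfolding Q_def by (rule coeff_root_of_unity_norm[OF assms(1)])
  qed
  have "poly (map_poly \<phi> Q) y = (\<Sum>k<d * d. \<phi> (poly.coeff Q k) * y ^ k)"
    using poly_eq_sum_lessThan[OF degQ] by (simp add: coeff_map_poly)
  also have "\<dots> = (\<Sum>k\<in>(\<lambda>i. d * i) ` {..<d}. \<phi> (poly.coeff Q k) * y ^ k)"
  proof (rule sum.mono_neutral_right)
    show "\<forall>i\<in>{..<d * d} - (\<lambda>i. d * i) ` {..<d}. \<phi> (poly.coeff Q i) * y ^ i = 0"
    proof
      fix i assume i: "i \<in> {..<d * d} - (\<lambda>i. d * i) ` {..<d}"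
      hence "\<not> d dvd i" by (auto simp: dvd_def)
      thus "\<phi> (poly.coeff Q i) * y ^ i = 0" by (simp add: Q0)
    qed
  qed (use d in auto)
  also have "\<dots> = (\<Sum>i<d. \<phi> (poly.coeff Q (d * i)) * y ^ (d * i))"
    using d by (subst sum.reindex) (auto simp: inj_on_def)
  finally have Qy: "poly (map_poly \<phi> Q) y = (\<Sum>i<d. \<phi> (poly.coeff Q (d * i)) * y ^ (d * i))" .
  have "\<phi> G ^ (d - 1) * poly (map_poly \<phi> Q) y = \<phi> (kummer_resultant \<eta> d F G p)"
    unfolding Qy kummer_resultant_def Q_def[symmetric] sum sum_distrib_left
  proof (rule sum.cong)
    fix i assume "i \<in> {..<d}"
    hence "d - 1 = i + (d - 1 - i)" by simp
    hence "\<phi> G ^ (d - 1) = \<phi> G ^ i * \<phi> G ^ (d - 1 - i)" by (metis power_add)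
    hence "\<phi> G ^ (d - 1) * y ^ (d * i) = (\<phi> G * y ^ d) ^ i * \<phi> G ^ (d - 1 - i)"
      by (simp add: power_mult power_mult_distrib mult_ac)
    also have "\<dots> = \<phi> F ^ i * \<phi> G ^ (d - 1 - i)" by (simp add: assms(4))
    finally have *: "\<phi> G ^ (d - 1) * y ^ (d * i) = \<phi> F ^ i * \<phi> G ^ (d - 1 - i)" .
    have "\<phi> G ^ (d - 1) * (\<phi> (poly.coeff Q (d * i)) * y ^ (d * i)) =
        \<phi> (poly.coeff Q (d * i)) * (\<phi> G ^ (d - 1) * y ^ (d * i))" by (simp add: mult_ac)
    also have "\<dots> = \<phi> (poly.coeff Q (d * i) * F ^ i * G ^ (d - 1 - i))"
      unfolding * by (simp add: mult power mult_ac)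
    finally show "\<phi> G ^ (d - 1) * (\<phi> (poly.coeff Q (d * i)) * y ^ (d * i)) =
      \<phi> (poly.coeff Q (d * i) * F ^ i * G ^ (d - 1 - i))" .
  qed simp
  moreover have "poly (map_poly \<phi> Q) y = (\<Prod>j<d. poly (map_poly \<phi> p) (\<phi> \<eta> ^ j * y))"
    unfolding Q_def map_poly_prod map_poly_scale power by (simp add: poly_prod poly_pcompose mult_ac)
  ultimately show ?thesis by simp
qed

lemma degree_coeff_mult_le:
  fixes p q :: "'a::comm_ring_1 poly poly"
  assumes "\<And>k. degree (poly.coeff p k) \<le> A" and "\<And>k. degree (poly.coeff q k) \<le> B"
  shows "degree (poly.coeff (p * q) k) \<le> A + B"
  unfolding coeff_mult
  by (rule degree_sum_le) (auto intro: order.trans[OF degree_mult_le] add_mono assms)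

lemma degree_coeff_prod_le:
  fixes p :: "'i \<Rightarrow> 'a::comm_ring_1 poly poly"
  assumes "\<And>i k. i \<in> I \<Longrightarrow> degree (poly.coeff (p i) k) \<le> A"
  shows "degree (poly.coeff (\<Prod>i\<in>I. p i) k) \<le> card I * A"
  using assms
proof (induction I arbitrary: k rule: infinite_finite_induct)
  case (insert i I)
  have "degree (poly.coeff (p i * (\<Prod>i\<in>I. p i)) k) \<le> A + card I * A"
    by (rule degree_coeff_mult_le) (use insert in auto)
  thus ?case using insert by simp
qed (simp_all add: coeff_1)

text \<open>Degrees are taken in the variable of the coefficient ring, in which \<open>F\<close> and
  \<open>\<eta>\<close> are constant. Each of the \<open>d\<close> conjugates of \<open>p\<close>
  contributes at most \<open>A - 1\<close>, which makes the bound strict, and at most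
  \<open>d - 1\<close> factors \<open>G\<close> occur.\<close>

lemma degree_kummer_resultant_less:
  fixes p :: "'a::idom poly poly" and F G \<eta> :: "'a poly"
  assumes "\<And>k. degree (poly.coeff p k) < A" and "degree G \<le> m" and "degree F = 0"
    and "degree \<eta> = 0" and "d > 0"
  shows "degree (kummer_resultant \<eta> d F G p) < d * (A + m)"
proof -
  have A: "A > 0" using assms(1)[of 0] by simp
  have "degree (kummer_resultant \<eta> d F G p) \<le> d * (A - 1) + (d - 1) * m"
    unfolding kummer_resultant_def
  proof (intro degree_sum_le)
    fix i assume i: "i \<in> {..<d}"
    let ?q = "poly.coeff (\<Prod>j<d. p \<circ>\<^sub>p [:0, \<eta> ^ j:]) (d * i)"
    have "degree ?q \<le> card {..<d} * (A - 1)"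
    proof (rule degree_coeff_prod_le)
      fix j k
      have "degree ((\<eta> ^ j) ^ k) = 0"
        using degree_power_le[of "\<eta> ^ j" k] degree_power_le[of \<eta> j] assms(4) by simp
      hence "degree (poly.coeff (p \<circ>\<^sub>p [:0, \<eta> ^ j:]) k) \<le> degree (poly.coeff p k)"
        unfolding coeff_pcompose_linear using degree_mult_le[of "(\<eta> ^ j) ^ k" "poly.coeff p k"] by simp
      thus "degree (poly.coeff (p \<circ>\<^sub>p [:0, \<eta> ^ j:]) k) \<le> A - 1" using assms(1)[of k] by simp
    qed
    moreover have "degree (F ^ i) = 0" using degree_power_le[of F i] assms(3) by simp
    moreover have "degree (G ^ (d - 1 - i)) \<le> (d - 1) * m"
    proof -
      have "degree (G ^ (d - 1 - i)) \<le> degree G * (d - 1 - i)" by (rule degree_power_le)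
      also have "\<dots> \<le> m * (d - 1)" using assms(2) by (intro mult_mono) auto
      finally show ?thesis by (simp add: mult.commute)
    qed
    ultimately show "degree (?q * F ^ i * G ^ (d - 1 - i)) \<le> d * (A - 1) + (d - 1) * m"
      using degree_mult_le[of "?q * F ^ i" "G ^ (d - 1 - i)"] degree_mult_le[of ?q "F ^ i"] by simp
  qed auto
  also have "\<dots> < d * A + d * m"
    using A assms(5) by (intro add_less_le_mono) auto
  finally show ?thesis by (simp add: algebra_simps)
qed

lemma ring_map_pcompose: "ring_map (\<lambda>p. p \<circ>\<^sub>p (q :: 'a::idom poly))"
  by standard (simp_all add: pcompose_add pcompose_mult pcompose_1)

lemma ring_map_poly: "ring_map (\<lambda>p. poly p (x :: 'a::idom))"
  by standard simp_all

lemma ring_map_comp: "ring_map f \<Longrightarrow> ring_map g \<Longrightarrow> ring_map (\<lambda>x. f (g x))"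
  by (simp add: ring_map_def)

lemma (in ring_map) ring_map_eval: "ring_map (\<lambda>p. poly (map_poly \<phi> p) x)"
  by standard (simp_all add: map_poly_add map_poly_mult)

text \<open>For \<open>R\<close> of degree less than \<open>P\<close> in the outer variable \<open>x\<close>, substituting \<open>x\<^sup>P\<close> for the inner
  variable is injective.\<close>

lemma subst_power_eq_0:
  fixes R :: "'a::idom poly poly"
  assumes "degree R < P"
    and "poly (map_poly (\<lambda>c. c \<circ>\<^sub>p Polynomial.monom 1 P) R) [:0, 1:] = 0"
  shows "R = 0"
proof (rule poly_eqI, rule poly_eqI)
  fix i j
  show "poly.coeff (poly.coeff R i) j = poly.coeff (poly.coeff 0 i) j"
  proof (cases "i < P")
    case True
    have mono: "c \<circ>\<^sub>p Polynomial.monom 1 P = (\<Sum>l\<le>degree c. Polynomial.monom (poly.coeff c l) (l * P))" for c :: "'a poly"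
      by (simp add: pcompose_altdef poly_altdef coeff_map_poly monom_power smult_monom mult.commute degree_map_poly)
    have "0 = poly.coeff (poly (map_poly (\<lambda>c. c \<circ>\<^sub>p Polynomial.monom 1 P) R) [:0, 1:]) (j * P + i)"
      using assms(2) by simp
    also have "poly (map_poly (\<lambda>c. c \<circ>\<^sub>p Polynomial.monom 1 P) R) [:0, 1:]
        = (\<Sum>k<P. (poly.coeff R k \<circ>\<^sub>p Polynomial.monom 1 P) * [:0, 1:] ^ k)"
      by (subst poly_eq_sum_lessThan[OF le_less_trans[OF map_poly_degree_leq assms(1)]])
        (simp add: coeff_map_poly)
    also have "\<dots> = (\<Sum>k<P. \<Sum>l\<le>degree (poly.coeff R k). Polynomial.monom (poly.coeff (poly.coeff R k) l) (l * P + k))"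
      unfolding mono by (simp add: sum_distrib_right monom_altdef[of 1, simplified, symmetric] mult_monom)
    also have "poly.coeff \<dots> (j * P + i) =
        (\<Sum>k<P. \<Sum>l\<le>degree (poly.coeff R k). if l = j \<and> k = i then poly.coeff (poly.coeff R k) l else 0)"
      unfolding coeff_sum coeff_monom
    proof (intro sum.cong refl)
      fix k l assume "k \<in> {..<P}"
      \<comment> \<open>Both \<open>k\<close> and \<open>i\<close> are below \<open>P\<close>, so
        the exponent determines quotient and remainder modulo \<open>P\<close>.\<close>
      have "l * P + k = j * P + i \<longleftrightarrow> l = j \<and> k = i"
      proof
        assume eq: "l * P + k = j * P + i"
        have "(l * P + k) div P = l" "(j * P + i) div P = j" using \<open>k \<in> {..<P}\<close> True by auto
        with eq show "l = j \<and> k = i" by simp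
      qed auto
      thus "(if l * P + k = j * P + i then poly.coeff (poly.coeff R k) l else 0) =
        (if l = j \<and> k = i then poly.coeff (poly.coeff R k) l else 0)" by simp
    qed
    also have "\<dots> = (\<Sum>k<P. if k = i then (\<Sum>l\<le>degree (poly.coeff R k). if l = j then poly.coeff (poly.coeff R k) l else 0) else 0)"
      by (intro sum.cong) auto
    also have "\<dots> = poly.coeff (poly.coeff R i) j" using True by (simp add: sum.delta coeff_eq_0)
    finally show ?thesis by simp
  qed (use assms(1) in \<open>simp add: coeff_eq_0\<close>)
qed

section \<open>Stepanov's method\<close>

lemma order_poly_power: "(p :: 'a::idom poly) \<noteq> 0 \<Longrightarrow> Polynomial.order x (p ^ n) = n * Polynomial.order x p"
  by (induction n) (simp_all add: order_mult order_0I)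

text \<open>Treat \<open>x ^ P\<close> as a second variable \<open>z\<close>. Since
  \<open>f (x ^ P) = f ^ P\<close> and \<open>P = 1 + d * g\<close>, the polynomial
  \<open>f ^ g\<close> is a \<open>d\<close>-th root of \<open>f z / f x\<close>, and a vanishing
  sum is a relation of degree below \<open>d\<close> for this root. Its resultant has degree below
  \<open>P\<close> in \<open>x\<close>, hence vanishes even with \<open>x\<close> and
  \<open>z\<close> independent. Fixing \<open>x\<close> leaves a relation of degree below
  \<open>d\<close> for a \<open>d\<close>-th root of a multiple of \<open>f z\<close>. Kummer theory
  refutes it: by \<open>ord\<close>, no \<open>f ^ k\<close> with \<open>0 < k < d\<close> is a
  constant times a \<open>d\<close>-th power.\<close>

theorem stepanov_independent:
  fixes f :: "'a::alg_closed_field poly" and c :: "nat \<Rightarrow> nat \<Rightarrow> nat \<Rightarrow> 'a" and \<eta> :: 'a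
  assumes \<eta>: "\<eta> ^ d = 1" "\<And>i. 0 < i \<Longrightarrow> i < d \<Longrightarrow> \<eta> ^ i \<noteq> 1"
    and frob: "f \<circ>\<^sub>p Polynomial.monom 1 P = f ^ P" and P: "P = 1 + d * g" and "d * (A + degree f) \<le> P"
    and "f \<noteq> 0" and ord: "\<And>k. (\<And>x. d dvd k * Polynomial.order x f) \<Longrightarrow> d dvd k"
    and c: "b\<^sub>0 < d" "j\<^sub>0 < J" "i\<^sub>0 < A" "c b\<^sub>0 j\<^sub>0 i\<^sub>0 \<noteq> 0"
  shows "(\<Sum>b<d. \<Sum>j<J. \<Sum>i<A. Polynomial.monom (c b j i) (i + j * P) * f ^ (b * g)) \<noteq> 0"
proof
  assume zero: "(\<Sum>b<d. \<Sum>j<J. \<Sum>i<A. Polynomial.monom (c b j i) (i + j * P) * f ^ (b * g)) = 0"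
  have d: "d > 0" using c(1) by simp
  define pb :: "nat \<Rightarrow> 'a poly poly" where
    "pb b = (\<Sum>i<A. Polynomial.monom (\<Sum>j<J. Polynomial.monom (c b j i) j) i)" for b
  define p where "p = (\<Sum>b<d. Polynomial.monom (pb b) b)"
  have coeff_p: "poly.coeff p b = (if b < d then pb b else 0)" for b
    unfolding p_def by (auto simp: coeff_sum coeff_monom if_distrib sum.delta cong: if_cong)
  have "degree p \<le> d - 1" unfolding p_def
    by (intro degree_sum_le) (auto intro: order.trans[OF degree_monom_le])
  hence degp: "degree p < d" using d by simp
  have coeff_pb: "poly.coeff (pb b) i = (if i < A then \<Sum>j<J. Polynomial.monom (c b j i) j else 0)" for b i
    unfolding pb_def by (auto simp: coeff_sum coeff_monom if_distrib sum.delta cong: if_cong)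
  have pb0: "pb b\<^sub>0 \<noteq> 0"
  proof
    assume "pb b\<^sub>0 = 0"
    hence "poly.coeff (poly.coeff (pb b\<^sub>0) i\<^sub>0) j\<^sub>0 = 0" by simp
    thus False using c by (simp add: coeff_pb coeff_sum coeff_monom sum.delta)
  qed
  have degpb: "degree (pb b) \<le> A - 1" for b
    unfolding pb_def by (intro degree_sum_le) (auto intro: order.trans[OF degree_monom_le])
  define \<epsilon> :: "'a poly poly" where "\<epsilon> = [:[:\<eta>:]:]"
  have \<epsilon>_power: "\<epsilon> ^ k = [:[:\<eta> ^ k:]:]" for k unfolding \<epsilon>_def by (simp add: poly_const_pow)
  have \<epsilon>: "\<epsilon> ^ d = 1" "\<And>i. 0 < i \<Longrightarrow> i < d \<Longrightarrow> \<epsilon> ^ i \<noteq> 1"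
    using \<eta> by (auto simp: \<epsilon>_power one_pCons)
  \<comment> \<open>The inner variable stands for \<open>x ^ P\<close> and the outer one for
    \<open>x\<close>: \<open>F\<close> is \<open>f\<close> in the former, \<open>G\<close> is
    \<open>f\<close> in the latter.\<close>
  define F :: "'a poly poly" where "F = [:f:]"
  define G :: "'a poly poly" where "G = map_poly (\<lambda>a. [:a:]) f"
  define R where "R = kummer_resultant \<epsilon> d F G p"

  define \<sigma> :: "'a poly poly \<Rightarrow> 'a poly" where
    "\<sigma> R = poly (map_poly (\<lambda>c. c \<circ>\<^sub>p Polynomial.monom 1 P) R) [:0, 1:]" for R
  interpret \<sigma>: ring_map \<sigma>
    unfolding \<sigma>_def by (rule ring_map.ring_map_eval[OF ring_map_pcompose])
  have \<sigma>F: "\<sigma> F = f ^ P" by (simp add: \<sigma>_def F_def map_poly_pCons frob)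
  have \<sigma>G: "\<sigma> G = f"
    by (simp add: \<sigma>_def G_def map_poly_map_poly o_def flip: pcompose_altdef)
  have "\<sigma> (Polynomial.monom (Polynomial.monom a j) i) = Polynomial.monom a (i + j * P)" for a i j
  proof -
    have "Polynomial.monom a j \<circ>\<^sub>p Polynomial.monom 1 P = Polynomial.monom a (j * P)"
      by (simp add: pcompose_altdef map_poly_monom poly_monom monom_power smult_monom mult.commute)
    thus ?thesis
      by (simp add: \<sigma>_def map_poly_monom poly_monom monom_altdef[of 1, simplified, symmetric] mult_monom add.commute)
  qed
  hence \<sigma>pb: "\<sigma> (pb b) = (\<Sum>i<A. \<Sum>j<J. Polynomial.monom (c b j i) (i + j * P))" for b
    unfolding pb_def \<sigma>.sum
    by (intro sum.cong refl) (simp add: monom_sum \<sigma>.sum)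
  have "poly (map_poly \<sigma> p) (f ^ g) = (\<Sum>b<d. \<sigma> (pb b) * f ^ (b * g))"
    using poly_eq_sum_lessThan[OF le_less_trans[OF map_poly_degree_leq degp], of \<sigma> "f ^ g"]
    by (simp add: coeff_map_poly coeff_p power_mult[symmetric] mult.commute)
  also have "\<dots> = (\<Sum>b<d. \<Sum>j<J. \<Sum>i<A. Polynomial.monom (c b j i) (i + j * P) * f ^ (b * g))"
  proof (intro sum.cong refl)
    show "\<sigma> (pb b) * f ^ (b * g) = (\<Sum>j<J. \<Sum>i<A. Polynomial.monom (c b j i) (i + j * P) * f ^ (b * g))" for b
      unfolding \<sigma>pb sum_distrib_right by (rule sum.swap)
  qed
  finally have root: "poly (map_poly \<sigma> p) (f ^ g) = 0" using zero by simp
  have "\<sigma> R = \<sigma> G ^ (d - 1) * (\<Prod>j<d. poly (map_poly \<sigma> p) (\<sigma> \<epsilon> ^ j * f ^ g))"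
    unfolding R_def
    by (rule \<sigma>.kummer_resultant_eq[OF \<epsilon> degp])
      (simp_all add: \<sigma>F \<sigma>G P power_add power_mult[symmetric] mult.commute)
  also have "(\<Prod>j<d. poly (map_poly \<sigma> p) (\<sigma> \<epsilon> ^ j * f ^ g)) = 0"
    using d root by (intro prod_zero) (auto intro!: bexI[of _ 0])
  finally have "\<sigma> R = 0" by simp
  \<comment> \<open>Here \<open>d * (A + degree f) \<le> P\<close> enters; it makes the substitution
    of \<open>x ^ P\<close> injective on \<open>R\<close>.\<close>
  moreover have "degree R < P"
  proof -
    have "degree R < d * (A + degree f)"
      unfolding R_def
    proof (rule degree_kummer_resultant_less)
      show "degree (poly.coeff p k) < A" for k
        using degpb[of k] c(3) by (auto simp: coeff_p)
      show "degree G \<le> degree f" unfolding G_def by (rule map_poly_degree_leq)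
    qed (use d in \<open>auto simp: F_def \<epsilon>_def\<close>)
    thus ?thesis using assms(5) by simp
  qed
  ultimately have R0: "R = 0" unfolding \<sigma>_def by (intro subst_power_eq_0[of R P]) auto

  \<comment> \<open>Only finitely many values of the outer variable kill the coefficient
    \<open>pb b\<^sub>0\<close> or the polynomial \<open>f\<close>, and the field is
    infinite.\<close>
  have "finite {x. poly (pb b\<^sub>0) [:x:] = 0}"
  proof -
    have "finite {y. poly (pb b\<^sub>0) y = 0}" using pb0 by (rule poly_roots_finite)
    hence "finite ((\<lambda>x. [:x:]) -` {y. poly (pb b\<^sub>0) y = 0})" by (rule finite_vimageI) (auto intro: injI)
    thus ?thesis by (simp add: vimage_def)
  qed
  moreover have "finite {x. poly f x = 0}" using assms(6) by (rule poly_roots_finite)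
  ultimately obtain x0 where x0: "poly (pb b\<^sub>0) [:x0:] \<noteq> 0" "poly f x0 \<noteq> 0"
    using ex_new_if_finite[OF infinite_UNIV_alg_closed, of "{x. poly (pb b\<^sub>0) [:x:] = 0} \<union> {x. poly f x = 0}"]
    by auto
  \<comment> \<open>The outer variable is fixed at \<open>x0\<close>. Then \<open>F\<close> is still
    the polynomial \<open>f\<close>, now in a field of fractions, while \<open>G\<close> becomes a
    nonzero constant.\<close>
  define \<tau> :: "'a poly poly \<Rightarrow> 'a poly fract" where "\<tau> R = to_fract (poly R [:x0:])" for R
  interpret \<tau>: ring_map \<tau> unfolding \<tau>_def
    by (rule ring_map_comp[OF to_fract.ring_map_axioms ring_map_poly])
  define \<phi> where "\<phi> R = to_ac (\<tau> R)" for R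
  interpret \<phi>: ring_map \<phi> unfolding \<phi>_def
    by (rule ring_map_comp[OF to_ac.ring_map_axioms \<tau>.ring_map_axioms])
  have \<tau>F: "\<tau> F = to_fract f" by (simp add: \<tau>_def F_def)
  have \<tau>G: "\<tau> G = to_fract [:poly f x0:]"
    by (simp add: \<tau>_def G_def pcompose_pCons_0 flip: pcompose_altdef)
  have G0: "\<tau> G \<noteq> 0" and F0: "\<tau> F \<noteq> 0" using x0 assms(6) by (simp_all add: \<tau>G \<tau>F)
  obtain y where y: "y ^ d = to_ac (\<tau> F / \<tau> G)" using nth_root_exists[OF d] by blast
  have "\<phi> G * y ^ d = \<phi> F" using G0 by (simp add: y \<phi>_def)
  hence "\<phi> R = \<phi> G ^ (d - 1) * (\<Prod>j<d. poly (map_poly \<phi> p) (\<phi> \<epsilon> ^ j * y))"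
    unfolding R_def by (intro \<phi>.kummer_resultant_eq[OF \<epsilon> degp]) auto
  moreover have "\<phi> G \<noteq> 0" using G0 by (simp add: \<phi>_def)
  ultimately have "(\<Prod>j<d. poly (map_poly \<phi> p) (\<phi> \<epsilon> ^ j * y)) = 0" using R0 by simp
  then obtain j where j: "poly (map_poly \<phi> p) (\<phi> \<epsilon> ^ j * y) = 0" by auto
  define z where "z = \<phi> \<epsilon> ^ j * y"
  define e where "e = \<tau> F / \<tau> G"
  have "\<phi> \<epsilon> ^ d = 1" using \<epsilon>(1) by (metis \<phi>.one \<phi>.power)
  hence "(\<phi> \<epsilon> ^ j) ^ d = 1" by (metis mult.commute power_mult power_one)
  hence zd: "z ^ d = to_ac e" by (simp add: z_def y power_mult_distrib e_def)
  have "map_poly \<phi> p = map_poly to_ac (map_poly \<tau> p)"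
    by (simp add: map_poly_map_poly o_def \<phi>_def[abs_def])
  hence pz: "poly (map_poly to_ac (map_poly \<tau> p)) z = 0" using j by (simp add: z_def)
  have \<tau>\<epsilon>: "\<tau> \<epsilon> ^ i = to_fract [:\<eta> ^ i:]" for i
    by (simp add: \<tau>.power[symmetric] \<epsilon>_power) (simp add: \<tau>_def)
  have "poly.coeff (map_poly \<tau> p) b\<^sub>0 \<noteq> 0"
    using x0 c(1) by (simp add: coeff_map_poly coeff_p \<tau>_def)
  hence "map_poly \<tau> p \<noteq> 0" by auto
  moreover have "degree (map_poly \<tau> p) < d" using map_poly_degree_leq[of \<tau> p] degp by simp
  moreover have "\<tau> \<epsilon> ^ d = 1"
    using \<eta>(1) unfolding \<tau>\<epsilon> by (simp flip: one_pCons)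
  moreover have "\<tau> \<epsilon> ^ i \<noteq> 1" if "0 < i" "i < d" for i
    using \<eta>(2)[OF that] unfolding \<tau>\<epsilon> to_fract_eq_iff[where y=1, simplified] by (simp add: one_pCons)
  moreover have "e \<noteq> 0" using G0 F0 by (simp add: e_def)
  ultimately obtain k u where k: "0 < k" "k < d" "z ^ k = to_ac u"
    using kummer_power_in_base[of "\<tau> \<epsilon>" d z e "map_poly \<tau> p"] zd pz by metis
  obtain v w where vw: "u = to_fract v / to_fract w" "w \<noteq> 0"
    by (cases u) (auto simp: Fract_conv_to_fract)
  have "to_ac (e ^ k) = to_ac (u ^ d)" using zd k(3)
    by (metis mult.commute power_mult to_ac_power)
  hence "e ^ k = u ^ d" by (simp only: to_ac_eq_iff)
  hence "to_fract (f ^ k * w ^ d) = to_fract ([:poly f x0:] ^ k * v ^ d)"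
    using G0 vw(2) unfolding e_def vw(1) \<tau>F \<tau>G
    by (simp add: power_divide field_simps to_fract.power del: to_fract_eq_iff)
  hence eq: "f ^ k * w ^ d = [:poly f x0:] ^ k * v ^ d" by (simp only: to_fract_eq_iff)
  have const: "[:poly f x0:] ^ k = [:poly f x0 ^ k:]" by (simp add: poly_const_pow)
  have lhs0: "f ^ k * w ^ d \<noteq> 0" using assms(6) vw(2) by simp
  \<comment> \<open>Up to a constant, \<open>f ^ k\<close> is the \<open>d\<close>-th power of
    \<open>v / w\<close>; the orders at \<open>x\<close> are compared in the version without
    denominators.\<close>
  have "d dvd k * Polynomial.order x f" for x
  proof -
    have "k * Polynomial.order x f + d * Polynomial.order x w = d * Polynomial.order x v"
    proof -
      have "v \<noteq> 0" using eq lhs0 d by (auto simp: power_0_left)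
      have "Polynomial.order x (f ^ k * w ^ d) = k * Polynomial.order x f + d * Polynomial.order x w"
        using lhs0 assms(6) vw(2) by (simp add: order_mult order_poly_power)
      moreover have "Polynomial.order x ([:poly f x0:] ^ k * v ^ d) = d * Polynomial.order x v"
        unfolding const using x0(2) \<open>v \<noteq> 0\<close> by (simp add: order_smult order_poly_power)
      ultimately show ?thesis using eq by simp
    qed
    thus ?thesis by (metis dvd_add_times_triv_right_iff dvd_triv_left mult.commute)
  qed
  hence "d dvd k" by (rule ord)
  thus False using k by (auto dest: dvd_imp_le)
qed


text \<open>Gaussian elimination on the coefficient of largest admissible index, with one vector
  spent as pivot at each stage.\<close>

lemma nontrivial_linear_relation:
  fixes v :: "'i \<Rightarrow> 'a::field poly"
  assumes "finite I" and "card I > E" and "\<And>i k. i \<in> I \<Longrightarrow> k \<ge> E \<Longrightarrow> poly.coeff (v i) k = 0"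
  obtains c where "\<exists>i\<in>I. c i \<noteq> 0" and "(\<Sum>i\<in>I. smult (c i) (v i)) = 0"
  using assms
proof (induction E arbitrary: I v thesis)
  case 0
  have "v i = 0" if "i \<in> I" for i using 0(4)[OF that] by (intro poly_eqI) simp
  moreover have "I \<noteq> {}" using 0(3) by auto
  ultimately show ?case by (intro 0(1)[of "\<lambda>_. 1"]) auto
next
  case (Suc E)
  show ?case
  proof (cases "\<forall>i\<in>I. poly.coeff (v i) E = 0")
    case True
    have "poly.coeff (v i) k = 0" if "i \<in> I" "k \<ge> E" for i k
      using Suc(5)[of i k] True that by (cases "k = E") auto
    thus ?thesis using Suc(1)[OF Suc(2) Suc(3)] Suc(4) by simp
  next
    case False
    then obtain l where l: "l \<in> I" "poly.coeff (v l) E \<noteq> 0" by blast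
    define a where "a i = poly.coeff (v i) E / poly.coeff (v l) E" for i
    define w where "w i = v i - smult (a i) (v l)" for i
    have "poly.coeff (w i) k = 0" if "i \<in> I - {l}" "k \<ge> E" for i k
      using Suc(5)[of i k] Suc(5)[of l k] that l by (cases "k = E") (auto simp: w_def a_def)
    moreover have "finite (I - {l})" "card (I - {l}) > E" using Suc(3,4) l(1) by auto
    ultimately obtain c where c: "\<exists>i\<in>I - {l}. c i \<noteq> 0" "(\<Sum>i\<in>I - {l}. smult (c i) (w i)) = 0"
      using Suc(1)[of "I - {l}" w] by blast
    define c' where "c' i = (if i = l then - (\<Sum>i\<in>I - {l}. c i * a i) else c i)" for i
    have "(\<Sum>i\<in>I. smult (c' i) (v i)) = smult (c' l) (v l) + (\<Sum>i\<in>I - {l}. smult (c' i) (v i))"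
      using Suc(3) l(1) by (rule sum.remove)
    also have "(\<Sum>i\<in>I - {l}. smult (c' i) (v i)) =
        (\<Sum>i\<in>I - {l}. smult (c i) (w i)) + (\<Sum>i\<in>I - {l}. smult (c i * a i) (v l))"
      unfolding sum.distrib[symmetric]
      by (intro sum.cong) (auto simp: c'_def w_def smult_diff_right)
    also have "(\<Sum>i\<in>I - {l}. smult (c i * a i) (v l)) = smult (\<Sum>i\<in>I - {l}. c i * a i) (v l)"
      by (simp add: smult_sum)
    finally have "(\<Sum>i\<in>I. smult (c' i) (v i)) = 0" using c(2) by (simp add: c'_def)
    moreover have "\<exists>i\<in>I. c' i \<noteq> 0" using c(1) by (auto simp: c'_def)
    ultimately show ?thesis using Suc(2) by blast
  qed
qed

text \<open>Bombieri's version of Stepanov's method: on the fibre in question the \<open>P\<close>-th power of the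
  auxiliary polynomial \<open>h\<close> agrees with a polynomial of small degree, whose coefficients vanish by the
  choice of \<open>h\<close>.\<close>

theorem stepanov_bound:
  fixes f :: "'a::alg_closed_field poly" and \<eta> \<zeta> :: 'a
  assumes "prime CHAR('a)" and "P = CHAR('a) ^ l"
    and \<eta>: "\<eta> ^ d = 1" "\<And>i. 0 < i \<Longrightarrow> i < d \<Longrightarrow> \<eta> ^ i \<noteq> 1"
    and frob: "f \<circ>\<^sub>p Polynomial.monom 1 P = f ^ P" and P: "P = 1 + d * g" and "d > 0" and "g > 0"
    and A: "d * (A + degree f) \<le> P" and J: "A * P + degree f * P + J < d * J * A"
    and "f \<noteq> 0" and ord: "\<And>k. (\<And>x. d dvd k * Polynomial.order x f) \<Longrightarrow> d dvd k"
    and "\<zeta> \<noteq> 0"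
  shows "card {x. x ^ P\<^sup>2 = x \<and> poly f x ^ (g * (P + 1)) = \<zeta>} \<le> A + degree f * P + J * P"
proof -
  let ?m = "degree f"
  define I where "I = {..<d} \<times> {..<J} \<times> {..<A}"
  \<comment> \<open>On the fibre, the \<open>P\<close>-th power of
    \<open>x ^ (i + j * P) * f ^ (b * g)\<close>, multiplied by \<open>f ^ ((d - 1) * g)\<close>, is
    \<open>v (b, j, i)\<close>: the first condition reduces \<open>x ^ (j * P * P)\<close> to
    \<open>x ^ j\<close>, the second turns \<open>b\<close> copies of
    \<open>f ^ (g * (P + 1))\<close> into \<open>\<zeta> ^ b\<close>. The common factor keeps the
    remaining exponent of \<open>f\<close> nonnegative for every \<open>b\<close>.\<close>
  define v where "v = (\<lambda>(b, j, i). smult (\<zeta> ^ b) (Polynomial.monom 1 (i * P + j) * f ^ ((d - 1 - b) * g)))"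
  \<comment> \<open>The degrees in \<open>v\<close> stay below \<open>E\<close>: at most
    \<open>(A - 1) * P\<close> comes from \<open>i\<close>, less than \<open>J\<close> from
    \<open>j\<close>, and at most \<open>degree f * P\<close> from the power of \<open>f\<close>.
    The hypothesis \<open>J\<close> says that the unknowns outnumber the coefficients to be
    killed.\<close>
  define E where "E = A * P + ?m * P + J"
  have "finite I" "card I > E" using J by (auto simp: I_def E_def card_cartesian_product mult_ac)
  moreover have "poly.coeff (v x) k = 0" if x: "x \<in> I" and k: "k \<ge> E" for x k
  proof -
    obtain b j i where bji: "x = (b, j, i)" "b < d" "j < J" "i < A" using x by (auto simp: I_def)
    have "degree (f ^ ((d - 1 - b) * g)) \<le> ?m * ((d - 1 - b) * g)" by (rule degree_power_le)
    also have "\<dots> \<le> ?m * P" unfolding P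
      by (intro mult_left_mono trans_le_add2 mult_right_mono) auto
    finally have "degree (Polynomial.monom 1 (i * P + j) * f ^ ((d - 1 - b) * g)) \<le> i * P + j + ?m * P"
      by (intro order.trans[OF degree_mult_le] add_mono) (auto simp: degree_monom_eq)
    hence "degree (v x) \<le> i * P + j + ?m * P"
      unfolding v_def bji prod.case by (rule order.trans[OF degree_smult_le])
    also have "\<dots> < E"
    proof -
      have "(i + 1) * P \<le> A * P" using bji(4) by (intro mult_right_mono) auto
      thus ?thesis using bji(3) unfolding E_def by simp
    qed
    finally show ?thesis using k by (intro coeff_eq_0) simp
  qed
  ultimately obtain c' where c': "\<exists>x\<in>I. c' x \<noteq> 0" "(\<Sum>x\<in>I. smult (c' x) (v x)) = 0"
    using nontrivial_linear_relation[of I E v] by blast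
  have "P > 0" using P by simp
  \<comment> \<open>Raising \<open>h\<close> to the power \<open>P\<close> raises its coefficients
    to that power, so \<open>h\<close> is built from \<open>P\<close>-th roots of the
    solution.\<close>
  hence "\<exists>c. \<forall>x. c x ^ P = c' x" using nth_root_exists[of P] by (intro choice) blast
  then obtain c where c: "\<And>x. c x ^ P = c' x" by blast
  obtain b\<^sub>0 j\<^sub>0 i\<^sub>0 where nz: "b\<^sub>0 < d" "j\<^sub>0 < J" "i\<^sub>0 < A" "c' (b\<^sub>0, j\<^sub>0, i\<^sub>0) \<noteq> 0"
    using c'(1) by (auto simp: I_def)
  hence "c (b\<^sub>0, j\<^sub>0, i\<^sub>0) \<noteq> 0" using c[of "(b\<^sub>0, j\<^sub>0, i\<^sub>0)"] \<open>P > 0\<close> by (auto simp: power_0_left)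
  define h where "h = (\<Sum>b<d. \<Sum>j<J. \<Sum>i<A. Polynomial.monom (c (b, j, i)) (i + j * P) * f ^ (b * g))"
  have "h \<noteq> 0" unfolding h_def
    by (rule stepanov_independent[OF \<eta> frob P A \<open>f \<noteq> 0\<close> ord, where c = "\<lambda>b j i. c (b, j, i)"])
      (use nz \<open>c (b\<^sub>0, j\<^sub>0, i\<^sub>0) \<noteq> 0\<close> in auto)
  have "poly h x = 0" if x: "x ^ P\<^sup>2 = x" "poly f x ^ (g * (P + 1)) = \<zeta>" for x
  proof -
    define y where "y = poly f x"
    have y0: "y \<noteq> 0" using x(2) \<open>\<zeta> \<noteq> 0\<close> \<open>g > 0\<close> by (auto simp: y_def power_0_left)
    have hI: "h = (\<Sum>(b, j, i)\<in>I. Polynomial.monom (c (b, j, i)) (i + j * P) * f ^ (b * g))"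
      unfolding h_def I_def by (simp add: sum.cartesian_product)
    have "poly h x ^ P * y ^ ((d - 1) * g) =
        (\<Sum>(b, j, i)\<in>I. (c (b, j, i) * x ^ (i + j * P) * y ^ (b * g)) ^ P) * y ^ ((d - 1) * g)"
      unfolding hI poly_sum
      by (subst freshmans_dream_sum'[OF assms(1,2)]) (simp add: case_prod_unfold poly_monom y_def poly_power)
    also have "\<dots> = (\<Sum>x'\<in>I. poly (smult (c' x') (v x')) x)"
      unfolding sum_distrib_right
    proof (rule sum.cong[OF refl])
      fix x' assume "x' \<in> I"
      then obtain b j i where bji: "x' = (b, j, i)" "b < d" by (auto simp: I_def)
      have "x ^ (j * P * P) = x ^ j"
        using x(1) by (metis mult.assoc mult.commute power2_eq_square power_mult)
      hence 1: "(x ^ (i + j * P)) ^ P = x ^ (i * P + j)"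
        by (simp add: power_mult[symmetric] power_add algebra_simps)
      have "b * g * P + (d - 1) * g = b * g * P + (b + (d - 1 - b)) * g" using bji(2) by simp
      also have "\<dots> = (g * (P + 1)) * b + (d - 1 - b) * g" by (simp add: algebra_simps)
      finally have 2: "(y ^ (b * g)) ^ P * y ^ ((d - 1) * g) = \<zeta> ^ b * y ^ ((d - 1 - b) * g)"
        using x(2) by (simp add: y_def[symmetric] power_mult[symmetric] power_add[symmetric])
          (simp add: power_add power_mult)
      have "(c (b, j, i) * x ^ (i + j * P) * y ^ (b * g)) ^ P * y ^ ((d - 1) * g) =
          c' (b, j, i) * x ^ (i * P + j) * ((y ^ (b * g)) ^ P * y ^ ((d - 1) * g))"
        by (simp add: power_mult_distrib c 1)
      also have "\<dots> = poly (smult (c' x') (v x')) x"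
        unfolding 2 by (simp add: bji(1) v_def poly_monom y_def mult_ac)
      finally show "(case x' of (b, j, i) \<Rightarrow> (c (b, j, i) * x ^ (i + j * P) * y ^ (b * g)) ^ P) * y ^ ((d - 1) * g)
          = poly (smult (c' x') (v x')) x" by (simp add: bji(1))
    qed
    also have "\<dots> = poly (\<Sum>x'\<in>I. smult (c' x') (v x')) x" by (simp only: poly_sum)
    also have "\<dots> = 0" using c'(2) by simp
    finally show ?thesis using y0 by simp
  qed
  hence "{x. x ^ P\<^sup>2 = x \<and> poly f x ^ (g * (P + 1)) = \<zeta>} \<subseteq> {x. poly h x = 0}" by blast
  hence "card {x. x ^ P\<^sup>2 = x \<and> poly f x ^ (g * (P + 1)) = \<zeta>} \<le> card {x. poly h x = 0}"
    by (rule card_mono[OF poly_roots_finite[OF \<open>h \<noteq> 0\<close>]])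
  also have "\<dots> \<le> degree h" by (rule card_poly_roots_bound[OF \<open>h \<noteq> 0\<close>])
  also have "\<dots> \<le> A + ?m * P + J * P"
    unfolding h_def
  proof (intro degree_sum_le)
    fix b j i assume bji: "b \<in> {..<d}" "j \<in> {..<J}" "i \<in> {..<A}"
    have "degree (f ^ (b * g)) \<le> ?m * (b * g)" by (rule degree_power_le)
    also have "\<dots> \<le> ?m * P" unfolding P using bji(1)
      by (intro mult_left_mono trans_le_add2 mult_right_mono) auto
    finally have "degree (f ^ (b * g)) \<le> ?m * P" .
    moreover have "degree (Polynomial.monom (c (b, j, i)) (i + j * P)) \<le> A + J * P"
      using bji(2,3) by (intro order.trans[OF degree_monom_le] add_mono mult_right_mono) auto
    ultimately show "degree (Polynomial.monom (c (b, j, i)) (i + j * P) * f ^ (b * g)) \<le> A + ?m * P + J * P"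
      using degree_mult_le[of "Polynomial.monom (c (b, j, i)) (i + j * P)" "f ^ (b * g)"] by simp
  qed auto
  finally show ?thesis .
qed

section \<open>Finite subfields of an algebraically closed field\<close>

definition GF :: "nat \<Rightarrow> 'a::field set" where
  "GF q = {x. x ^ q = x}"

lemma zero_in_GF: "q > 0 \<Longrightarrow> 0 \<in> GF q"
  and one_in_GF: "1 \<in> GF q"
  and mult_in_GF: "x \<in> GF q \<Longrightarrow> y \<in> GF q \<Longrightarrow> x * y \<in> GF q"
  and inverse_in_GF: "x \<in> GF q \<Longrightarrow> inverse x \<in> GF q"
  and divide_in_GF: "x \<in> GF q \<Longrightarrow> y \<in> GF q \<Longrightarrow> x / y \<in> GF q"
  and power_in_GF: "x \<in> GF q \<Longrightarrow> x ^ k \<in> GF q"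
  and prod_in_GF: "(\<And>i. i \<in> I \<Longrightarrow> f i \<in> GF q) \<Longrightarrow> prod f I \<in> GF q"
  by (auto simp: GF_def power_mult_distrib power_inverse power_divide prod_power_distrib)
    (metis mult.commute power_mult)

lemma GF_iff: "q > 0 \<Longrightarrow> x \<in> GF q \<longleftrightarrow> x = 0 \<or> x ^ (q - 1) = (1::'a::field)"
  by (cases q) (auto simp: GF_def)

lemma finite_GF:
  assumes "q > 1"
  shows "finite (GF q :: 'a::field set)" and "card (GF q :: 'a set) \<le> q"
proof -
  let ?p = "Polynomial.monom 1 q - Polynomial.monom 1 1 :: 'a poly"
  have "poly.coeff ?p q = 1" using assms by simp
  hence p0: "?p \<noteq> 0" by (metis coeff_0 zero_neq_one)
  have deg: "degree ?p \<le> q"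
    using assms by (intro degree_diff_le) (auto simp: degree_monom_eq)
  have eq: "GF q = {x. poly ?p x = 0}" by (auto simp: GF_def poly_monom)
  show "finite (GF q :: 'a set)" unfolding eq by (rule poly_roots_finite[OF p0])
  show "card (GF q :: 'a set) \<le> q" unfolding eq using card_poly_roots_bound[OF p0] deg by linarith
qed

lemma GF_power: "x \<in> GF q \<Longrightarrow> x \<in> GF (q ^ k)"
  by (induction k) (auto simp: GF_def power_mult)

lemma order_linear_factor: "Polynomial.order x [:- y, 1:] = (if x = (y::'a::field) then 1 else 0)"
  using order_power_n_n[of y 1] by (auto intro!: order_0I)

lemma order_prod_mset_linear:
  "Polynomial.order x (\<Prod>x\<in>#A. [:- x, 1:]) = count A (x :: 'a::field)"
proof (induction A)
  case (add y A)
  have "[:- y, 1:] * (\<Prod>x\<in>#A. [:- x, 1:]) \<noteq> 0"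
    by (auto simp: prod_mset_zero_iff simp del: mult_pCons_left)
  from order_mult[OF this, of x] show ?case
    using add by (simp add: order_linear_factor del: mult_pCons_left)
qed (simp add: order_0I)

text \<open>As \<open>q\<close> is zero in the field, \<open>X ^ q - X\<close> has derivative
  \<open>- 1\<close>, so it has no multiple root.\<close>

lemma card_GF:
  assumes "q > 1" and "of_nat q = (0::'a::alg_closed_field)"
  shows "card (GF q :: 'a set) = q"
proof -
  let ?p = "Polynomial.monom 1 q - Polynomial.monom 1 1 :: 'a poly"
  have "poly.coeff ?p q = 1" using assms by simp
  hence p0: "?p \<noteq> 0" and le: "q \<le> degree ?p" by (metis coeff_0 zero_neq_one, metis le_degree zero_neq_one)
  have "degree ?p \<le> q"
    using assms by (intro degree_diff_le) (auto simp: degree_monom_eq)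
  with le have deg: "degree ?p = q" by simp
  have eq: "GF q = {x. poly ?p x = 0}" by (auto simp: GF_def poly_monom)
  have "pderiv ?p = - [:1:]"
    using assms by (simp add: pderiv_diff pderiv_monom monom_0)
  have ord_le: "Polynomial.order x ?p \<le> 1" for x
  proof (rule ccontr)
    assume "\<not> Polynomial.order x ?p \<le> 1"
    hence "[:- x, 1:] ^ 2 dvd ?p" using p0 by (subst order_divides) auto
    then obtain r where "?p = [:- x, 1:] ^ 2 * r" by (rule dvdE)
    hence "?p = [:- x, 1:] * ([:- x, 1:] * r)" by (simp only: power2_eq_square mult.assoc)
    hence "pderiv ?p = [:- x, 1:] * pderiv ([:- x, 1:] * r) + [:- x, 1:] * r * pderiv [:- x, 1:]"
      by (simp only: pderiv_mult)
    moreover have "poly [:- x, 1:] x = 0" by simp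
    ultimately have "poly (pderiv ?p) x = 0" by (simp only: poly_add poly_mult mult_zero_left add_0)
    thus False unfolding \<open>pderiv ?p = - [:1:]\<close> by simp
  qed
  obtain A where A: "size A = degree ?p" "?p = smult (lead_coeff ?p) (\<Prod>x\<in>#A. [:- x, 1:])"
    using alg_closed_imp_factorization[OF p0] by auto
  have lc: "lead_coeff ?p = 1" using deg \<open>poly.coeff ?p q = 1\<close> by simp
  have pA: "?p = (\<Prod>x\<in>#A. [:- x, 1:])" using A(2) unfolding lc by simp
  have "count A x \<le> 1" for x
  proof -
    have "Polynomial.order x ?p = count A x" by (subst pA) (rule order_prod_mset_linear)
    thus ?thesis using ord_le[of x] by simp
  qed
  hence "A = mset_set (set_mset A)"
    by (intro multiset_eqI) (metis One_nat_def Suc_leI count_greater_zero_iff count_mset_set(1,3) finite_set_mset le_antisym not_gr0 not_in_iff)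
  hence "card (set_mset A) = q" using A(1) deg by (metis size_mset_set)
  moreover have "set_mset A = {x. poly ?p x = 0}"
    unfolding pA poly_prod_mset by (auto simp: prod_mset_zero_iff image_iff)
  ultimately show ?thesis using eq by simp
qed

text \<open>The conditions on its powers make \<open>\<theta>\<close> a generator of the nonzero
  elements of \<open>GF q\<close>, so that characters can be given by discrete logarithms. All
  extensions of \<open>GF q\<close> are subsets of the one ambient type.\<close>

locale char2_field =
  fixes K :: nat and \<theta> :: "'a::alg_closed_field"
  assumes CHAR2: "CHAR('a) = 2" and K: "K > 0"
    and \<theta>_power: "\<theta> ^ (2 ^ K - 1) = 1"
    and \<theta>_prim: "0 < i \<Longrightarrow> i < 2 ^ K - 1 \<Longrightarrow> \<theta> ^ i \<noteq> 1"
begin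

definition q :: nat where "q = 2 ^ K"
definition n :: nat where "n = q - 1"

lemma q_gt_1: "q > 1" unfolding q_def using K by (rule one_less_power[rotated]) simp
lemma n_pos: "n > 0" using q_gt_1 by (simp add: n_def)
lemma q_eq: "q = n + 1" using q_gt_1 by (simp add: n_def)

lemma two_eq_0: "(2::'a) = 0"
  using of_nat_CHAR[where ?'a = 'a] unfolding CHAR2 by simp

lemma add_self [simp]: "x + x = (0::'a)"
  using two_eq_0 by (metis mult_2 mult_zero_left)

lemma minus_eq [simp]: "- x = (x::'a)"
  using add_self[of x] by (metis neg_eq_iff_add_eq_0)

lemma add_eq_0: "x + y = (0::'a) \<longleftrightarrow> x = y"
  by (metis add_self add_left_cancel)

lemma frobenius_add: "(x + y :: 'a) ^ (2 ^ k) = x ^ (2 ^ k) + y ^ (2 ^ k)"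
  using freshmans_dream'[where ?'a = 'a, of "2 ^ k" k x y] CHAR2 by simp

lemma frobenius_sum: "(sum f A :: 'a) ^ (2 ^ k) = (\<Sum>i\<in>A. f i ^ (2 ^ k))"
  using freshmans_dream_sum'[where ?'a = 'a, of "2 ^ k" k f A] CHAR2 by simp

lemma q_power: "q ^ k = 2 ^ (K * k)" by (simp add: q_def power_mult)

lemma add_in_GF: "x \<in> GF (2 ^ k) \<Longrightarrow> y \<in> GF (2 ^ k) \<Longrightarrow> (x + y :: 'a) \<in> GF (2 ^ k)"
  by (simp add: GF_def frobenius_add)

lemma card_GF_2: "k > 0 \<Longrightarrow> card (GF (2 ^ k) :: 'a set) = 2 ^ k"
  by (rule card_GF) (use one_less_power[of "2::nat" k] in \<open>simp_all add: two_eq_0 power_0_left\<close>)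

lemma finite_GF_2: "k > 0 \<Longrightarrow> finite (GF (2 ^ k) :: 'a set)"
  by (rule finite_GF) (use one_less_power[of "2::nat" k] in simp)

lemma card_GF_q: "card (GF q :: 'a set) = q"
  and finite_GF_q [simp]: "finite (GF q :: 'a set)"
  and add_in_GF_q: "x \<in> GF q \<Longrightarrow> y \<in> GF q \<Longrightarrow> (x + y :: 'a) \<in> GF q"
  using card_GF_2[OF K] finite_GF_2[OF K] add_in_GF[of x K y] by (simp_all add: q_def)

lemma zero_in_GF_q [simp]: "0 \<in> GF q"
  using q_gt_1 by (simp add: zero_in_GF)

lemma \<theta>_nz: "\<theta> \<noteq> 0"
  using \<theta>_power n_pos by (auto simp: n_def q_def power_0_left)

lemma \<theta>_power_n: "\<theta> ^ n = 1" using \<theta>_power by (simp add: n_def q_def)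

lemma \<theta>_power_mod: "\<theta> ^ (k mod n) = \<theta> ^ k"
  by (metis \<theta>_power_n mod_mult_div_eq mult.right_neutral power_add power_mult power_one)

lemma \<theta>_power_eq_1_iff: "\<theta> ^ k = 1 \<longleftrightarrow> n dvd k"
proof
  assume "\<theta> ^ k = 1"
  hence "\<theta> ^ (k mod n) = 1" by (simp add: \<theta>_power_mod)
  hence "k mod n = 0" using \<theta>_prim[of "k mod n"] n_pos
    by (metis bot_nat_0.not_eq_extremum mod_less_divisor n_def q_def)
  thus "n dvd k" by (simp add: dvd_eq_mod_eq_0)
qed (auto simp: power_mult \<theta>_power_n elim!: dvdE)

lemma \<theta>_power_eq_iff: "\<theta> ^ i = \<theta> ^ j \<longleftrightarrow> [i = j] (mod n)"
proof -
  have *: "\<theta> ^ i = \<theta> ^ j \<longleftrightarrow> [i = j] (mod n)" if "i \<le> j" for i j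
  proof -
    have "\<theta> ^ j = \<theta> ^ i * \<theta> ^ (j - i)" using that by (simp flip: power_add)
    hence "\<theta> ^ i = \<theta> ^ j \<longleftrightarrow> n dvd j - i" using \<theta>_nz \<theta>_power_eq_1_iff[of "j - i"] by auto
    thus ?thesis using that by (simp add: cong_altdef_nat cong_sym_eq[of i j])
  qed
  show ?thesis using *[of i j] *[of j i] by (metis cong_sym_eq nle_le)
qed

lemma \<theta>_power_in_GF: "\<theta> ^ i \<in> GF q"
  by (rule power_in_GF) (use \<theta>_power_n q_gt_1 in \<open>auto simp: GF_iff n_def\<close>)

lemma bij_betw_\<theta>: "bij_betw (\<lambda>i. \<theta> ^ i) {..<n} (GF q - {0})"
proof -
  have inj: "inj_on (\<lambda>i. \<theta> ^ i) {..<n}"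
    by (auto simp: inj_on_def \<theta>_power_eq_iff cong_less_modulus_unique_nat)
  moreover have "(\<lambda>i. \<theta> ^ i) ` {..<n} = GF q - {0}"
  proof (rule card_subset_eq)
    show "(\<lambda>i. \<theta> ^ i) ` {..<n} \<subseteq> GF q - {0}" using \<theta>_power_in_GF \<theta>_nz by auto
    show "card ((\<lambda>i. \<theta> ^ i) ` {..<n}) = card (GF q - {0} :: 'a set)"
      using card_image[OF inj] by (simp add: card_Diff_singleton card_GF_q n_def)
  qed simp
  ultimately show ?thesis by (simp add: bij_betw_def)
qed

section \<open>Multiplicative characters of \<open>GF q\<close>\<close>

definition dlog :: "'a \<Rightarrow> nat" where
  "dlog x = the_inv_into {..<n} (\<lambda>i. \<theta> ^ i) x"

lemma \<theta>_power_dlog: "x \<in> GF q \<Longrightarrow> x \<noteq> 0 \<Longrightarrow> \<theta> ^ dlog x = x"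
  unfolding dlog_def using bij_betw_\<theta>
  by (intro f_the_inv_into_f) (auto simp: bij_betw_def)

text \<open>The value at \<open>0\<close> is \<open>0\<close> even for the trivial character. This
  keeps \<open>chi_add\<close> valid at every point, at the price that the trivial character sums to
  \<open>n\<close> and not to \<open>q\<close>.\<close>

definition chi :: "int \<Rightarrow> 'a \<Rightarrow> complex" where
  "chi k x = (if x = 0 then 0 else cis (2 * pi * k * dlog x / n))"

lemma chi_0 [simp]: "chi k 0 = 0" by (simp add: chi_def)

lemma cis_periodic: "[i = j] (mod int n) \<Longrightarrow> cis (2 * pi * i / n) = cis (2 * pi * j / n)"
proof -
  assume "[i = j] (mod int n)"
  then obtain m where "j = i + int n * m" by (auto simp: cong_iff_lin)
  hence "2 * pi * j / n = 2 * pi * i / n + 2 * pi * m" using n_pos by (simp add: field_simps)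
  thus ?thesis by (simp add: cis_mult[symmetric] cis_multiple_2pi)
qed

lemma chi_\<theta>: "chi k (\<theta> ^ i) = cis (2 * pi * k * i / n)"
proof -
  have "\<theta> ^ dlog (\<theta> ^ i) = \<theta> ^ i" using \<theta>_power_dlog[OF \<theta>_power_in_GF] \<theta>_nz by simp
  hence "[int (dlog (\<theta> ^ i)) = int i] (mod int n)" by (simp add: \<theta>_power_eq_iff cong_int_iff)
  hence "[k * int (dlog (\<theta> ^ i)) = k * int i] (mod int n)" by (intro cong_mult) auto
  from cis_periodic[OF this] show ?thesis using \<theta>_nz by (simp add: chi_def mult_ac)
qed

lemma chi_mult:
  assumes "x \<in> GF q" and "y \<in> GF q"
  shows "chi k (x * y) = chi k x * chi k y"
proof (cases "x = 0 \<or> y = 0")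
  case False
  then obtain i j where "x = \<theta> ^ i" "y = \<theta> ^ j" using \<theta>_power_dlog assms by metis
  thus ?thesis
    by (simp add: chi_\<theta> cis_mult add_divide_distrib[symmetric] algebra_simps flip: power_add)
qed auto

lemma chi_1 [simp]: "chi k 1 = 1" using chi_\<theta>[of k 0] by simp

lemma chi_power: "x \<in> GF q \<Longrightarrow> chi k (x ^ m) = chi k x ^ m"
  by (induction m) (simp_all add: chi_mult power_in_GF)

lemma chi_add: "chi (k + l) x = chi k x * chi l x"
  by (simp add: chi_def cis_mult add_divide_distrib[symmetric] algebra_simps)

lemma chi_uminus: "chi (- k) x = cnj (chi k x)"
  by (simp add: chi_def cis_cnj)

lemma norm_chi: "x \<noteq> 0 \<Longrightarrow> norm (chi k x) = 1"
  by (simp add: chi_def)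

lemma chi_cong: "[k = l] (mod int n) \<Longrightarrow> chi k x = chi l x"
proof -
  assume "[k = l] (mod int n)"
  hence "[k * int (dlog x) = l * int (dlog x)] (mod int n)" by (intro cong_mult) auto
  from cis_periodic[OF this] show ?thesis by (simp add: chi_def mult_ac)
qed

lemma chi_inverse: "x \<in> GF q \<Longrightarrow> chi k (inverse x) = cnj (chi k x)"
proof (cases "x = 0")
  case False
  assume x: "x \<in> GF q"
  have "chi k x * chi k (inverse x) = 1"
    using chi_mult[OF x inverse_in_GF[OF x], of k] False by simp
  moreover have "chi k x * cnj (chi k x) = 1"
    using norm_chi[OF False, of k] by (simp add: complex_norm_square[symmetric])
  ultimately show ?thesis using norm_chi[OF False, of k]
    by (metis mult_left_cancel norm_zero zero_neq_one)
qed simp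

lemma chi_eq_1_iff: "chi k \<theta> = 1 \<longleftrightarrow> int n dvd k"
proof
  assume "chi k \<theta> = 1"
  hence "cis (2 * pi * k / n) = 1" using chi_\<theta>[of k 1] by simp
  hence "cos (2 * pi * k / n) = 1" by (simp add: complex_eq_iff)
  then obtain m :: int where "2 * pi * k / n = 2 * pi * m"
    by (auto simp: cos_one_2pi_int)
  hence "real_of_int k = real_of_int (int n * m)" using n_pos by (simp add: field_simps)
  thus "int n dvd k" unfolding of_int_eq_iff by simp
next
  assume "int n dvd k"
  hence "[k = 0] (mod int n)" by (simp add: cong_0_iff)
  from chi_cong[OF this, of \<theta>] show "chi k \<theta> = 1" using \<theta>_nz by (simp add: chi_def)
qed

end

section \<open>Character sums over extensions of even degree\<close>

context char2_field
begin

text \<open>The exponent is \<open>(q ^ \<nu> - 1) / (q - 1)\<close>, so on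
  \<open>GF (q ^ \<nu>)\<close> this is the norm to \<open>GF q\<close>.\<close>

definition Nm :: "nat \<Rightarrow> 'a \<Rightarrow> 'a" where
  "Nm \<nu> x = x ^ (\<Sum>i<\<nu>. q ^ i)"

lemma n_times_sum_q_powers: "n * (\<Sum>i<\<nu>. q ^ i) = q ^ \<nu> - 1"
proof -
  have "n * (\<Sum>i<\<nu>. q ^ i) + 1 = q ^ \<nu>"
    by (induction \<nu>) (simp_all add: q_eq algebra_simps)
  thus ?thesis by simp
qed

lemma Nm_eq_prod: "Nm \<nu> x = (\<Prod>i<\<nu>. x ^ (q ^ i))"
  by (simp add: Nm_def power_sum)

lemma Nm_in_GF: "x \<in> GF (q ^ \<nu>) \<Longrightarrow> Nm \<nu> x \<in> GF q"
proof -
  assume x: "x \<in> GF (q ^ \<nu>)"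
  have "q ^ \<nu> > 0" using q_gt_1 by simp
  hence "x = 0 \<or> x ^ (q ^ \<nu> - 1) = 1" using x by (simp add: GF_iff)
  thus ?thesis
  proof
    assume "x = 0"
    thus ?thesis by (cases "\<nu> = 0") (simp_all add: Nm_def one_in_GF power_0_left)
  next
    assume "x ^ (q ^ \<nu> - 1) = 1"
    hence "Nm \<nu> x ^ n = 1"
      unfolding Nm_def by (simp flip: power_mult add: mult.commute[of _ n] n_times_sum_q_powers)
    thus ?thesis using q_gt_1 by (simp add: GF_iff n_def)
  qed
qed

text \<open>The characters are lifted by the norm. For \<open>\<nu> = 1\<close> this is the sum in
  Weil's bound; all of them together are the power sums belonging to its L-function.\<close>

definition ext_sum :: "int \<Rightarrow> int \<Rightarrow> int \<Rightarrow> 'a \<Rightarrow> nat \<Rightarrow> complex" where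
  "ext_sum a b c v \<nu> =
     (\<Sum>u\<in>GF (q ^ \<nu>). chi a (Nm \<nu> u) * chi b (Nm \<nu> (u + 1)) * chi c (Nm \<nu> (u + v)))"

lemma chi_nat: "m > 0 \<Longrightarrow> chi (int m) x = chi 1 x ^ m"
  by (cases "x = 0") (simp_all add: chi_def Complex.DeMoivre power_0_left mult_ac)

lemma chi_nat_power: "m > 0 \<Longrightarrow> x \<in> GF q \<Longrightarrow> chi (int m) x = chi 1 (x ^ m)"
  by (simp add: chi_nat chi_power)

lemma order_linear_poly: "Polynomial.order x [:y, 1:] = (if x = (y::'a) then 1 else 0)"
proof (cases "x = y")
  case True
  thus ?thesis using order_power_n_n[of y 1] by simp
next
  case False
  thus ?thesis using add_eq_0[of y x] by (auto intro!: order_0I)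
qed

lemma linear_poly_frobenius:
  assumes "y \<in> GF (2 ^ k)"
  shows "[:y, 1:] \<circ>\<^sub>p Polynomial.monom 1 (2 ^ k) = ([:y, 1:] :: 'a poly) ^ (2 ^ k)"
proof -
  have "([:y, 1:] :: 'a poly) = [:y:] + Polynomial.monom 1 1"
    by (simp add: monom_Suc monom_0)
  hence "([:y, 1:] :: 'a poly) ^ (2 ^ k) = [:y:] ^ (2 ^ k) + Polynomial.monom 1 1 ^ (2 ^ k)"
    using freshmans_dream'[where ?'a = "'a poly", of "2 ^ k" k "[:y:]" "Polynomial.monom 1 1"] CHAR2
    by simp
  thus ?thesis using assms by (simp add: GF_def poly_const_pow monom_power pcompose_pCons)
qed

text \<open>Stepanov's method bounds each fibre of \<open>w\<close>, the power residue symbol of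
  \<open>f\<close>, by about \<open>P\<^sup>2 / d\<close> from above. The \<open>d\<close> fibres
  over nonzero values contain all but at most three points, so upper bounds for all of them also
  bound each from below. The constant depends on the order of the character but not on
  \<open>k\<close>, which is all that matters later.\<close>

lemma ext_sum_bound:
  assumes v: "v \<in> GF q" "v \<noteq> 0" "v \<noteq> 1" and b: "\<not> int n dvd b"
  shows "\<exists>C k\<^sub>0. \<forall>k\<ge>k\<^sub>0. norm (ext_sum a b c v (2 * k)) \<le> C * real q ^ k"
proof -
  \<comment> \<open>A positive representative of \<open>e\<close> modulo \<open>n\<close> is
    required: every character vanishes at \<open>0\<close>, even the trivial one, and a power of a
    linear factor imitates this only if its exponent is positive.\<close>
  define lift where "lift e = nat (e mod int n) + n" for e
  have lift_pos: "lift e > 0" for e using n_pos by (simp add: lift_def)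
  have "[int (lift e) = e] (mod int n)" for e
    using n_pos by (simp add: lift_def cong_def)
  hence lift: "chi e = chi (int (lift e))" for e using chi_cong by (metis ext)
  \<comment> \<open>Dividing by \<open>\<delta>\<close> leaves character values of order dividing
    \<open>d\<close>, and exponents \<open>a1\<close>, \<open>b1\<close>, \<open>c1\<close> that
    have jointly no factor in common with \<open>d\<close>. The latter is the condition
    \<open>ord\<close> of Stepanov's bound.\<close>
  define \<delta> where "\<delta> = gcd (gcd (lift a) (lift b)) (gcd (lift c) n)"
  have \<delta>_pos: "\<delta> > 0" using n_pos by (simp add: \<delta>_def)
  define d where "d = n div \<delta>"
  define a1 where "a1 = lift a div \<delta>"
  define b1 where "b1 = lift b div \<delta>"
  define c1 where "c1 = lift c div \<delta>"
  have dvd: "\<delta> dvd lift a" "\<delta> dvd lift b" "\<delta> dvd lift c" "\<delta> dvd n"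
    unfolding \<delta>_def by (meson dvd_trans gcd_dvd1 gcd_dvd2)+
  have eqs: "lift a = \<delta> * a1" "lift b = \<delta> * b1" "lift c = \<delta> * c1" "n = \<delta> * d"
    using dvd by (simp_all add: a1_def b1_def c1_def d_def)
  have pos: "a1 > 0" "b1 > 0" "c1 > 0" "d > 0"
    using eqs lift_pos[of a] lift_pos[of b] lift_pos[of c] n_pos by (auto intro: Nat.gr0I)
  have "\<not> n dvd \<delta>"
  proof
    assume "n dvd \<delta>"
    hence "n dvd lift b" using dvd(2) dvd_trans by blast
    hence "int n dvd int (lift b)" by simp
    thus False using b \<open>\<And>e. [int (lift e) = e] (mod int n)\<close>[of b] by (metis cong_dvd_iff cong_sym)
  qed
  have "\<delta> * gcd (gcd a1 b1) (gcd c1 d) = \<delta>"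
    by (simp only: gcd_mult_distrib_nat eqs[symmetric] \<delta>_def[symmetric])
  hence cop: "gcd (gcd a1 b1) (gcd c1 d) = 1" using \<delta>_pos by simp
  define \<eta> where "\<eta> = \<theta> ^ \<delta>"
  have \<eta>d: "\<eta> ^ d = 1" by (simp add: \<eta>_def eqs(4)[symmetric] \<theta>_power_n flip: power_mult)
  have \<eta>_prim: "\<eta> ^ i \<noteq> 1" if "0 < i" "i < d" for i
    using that \<delta>_pos unfolding \<eta>_def by (simp add: \<theta>_power_eq_1_iff eqs(4) nat_dvd_not_less flip: power_mult)
  have \<eta>_inj: "i = j" if "\<eta> ^ i = \<eta> ^ j" "i < d" "j < d" for i j
    using that \<delta>_pos unfolding \<eta>_def
    by (simp add: \<theta>_power_eq_iff eqs(4) flip: power_mult) (metis cong_less_modulus_unique_nat mult_less_cancel1 nat_mult_eq_cancel1)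
  have \<eta>_nz: "\<eta> \<noteq> 0" using \<theta>_nz by (simp add: \<eta>_def)
  define f :: "'a poly" where "f = [:0, 1:] ^ a1 * [:1, 1:] ^ b1 * [:v, 1:] ^ c1"
  have f0: "f \<noteq> 0" by (simp add: f_def)
  define m where "m = degree f"
  have f_eval: "poly f x = x ^ a1 * (x + 1) ^ b1 * (x + v) ^ c1" for x
    by (simp add: f_def poly_mult poly_power add.commute)
  have ord_f: "Polynomial.order x f = (if x = 0 then a1 else 0) + (if x = 1 then b1 else 0) + (if x = v then c1 else 0)" for x
    unfolding f_def by (simp add: order_mult order_poly_power order_linear_poly)
  have ord: "d dvd k" if "\<And>x. d dvd k * Polynomial.order x f" for k
  proof -
    have "d dvd k * a1" "d dvd k * b1" "d dvd k * c1"
      using that[of 0] that[of 1] that[of v] v by (simp_all add: ord_f)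
    hence "d dvd gcd (gcd (k * a1) (k * b1)) (gcd (k * c1) (k * d))" by simp
    also have "\<dots> = k * gcd (gcd a1 b1) (gcd c1 d)" by (simp only: gcd_mult_distrib_nat)
    finally show ?thesis using cop by simp
  qed
  define z where "z = chi 1 \<eta>"
  have z: "chi 1 (\<eta> ^ i) = z ^ i" for i
    using \<theta>_power_in_GF by (simp add: z_def \<eta>_def chi_power)
  \<comment> \<open>Since \<open>n\<close> does not divide \<open>b\<close>, it does not divide
    \<open>\<delta>\<close> either; so \<open>z\<close> is a \<open>d\<close>-th root of unity other
    than \<open>1\<close> and its powers cancel.\<close>
  have "z = chi (int \<delta>) \<theta>" unfolding z_def \<eta>_def
    using chi_nat_power[OF \<delta>_pos, of \<theta>] \<theta>_power_in_GF[of 1] by simp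
  hence "z \<noteq> 1" using chi_eq_1_iff[of "int \<delta>"] \<open>\<not> n dvd \<delta>\<close> by simp
  moreover have "z ^ d = 1" using z[of d] \<eta>d by simp
  ultimately have z_sum: "(\<Sum>i<d. z ^ i) = 0" by (simp add: sum_gp_strict)
  have z_norm: "norm (z ^ i) = 1" for i unfolding z[symmetric] using \<eta>_nz by (intro norm_chi) auto

  define C where "C = real (d * (m + 2 * m + 6) + 4)"
  have "norm (ext_sum a b c v (2 * k)) \<le> C * real q ^ k" if k: "k \<ge> 4 * d * (m + 3)" for k
  proof -
    define P where "P = q ^ k"
    define g where "g = (P - 1) div d"
    have "k < 2 ^ k" by simp
    also have "2 ^ k \<le> P" unfolding P_def using q_gt_1 by (intro power_mono) auto
    finally have Pk: "P > k" .
    have "k > 0" using k pos by (intro Nat.gr0I) auto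
    have "n dvd P - 1" unfolding P_def by (metis dvd_triv_left n_times_sum_q_powers)
    hence "d dvd P - 1" using eqs(4) by (metis dvd_mult_right)
    hence Pg: "P = 1 + d * g" using Pk by (simp add: g_def)
    have g: "g > 0" using Pg Pk \<open>k > 0\<close> by (intro Nat.gr0I) auto
    have P2: "q ^ (2 * k) = P\<^sup>2" by (simp add: P_def power_mult[symmetric] mult.commute)
    \<comment> \<open>Both sides are \<open>(P\<^sup>2 - 1) / d\<close>: the norm has exponent
      \<open>(P\<^sup>2 - 1) / n\<close>, and \<open>n = \<delta> * d\<close>.\<close>
    have expo: "\<delta> * (\<Sum>i<2*k. q ^ i) = g * (P + 1)"
    proof -
      have "d * (\<delta> * (\<Sum>i<2*k. q ^ i)) = q ^ (2 * k) - 1"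
        using n_times_sum_q_powers[of "2 * k"] eqs(4) by (simp add: mult_ac)
      also have "\<dots> = (P - 1) * (P + 1)" unfolding P2
        by (simp add: power2_eq_square algebra_simps)
      also have "\<dots> = d * (g * (P + 1))" by (simp add: Pg algebra_simps)
      finally show ?thesis using pos by simp
    qed
    define w where "w x = poly f x ^ (g * (P + 1))" for x
    let ?X = "GF (P\<^sup>2) :: 'a set"
    have PX: "P\<^sup>2 = 2 ^ (K * (2 * k))" unfolding P2[symmetric] by (rule q_power)
    have finX: "finite ?X" and cardX: "card ?X = P\<^sup>2"
      unfolding PX using K \<open>k > 0\<close> by (simp_all add: finite_GF_2 card_GF_2)
    have v2: "v \<in> ?X" and one2: "1 \<in> ?X"
      using GF_power[OF v(1), of "2 * k"] one_in_GF by (auto simp: P2)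
    have S: "ext_sum a b c v (2 * k) = (\<Sum>x\<in>?X. chi 1 (w x))"
      unfolding ext_sum_def P2
    proof (rule sum.cong[OF refl])
      fix x assume x: "x \<in> ?X"
      have x1: "x + 1 \<in> ?X" and xv: "x + v \<in> ?X"
        using x v2 one2 unfolding PX by (auto intro: add_in_GF)
      have *: "Nm (2 * k) y \<in> GF q" if "y \<in> ?X" for y using Nm_in_GF[of y "2 * k"] that by (simp add: P2)
      have "chi a (Nm (2 * k) x) * chi b (Nm (2 * k) (x + 1)) * chi c (Nm (2 * k) (x + v)) =
          chi 1 (Nm (2 * k) x ^ lift a * Nm (2 * k) (x + 1) ^ lift b * Nm (2 * k) (x + v) ^ lift c)"
        using *[OF x] *[OF x1] *[OF xv] lift_pos
        by (simp add: lift[of a] lift[of b] lift[of c] chi_nat_power chi_mult power_in_GF mult_in_GF)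
      also have "Nm (2 * k) x ^ lift a * Nm (2 * k) (x + 1) ^ lift b * Nm (2 * k) (x + v) ^ lift c =
          poly f x ^ (\<delta> * (\<Sum>i<2*k. q ^ i))"
        unfolding eqs f_eval Nm_def by (simp add: power_mult_distrib mult_ac flip: power_mult)
      finally show "chi a (Nm (2 * k) x) * chi b (Nm (2 * k) (x + 1)) * chi c (Nm (2 * k) (x + v)) = chi 1 (w x)"
        unfolding w_def expo .
    qed
    have w_cases: "(\<exists>i<d. w x = \<eta> ^ i)" if "x \<in> ?X" "poly f x \<noteq> 0" for x
    proof -
      have fx: "poly f x \<in> ?X" unfolding f_eval using that(1) one2 v2 PX
        by (auto intro!: mult_in_GF power_in_GF) (metis add_in_GF)+
      have "w x ^ d = poly f x ^ (P\<^sup>2 - 1)"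
      proof -
        have "g * (P + 1) * d = P\<^sup>2 - 1" unfolding Pg by (simp add: power2_eq_square algebra_simps)
        thus ?thesis by (simp add: w_def flip: power_mult)
      qed
      also have "\<dots> = 1" using fx that(2) Pk by (simp add: GF_iff)
      finally show ?thesis using roots_of_unity_powers[OF pos(4) \<eta>d \<eta>_prim] by metis
    qed
    have w0: "w x = 0" if "poly f x = 0" for x using that g by (simp add: w_def power_0_left)
    have w_sum: "(\<Sum>i<d. if w x = \<eta> ^ i then h i else 0) = h j" if "j < d" "w x = \<eta> ^ j" for x j and h :: "nat \<Rightarrow> complex"
    proof -
      have "(\<Sum>i<d. if w x = \<eta> ^ i then h i else 0) = (\<Sum>i<d. if i = j then h i else 0)"
        using that \<eta>_inj by (intro sum.cong) auto
      thus ?thesis using that(1) by simp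
    qed
    define N where "N i = card {x \<in> ?X. w x = \<eta> ^ i}" for i
    have fiber: "(\<Sum>x\<in>?X. \<Sum>i<d. if w x = \<eta> ^ i then h i else 0) = (\<Sum>i<d. of_nat (N i) * h i)" for h :: "nat \<Rightarrow> complex"
      unfolding N_def by (subst sum.swap) (simp add: finX flip: sum.inter_filter)
    have S2: "(\<Sum>x\<in>?X. chi 1 (w x)) = (\<Sum>i<d. of_nat (N i) * z ^ i)"
      unfolding fiber[symmetric]
    proof (rule sum.cong[OF refl])
      fix x assume x: "x \<in> ?X"
      show "chi 1 (w x) = (\<Sum>i<d. if w x = \<eta> ^ i then z ^ i else 0)"
      proof (cases "poly f x = 0")
        case True
        thus ?thesis using w0[OF True] \<eta>_nz by simp
      next
        case False
        then obtain j where "j < d" "w x = \<eta> ^ j" using w_cases[OF x] by blast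
        thus ?thesis using w_sum[of j x "\<lambda>i. z ^ i"] z[of j] by simp
      qed
    qed
    have sumN: "real (P\<^sup>2) - 3 \<le> (\<Sum>i<d. real (N i))"
    proof -
      have "complex_of_real (\<Sum>i<d. real (N i)) = (\<Sum>x\<in>?X. \<Sum>i<d. if w x = \<eta> ^ i then 1 else 0)"
        using fiber[of "\<lambda>_. 1"] by simp
      also have "\<dots> = (\<Sum>x\<in>?X. if poly f x = 0 then 0 else 1)"
      proof (rule sum.cong[OF refl])
        fix x assume x: "x \<in> ?X"
        show "(\<Sum>i<d. if w x = \<eta> ^ i then 1 else 0) = (if poly f x = 0 then 0 else 1 :: complex)"
          using w_cases[OF x] w_sum[of _ x "\<lambda>_. 1"] w0[of x] \<eta>_nz by auto
      qed
      also have "\<dots> = (\<Sum>x\<in>{x \<in> ?X. poly f x \<noteq> 0}. 1)"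
        by (rule sum.mono_neutral_cong_right) (auto simp: finX)
      also have "\<dots> = of_nat (card {x \<in> ?X. poly f x \<noteq> 0})" by simp
      finally have "(\<Sum>i<d. real (N i)) = real (card {x \<in> ?X. poly f x \<noteq> 0})"
        by (metis of_real_eq_iff of_real_of_nat_eq)
      moreover have "P\<^sup>2 \<le> card {x \<in> ?X. poly f x \<noteq> 0} + 3"
      proof -
        have "{x \<in> ?X. poly f x \<noteq> 0} = ?X - {0, 1, v}"
          unfolding f_eval using pos by (auto simp: add_eq_0)
        moreover have "card ?X - card {0, 1, v} \<le> card (?X - {0, 1, v})"
          by (rule diff_card_le_card_Diff) simp
        moreover have "card {0, 1, v} \<le> 3" by (simp add: card_insert_if)
        ultimately show ?thesis using cardX by simp
      qed
      ultimately show ?thesis by linarith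
    qed
    \<comment> \<open>With \<open>A\<close> near \<open>P / (2 * d)\<close>, half of
      \<open>P\<close> is left for the degree of \<open>f\<close> in \<open>hA\<close>. Then
      \<open>d * g * A\<close> nearly pays for \<open>A * P\<close>, and the surplus
      \<open>2 * m + 6\<close> in \<open>J\<close> adds \<open>(m + 3) * (2 * d * A)\<close>, about
      \<open>(m + 3) * P\<close>, which outweighs \<open>m * P + J\<close>. As \<open>J\<close>
      exceeds \<open>g\<close> by a constant only, \<open>d * J * P\<close> is
      \<open>P\<^sup>2 + O(P)\<close>.\<close>
    define A where "A = P div (2 * d)"
    define J where "J = g + (2 * m + 6)"
    have "P = 2 * d * A + P mod (2 * d)" unfolding A_def by (simp only: mult_div_mod_eq)
    moreover have "P mod (2 * d) < 2 * d" using pos by simp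
    ultimately have A1: "2 * d * A \<le> P" and A2: "P < 2 * d * A + 2 * d" by linarith+
    have big: "4 * d * m + 12 * d \<le> P" using k Pk by (simp add: algebra_simps)
    have hA: "d * (A + degree f) \<le> P" using A1 big by (simp add: m_def[symmetric] algebra_simps)
    have hJ: "A * P + degree f * P + J < d * J * A"
    proof -
      have le_d: "x \<le> d * x" for x using pos by (cases d) auto
      have gP: "g \<le> P" unfolding Pg using le_d[of g] by linarith
      have AP: "2 * A \<le> P" using le_d[of "2 * A"] A1 by (simp only: mult_ac)
      have "m + 3 \<le> d * m + 3 * d" using le_d[of m] le_d[of 3] by linarith
      have "(m + 3) * P \<le> (m + 3) * (2 * d * A + 2 * d)" using A2 by (intro mult_left_mono) auto
      hence 1: "m * P + 3 * P \<le> (m + 3) * (2 * d * A) + 2 * (d * m) + 6 * d" by (simp add: algebra_simps)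
      have "d * J * A = d * g * A + (m + 3) * (2 * d * A)" by (simp add: J_def algebra_simps)
      also have "d * g = P - 1" by (simp add: Pg)
      finally have "d * J * A = (P - 1) * A + (m + 3) * (2 * d * A)" .
      moreover have "(P - 1) * A + A = P * A" using Pk by (cases P) auto
      ultimately have 2: "d * J * A + A = P * A + (m + 3) * (2 * d * A)" by linarith
      show ?thesis using 1 2 gP AP big \<open>m + 3 \<le> d * m + 3 * d\<close> Pk
        unfolding J_def m_def[symmetric] by (simp add: mult.commute[of A P] mult.assoc)
    qed
    define B where "B = A + m * P + J * P"
    have NB: "N i \<le> B" for i
    proof -
      have "\<eta> ^ i \<noteq> 0" using \<eta>_nz by simp
      have Pl: "P = CHAR('a) ^ (K * k)" by (simp add: P_def q_power CHAR2)
      have fr: "f \<circ>\<^sub>p Polynomial.monom 1 P = f ^ P"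
      proof -
        have P_eq: "P = 2 ^ (K * k)" by (simp add: P_def q_power)
        have lin: "[:y, 1:] \<circ>\<^sub>p Polynomial.monom 1 P = ([:y, 1:] :: 'a poly) ^ P" if "y \<in> GF q" for y
          unfolding P_eq using GF_power[OF that, of k] by (intro linear_poly_frobenius) (simp add: q_power)
        have "(x ^ P) ^ e = (x ^ e) ^ P" for x :: "'a poly" and e
          by (simp only: power_mult[symmetric] mult.commute)
        thus ?thesis unfolding f_def
          by (simp only: pcompose_mult ring_map.power[OF ring_map_pcompose] power_mult_distrib
              lin[OF v(1)] lin[OF one_in_GF] lin[OF zero_in_GF_q])
      qed
      have "card {x. x ^ P\<^sup>2 = x \<and> poly f x ^ (g * (P + 1)) = \<eta> ^ i} \<le> A + degree f * P + J * P"
        by (rule stepanov_bound[OF _ Pl \<eta>d \<eta>_prim fr Pg pos(4) g hA hJ f0 ord \<open>\<eta> ^ i \<noteq> 0\<close>])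
          (auto simp: CHAR2)
      thus ?thesis unfolding N_def B_def w_def GF_def m_def by simp
    qed
    \<comment> \<open>Subtracting \<open>B\<close> times the vanishing sum makes all coefficients
      nonpositive. Their absolute values then add up to \<open>d * B\<close> minus the number of
      points, which is \<open>O(P)\<close>.\<close>
    have "(\<Sum>i<d. of_nat (N i) * z ^ i) = (\<Sum>i<d. of_nat (N i) * z ^ i) - of_nat B * (\<Sum>i<d. z ^ i)"
      by (simp add: z_sum)
    also have "\<dots> = (\<Sum>i<d. (of_nat (N i) - of_nat B) * z ^ i)"
      by (simp add: sum_distrib_left sum_subtractf algebra_simps)
    also have "norm \<dots> \<le> (\<Sum>i<d. real B - real (N i))"
    proof (rule sum_norm_le)
      fix i
      have "norm ((of_nat (N i) - of_nat B) * z ^ i :: complex) = \<bar>real (N i) - real B\<bar>"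
        using z_norm[of i] by (metis mult.right_neutral norm_mult norm_of_real of_real_diff of_real_of_nat_eq)
      thus "norm ((of_nat (N i) - of_nat B) * z ^ i :: complex) \<le> real B - real (N i)"
        using NB[of i] by simp
    qed
    also have "\<dots> = real (d * B) - (\<Sum>i<d. real (N i))" by (simp add: sum_subtractf)
    also have "\<dots> \<le> real (d * B) - real (P\<^sup>2) + 3" using sumN by simp
    also have "\<dots> \<le> C * real P"
    proof -
      have "d * B = d * A + d * m * P + (d * g) * P + d * (2 * m + 6) * P"
        by (simp add: B_def J_def algebra_simps)
      also have "\<dots> \<le> P + d * m * P + P * P + d * (2 * m + 6) * P"
      proof -
        have "d * A \<le> P" using A1 by simp
        moreover have "d * g * P \<le> P * P" unfolding Pg by (intro mult_right_mono) auto
        ultimately show ?thesis by linarith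
      qed
      finally have "d * B + 3 \<le> P\<^sup>2 + (d * (m + 2 * m + 6) + 4) * P" using Pk
        by (simp add: algebra_simps power2_eq_square)
      hence "real (d * B + 3) \<le> real (P\<^sup>2 + (d * (m + 2 * m + 6) + 4) * P)" by (simp only: of_nat_le_iff)
      thus ?thesis by (simp add: C_def)
    qed
    finally show ?thesis unfolding S S2 by (simp add: P_def)
  qed
  thus ?thesis by blast
qed

end

section \<open>The Weil bound for character sums\<close>

lemma alg_closed_root_multiset:
  fixes p :: "'a::alg_closed_field poly"
  assumes "p \<noteq> 0"
  obtains A where "p = smult (lead_coeff p) (\<Prod>x\<in>#A. [:- x, 1:])" and "size A = degree p"
    and "\<And>x. count A x = Polynomial.order x p"
proof -
  obtain A where A: "size A = degree p" "p = smult (lead_coeff p) (\<Prod>x\<in>#A. [:- x, 1:])"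
    using alg_closed_imp_factorization[OF assms] by auto
  have "Polynomial.order x p = count A x" for x
    using assms by (subst A(2)) (simp add: order_smult order_prod_mset_linear)
  thus ?thesis using that A by metis
qed

text \<open>Both polynomials split, so divisibility is inclusion of their multisets of
  roots.\<close>

lemma dvd_if_order_le:
  fixes p g :: "'a::alg_closed_field poly"
  assumes "p \<noteq> 0" and "g \<noteq> 0" and "\<And>x. Polynomial.order x p \<le> Polynomial.order x g"
  shows "p dvd g"
proof -
  obtain A where A: "p = smult (lead_coeff p) (\<Prod>x\<in>#A. [:- x, 1:])" "\<And>x. count A x = Polynomial.order x p"
    using alg_closed_root_multiset[OF assms(1)] by metis
  obtain B where B: "g = smult (lead_coeff g) (\<Prod>x\<in>#B. [:- x, 1:])" "\<And>x. count B x = Polynomial.order x g"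
    using alg_closed_root_multiset[OF assms(2)] by metis
  have "A \<subseteq># B" using assms(3) by (simp add: subseteq_mset_def A(2) B(2))
  hence "(\<Prod>x\<in>#A. [:- x, 1:]) dvd (\<Prod>x\<in>#B. [:- x, 1:])"
    by (intro prod_mset_subset_imp_dvd image_mset_subseteq_mono)
  hence "smult (lead_coeff p) (\<Prod>x\<in>#A. [:- x, 1:]) dvd smult (lead_coeff g) (\<Prod>x\<in>#B. [:- x, 1:])"
    using assms(1) by (simp add: smult_dvd_iff dvd_smult)
  thus ?thesis using A(1) B(1) by simp
qed

lemma sum_order_eq_degree:
  fixes p :: "'a::alg_closed_field poly"
  assumes "p \<noteq> 0"
  shows "(\<Sum>x | poly p x = 0. Polynomial.order x p) = degree p"
proof -
  obtain A where A: "size A = degree p" "\<And>x. count A x = Polynomial.order x p"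
    using alg_closed_root_multiset[OF assms] by metis
  have "set_mset A = {x. poly p x = 0}"
    using assms by (auto simp: A(2) order_root simp flip: count_greater_zero_iff)
  thus ?thesis using A by (simp add: size_multiset_overloaded_eq)
qed

text \<open>The danger is cancellation between \<open>z ^ k\<close> and \<open>w ^ k\<close>. Twice
  \<open>(z * w) ^ k\<close> is the square of the power sum for \<open>k\<close> minus the power sum
  for \<open>2 * k\<close>, so \<open>z * w\<close> lies in the unit disc. If \<open>z\<close> were
  outside, then \<open>w\<close> would be inside, and \<open>z ^ k\<close> alone would be
  bounded.\<close>

lemma bounded_power_sum_imp_norm_le_1:
  fixes z w :: complex
  assumes "\<And>k. k \<ge> k\<^sub>0 \<Longrightarrow> norm (z ^ k + w ^ k) \<le> C"
  shows "norm z \<le> 1"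
proof (rule ccontr)
  have bdd: "x \<le> 1" if "\<And>k. k \<ge> k\<^sub>0 \<Longrightarrow> x ^ k \<le> M" for x M :: real
  proof (rule ccontr)
    assume "\<not> x \<le> 1"
    then obtain k where "M < x ^ k" using real_arch_pow[of x M] by auto
    also have "\<dots> \<le> x ^ max k k\<^sub>0" using \<open>\<not> x \<le> 1\<close> by (intro power_increasing) auto
    also have "\<dots> \<le> M" by (rule that) simp
    finally show False by simp
  qed
  assume z: "\<not> norm z \<le> 1"
  have "norm (z * w) \<le> 1"
  proof (rule bdd)
    fix k assume k: "k \<ge> k\<^sub>0"
    have sq: "2 * (a * b) = (a + b)\<^sup>2 - (a\<^sup>2 + b\<^sup>2)" for a b :: complex
      by (simp add: power2_eq_square algebra_simps)
    have "2 * (z * w) ^ k = (z ^ k + w ^ k) ^ 2 - (z ^ (2 * k) + w ^ (2 * k))"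
      unfolding power_mult_distrib power_even_eq by (rule sq)
    hence "norm (2 * (z * w) ^ k) \<le> norm (z ^ k + w ^ k) ^ 2 + norm (z ^ (2 * k) + w ^ (2 * k))"
      by (metis norm_power norm_triangle_ineq4)
    also have "\<dots> \<le> C ^ 2 + C" using assms[OF k] assms[of "2 * k"] k by (intro add_mono power_mono) auto
    finally show "norm (z * w) ^ k \<le> C ^ 2 + C"
      by (simp add: norm_mult norm_power) (smt (verit) norm_ge_zero mult_nonneg_nonneg zero_le_power)
  qed
  hence w: "norm w \<le> 1" using z by (simp add: norm_mult)
    (smt (verit) mult_le_cancel_right1 norm_ge_zero)
  have "norm z \<le> 1"
  proof (rule bdd)
    fix k assume k: "k \<ge> k\<^sub>0"
    have "norm (z ^ k) \<le> norm (z ^ k + w ^ k) + norm (w ^ k)"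
      by (metis add_diff_cancel_right' norm_triangle_ineq4)
    also have "norm (w ^ k) \<le> 1" using w by (simp add: norm_power power_le_one)
    finally show "norm z ^ k \<le> C + 1" using assms[OF k] by (simp add: norm_power)
  qed
  thus False using z by simp
qed

section \<open>Polynomials over \<open>GF q\<close> and Frobenius orbits of their roots\<close>

context char2_field
begin

lemma sum_chi_eq_0:
  assumes "\<not> int n dvd b"
  shows "(\<Sum>x\<in>GF q. chi b x) = 0"
proof -
  have "\<theta> \<in> GF q" using \<theta>_power_in_GF[of 1] by simp
  have "(\<Sum>x\<in>GF q. chi b x) = (\<Sum>x\<in>GF q. chi b (\<theta> * x))"
    by (rule sum.reindex_bij_witness[of _ "\<lambda>x. \<theta> * x" "\<lambda>x. x / \<theta>"])
      (use \<theta>_nz \<open>\<theta> \<in> GF q\<close> in \<open>auto intro: mult_in_GF divide_in_GF\<close>)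
  also have "\<dots> = chi b \<theta> * (\<Sum>x\<in>GF q. chi b x)"
    unfolding sum_distrib_left by (intro sum.cong) (auto simp: chi_mult \<open>\<theta> \<in> GF q\<close>)
  finally have "(1 - chi b \<theta>) * (\<Sum>x\<in>GF q. chi b x) = 0" by (simp add: algebra_simps)
  thus ?thesis using assms chi_eq_1_iff[of b] by simp
qed

lemma ring_map_frobenius: "ring_map (\<lambda>x::'a. x ^ q)"
  by standard (simp_all add: q_def frobenius_add power_mult_distrib)

definition over_GF :: "'a poly \<Rightarrow> bool" where
  "over_GF g \<longleftrightarrow> (\<forall>i. poly.coeff g i \<in> GF q)"

lemma over_GF_iff: "over_GF g \<longleftrightarrow> map_poly (\<lambda>x. x ^ q) g = g"
  unfolding over_GF_def poly_eq_iff using q_gt_1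
  by (auto simp: coeff_map_poly GF_def)

lemma frobenius_root:
  assumes "over_GF g"
  shows "poly g (x ^ q) = poly g x ^ q"
  using ring_map.poly_map_poly[OF ring_map_frobenius, of g x] assms by (simp add: over_GF_iff)

lemma poly_in_GF: "over_GF g \<Longrightarrow> y \<in> GF q \<Longrightarrow> poly g y \<in> GF q"
  using frobenius_root[of g y] by (simp add: GF_def)

lemma over_GF_mult: "over_GF g \<Longrightarrow> over_GF h \<Longrightarrow> over_GF (g * h)"
  by (simp add: over_GF_iff ring_map.map_poly_mult[OF ring_map_frobenius])

lemma over_GF_add: "over_GF g \<Longrightarrow> over_GF h \<Longrightarrow> over_GF (g + h)"
  by (simp add: over_GF_iff ring_map.map_poly_add[OF ring_map_frobenius])

lemma over_GF_smult: "over_GF g \<Longrightarrow> y \<in> GF q \<Longrightarrow> over_GF (smult y g)"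
  by (simp add: over_GF_def mult_in_GF)

lemma over_GF_cancel:
  assumes "over_GF g" and "over_GF (g * h)" and "g \<noteq> 0"
  shows "over_GF h"
proof -
  have "g * map_poly (\<lambda>x. x ^ q) h = g * h"
    using assms by (simp add: over_GF_iff ring_map.map_poly_mult[OF ring_map_frobenius])
  thus ?thesis using assms(3) by (simp add: over_GF_iff)
qed

lemma frobenius_inj: "(x::'a) ^ q ^ k = y ^ q ^ k \<Longrightarrow> x = y"
proof -
  assume "x ^ q ^ k = y ^ q ^ k"
  hence "(x + y) ^ q ^ k = 0" unfolding q_power frobenius_add by simp
  hence "x + y = 0" by simp
  thus ?thesis by (simp add: add_eq_0)
qed

text \<open>The characteristic polynomial of \<open>u\<close> over \<open>GF q\<close>.\<close>

definition cyc :: "nat \<Rightarrow> 'a \<Rightarrow> 'a poly" where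
  "cyc \<nu> u = (\<Prod>i<\<nu>. [:u ^ q ^ i, 1:])"

lemma cyc_nz: "cyc \<nu> u \<noteq> 0" by (simp add: cyc_def)

lemma degree_cyc: "degree (cyc \<nu> u) = \<nu>"
  unfolding cyc_def by (subst degree_prod_eq_sum_degree) auto

lemma lead_coeff_cyc: "lead_coeff (cyc \<nu> u) = 1"
  unfolding cyc_def by (simp add: lead_coeff_prod)

lemma poly_cyc:
  assumes "y \<in> GF q"
  shows "poly (cyc \<nu> u) y = Nm \<nu> (u + y)"
proof -
  have "poly (cyc \<nu> u) y = (\<Prod>i<\<nu>. u ^ q ^ i + y ^ q ^ i)"
    using GF_power[OF assms] by (simp add: cyc_def poly_prod GF_def)
  thus ?thesis by (simp add: Nm_eq_prod q_power frobenius_add)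
qed

lemma over_GF_cyc:
  assumes "u \<in> GF (q ^ \<nu>)"
  shows "over_GF (cyc \<nu> u)"
proof (cases "\<nu> = 0")
  case True
  thus ?thesis by (auto simp: cyc_def over_GF_def coeff_1 one_in_GF)
next
  case False
  have "map_poly (\<lambda>x. x ^ q) (cyc \<nu> u) = (\<Prod>i<\<nu>. [:u ^ q ^ Suc i, 1:])"
    using q_gt_1 unfolding cyc_def ring_map.map_poly_prod[OF ring_map_frobenius]
    by (simp add: map_poly_pCons power_mult[symmetric] mult.commute)
  also have "\<dots> = (\<Prod>i\<in>{1..\<nu>}. [:u ^ q ^ i, 1:])"
    by (rule prod.reindex_bij_witness[of _ "\<lambda>i. i - 1" Suc]) auto
  also have "{1..\<nu>} = insert \<nu> {1..<\<nu>}" using False by auto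
  also have "(\<Prod>i\<in>insert \<nu> {1..<\<nu>}. [:u ^ q ^ i, 1:]) = (\<Prod>i\<in>insert 0 {1..<\<nu>}. [:u ^ q ^ i, 1:])"
    using assms by (simp add: GF_def)
  also have "insert 0 {1..<\<nu>} = {..<\<nu>}" using False by auto
  finally show ?thesis by (simp add: over_GF_iff cyc_def)
qed

text \<open>Frobenius on the coefficients fixes \<open>g\<close> and moves each linear factor from
  \<open>x\<close> to \<open>x ^ q\<close>, so it permutes the multiset of roots.\<close>

lemma order_frobenius:
  assumes "over_GF g" and "g \<noteq> 0"
  shows "Polynomial.order (u ^ q) g = Polynomial.order u g"
proof -
  interpret fr: ring_map "\<lambda>x::'a. x ^ q" by (rule ring_map_frobenius)
  have inj: "inj (\<lambda>x::'a. x ^ q)" using frobenius_inj[of _ 1] by (auto intro: injI)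
  obtain A where A: "g = smult (lead_coeff g) (\<Prod>x\<in>#A. [:- x, 1:])" "\<And>x. count A x = Polynomial.order x g"
    using alg_closed_root_multiset[OF assms(2)] by metis
  have lin: "map_poly (\<lambda>x. x ^ q) [:- x, 1:] = [:- (x ^ q), 1:]" for x :: 'a
    using q_gt_1 by (simp add: map_poly_pCons)
  have "map_poly (\<lambda>x. x ^ q) (\<Prod>x\<in>#B. [:- x, 1:]) = (\<Prod>x\<in>#image_mset (\<lambda>x. x ^ q) B. [:- x, 1:])" for B :: "'a multiset"
    by (induction B) (simp_all only: image_mset_add_mset prod_mset.add_mset fr.map_poly_mult lin,
      simp_all)
  hence "g = smult (lead_coeff g ^ q) (\<Prod>x\<in>#image_mset (\<lambda>x. x ^ q) A. [:- x, 1:])"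
    using assms(1) A(1) q_gt_1 unfolding over_GF_iff by (metis (no_types, lifting) fr.zero map_poly_smult fr.mult)
  moreover have "lead_coeff g ^ q \<noteq> 0" using assms(2) by simp
  ultimately have "Polynomial.order (u ^ q) g = count (image_mset (\<lambda>x. x ^ q) A) (u ^ q)"
    by (metis order_smult order_prod_mset_linear)
  also have "\<dots> = count A u"
    by (induction A) (auto dest: frobenius_inj[of _ 1 _, simplified])
  finally show ?thesis by (simp add: A(2))
qed

end

context char2_field
begin

text \<open>The number \<open>e\<close> is the degree of \<open>u\<close> over \<open>GF q\<close>,
  obtained as the length of the Frobenius orbit. The orbit is finite because it stays among the
  roots of \<open>g\<close>, and injectivity of Frobenius makes it purely periodic.\<close>

lemma period_exists:
  assumes "over_GF g" and "g \<noteq> 0" and "poly g u = 0"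
  obtains e where "e > 0" and "\<And>\<nu>. u \<in> GF (q ^ \<nu>) \<longleftrightarrow> e dvd \<nu>"
    and "inj_on (\<lambda>i. u ^ q ^ i) {..<e}"
proof -
  have roots: "poly g (u ^ q ^ i) = 0" for i
  proof (induction i)
    case (Suc i)
    have "poly g ((u ^ q ^ i) ^ q) = 0" using frobenius_root[OF assms(1), of "u ^ q ^ i"] Suc q_gt_1
      by (simp add: power_0_left)
    thus ?case by (simp add: mult.commute flip: power_mult)
  qed (use assms(3) in simp)
  have shift: "u = u ^ q ^ (j - i)" if "i \<le> j" "u ^ q ^ i = u ^ q ^ j" for i j
  proof -
    have "u ^ q ^ j = (u ^ q ^ (j - i)) ^ q ^ i" using that(1) by (simp flip: power_mult power_add)
    thus ?thesis using that(2) frobenius_inj by metis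
  qed
  have "\<not> inj (\<lambda>i. u ^ q ^ i)"
  proof
    assume "inj (\<lambda>i. u ^ q ^ i)"
    moreover have "finite (range (\<lambda>i. u ^ q ^ i))"
      using poly_roots_finite[OF assms(2)] roots by (elim finite_subset[rotated]) auto
    ultimately show False by (metis finite_imageD infinite_UNIV_nat)
  qed
  then obtain i j where "i < j" "u ^ q ^ i = u ^ q ^ j"
    unfolding inj_def by (metis linorder_neqE_nat)
  hence ex: "\<exists>e. e > 0 \<and> u ^ q ^ e = u" using shift[of i j] by (metis less_imp_le zero_less_diff)
  define e where "e = (LEAST e. e > 0 \<and> u ^ q ^ e = u)"
  have e: "e > 0" "u ^ q ^ e = u" using LeastI_ex[OF ex] by (simp_all add: e_def)
  have least: "\<not> (0 < i \<and> u ^ q ^ i = u)" if "i < e" for i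
    using that unfolding e_def by (rule not_less_Least)
  have mult: "u ^ q ^ (e * t + s) = u ^ q ^ s" for t s
  proof (induction t)
    case (Suc t)
    have "u ^ q ^ (e * Suc t + s) = (u ^ q ^ e) ^ q ^ (e * t + s)"
      by (simp add: algebra_simps flip: power_mult power_add)
    thus ?case using Suc e by simp
  qed simp
  have "u \<in> GF (q ^ \<nu>) \<longleftrightarrow> e dvd \<nu>" for \<nu>
  proof -
    have "u ^ q ^ \<nu> = u ^ q ^ (\<nu> mod e)" using mult[of "\<nu> div e" "\<nu> mod e"] by simp
    moreover have "\<nu> mod e < e" using e(1) by simp
    ultimately show ?thesis using least[of "\<nu> mod e"] by (auto simp: GF_def mod_eq_0_iff_dvd)
  qed
  moreover have "inj_on (\<lambda>i. u ^ q ^ i) {..<e}"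
  proof (rule inj_onI)
    have *: "i = j" if "i \<le> j" "j < e" "u ^ q ^ i = u ^ q ^ j" for i j
    proof (rule ccontr)
      assume "i \<noteq> j"
      moreover have "j - i < e" using that(2) by simp
      ultimately show False using least[of "j - i"] shift[OF that(1,3)] that(1) by simp
    qed
    show "i = j" if "i \<in> {..<e}" "j \<in> {..<e}" "u ^ q ^ i = u ^ q ^ j" for i j
      using *[of i j] *[of j i] that by (metis lessThan_iff nle_le)
  qed
  ultimately show ?thesis using that e(1) by blast
qed

lemma order_prod_linear:
  fixes h :: "'i \<Rightarrow> 'a"
  shows "finite I \<Longrightarrow> Polynomial.order x (\<Prod>i\<in>I. [:h i, 1:]) = card {i \<in> I. h i = x}"
proof (induction I rule: finite_induct)
  case (insert i I)
  have "[:h i, 1:] * (\<Prod>i\<in>I. [:h i, 1:]) \<noteq> 0" using insert by (simp del: mult_pCons_left)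
  from order_mult[OF this, of x]
  have "Polynomial.order x (\<Prod>i\<in>insert i I. [:h i, 1:]) = (if x = h i then 1 else 0) + card {i \<in> I. h i = x}"
    using insert by (simp add: order_linear_poly del: mult_pCons_left)
  moreover have "{j \<in> insert i I. h j = x} = (if x = h i then insert i {j \<in> I. h j = x} else {j \<in> I. h j = x})"
    by auto
  ultimately show ?case using insert by simp
qed (simp add: order_0I)

text \<open>If \<open>e\<close> is the degree of \<open>u\<close>, only multiples
  \<open>\<nu> = e * t\<close> are possible, and \<open>cyc (e * t) u\<close> is the
  \<open>t\<close>-th power of the minimal polynomial of \<open>u\<close>. All conjugates of
  \<open>u\<close> are roots of \<open>g\<close> of the same multiplicity, so this power divides
  \<open>g\<close> exactly when \<open>t\<close> is at most that multiplicity.\<close>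

lemma card_cyc_dvd_orders:
  assumes "over_GF g" and "g \<noteq> 0" and "poly g u = 0"
  shows "card {\<nu> \<in> {1..degree g}. u \<in> GF (q ^ \<nu>) \<and> cyc \<nu> u dvd g} = Polynomial.order u g"
proof -
  obtain e where e: "e > 0" "\<And>\<nu>. u \<in> GF (q ^ \<nu>) \<longleftrightarrow> e dvd \<nu>" "inj_on (\<lambda>i. u ^ q ^ i) {..<e}"
    using period_exists[OF assms] by metis
  define m where "m = Polynomial.order u g"
  have ord: "Polynomial.order (u ^ q ^ i) g = m" for i
  proof (induction i)
    case (Suc i)
    have "u ^ q ^ Suc i = (u ^ q ^ i) ^ q" by (simp add: mult.commute flip: power_mult)
    thus ?case using order_frobenius[OF assms(1,2), of "u ^ q ^ i"] Suc by simp
  qed (simp add: m_def)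
  have cyc_add: "cyc (e + \<nu>) u = cyc e u * cyc \<nu> u" for \<nu>
  proof -
    have "u ^ q ^ e = u" using e(2)[of e] by (simp add: GF_def)
    hence "u ^ q ^ (e + i) = u ^ q ^ i" for i by (simp add: power_add power_mult)
    thus ?thesis by (induction \<nu>) (simp_all add: cyc_def mult_ac del: mult_pCons_left mult_pCons_right)
  qed
  have cyc_power: "cyc (e * t) u = cyc e u ^ t" for t
    by (induction t) (simp add: cyc_def, simp add: cyc_add)
  have ord_cyc: "Polynomial.order x (cyc e u) = (if x \<in> (\<lambda>i. u ^ q ^ i) ` {..<e} then 1 else 0)" for x
  proof -
    have "Polynomial.order x (cyc e u) = card {i \<in> {..<e}. u ^ q ^ i = x}"
      unfolding cyc_def by (rule order_prod_linear) simp
    also have "\<dots> = (if x \<in> (\<lambda>i. u ^ q ^ i) ` {..<e} then 1 else 0)"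
    proof (cases "x \<in> (\<lambda>i. u ^ q ^ i) ` {..<e}")
      case True
      then obtain i where "i < e" "x = u ^ q ^ i" by auto
      hence "{i \<in> {..<e}. u ^ q ^ i = x} = {i}" using e(3) by (auto dest: inj_onD)
      thus ?thesis using True by simp
    next
      case False
      hence "{i \<in> {..<e}. u ^ q ^ i = x} = {}" by auto
      thus ?thesis using False by (simp only: card.empty if_False)
    qed
    finally show ?thesis .
  qed
  have dvd_iff: "cyc (e * t) u dvd g \<longleftrightarrow> t \<le> m" for t
  proof
    assume "cyc (e * t) u dvd g"
    hence "Polynomial.order u (cyc (e * t) u) \<le> Polynomial.order u g"
      by (rule dvd_imp_order_le[OF assms(2)])
    moreover have "u \<in> (\<lambda>i. u ^ q ^ i) ` {..<e}" using e(1) by (intro image_eqI[of _ _ 0]) auto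
    ultimately show "t \<le> m" by (simp add: cyc_power order_poly_power cyc_nz ord_cyc m_def)
  next
    assume t: "t \<le> m"
    show "cyc (e * t) u dvd g"
      by (rule dvd_if_order_le) (use t ord in \<open>auto simp: cyc_power order_poly_power cyc_nz ord_cyc assms(2)\<close>)
  qed
  have "{\<nu> \<in> {1..degree g}. u \<in> GF (q ^ \<nu>) \<and> cyc \<nu> u dvd g} = (\<lambda>t. e * t) ` {1..m}" (is "?L = ?R")
  proof (intro equalityI subsetI)
    fix \<nu> assume \<nu>: "\<nu> \<in> ?L"
    then obtain t where t: "\<nu> = e * t" using e(2) by (auto elim: dvdE)
    hence "t \<le> m" "t \<ge> 1" using \<nu> dvd_iff[of t] by (auto intro: Suc_leI Nat.gr0I)
    thus "\<nu> \<in> ?R" using t by auto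
  next
    fix \<nu> assume "\<nu> \<in> ?R"
    then obtain t where "\<nu> = e * t" "t \<in> {1..m}" by blast
    hence t: "\<nu> = e * t" "1 \<le> t" "t \<le> m" by auto
    have "cyc \<nu> u dvd g" using dvd_iff[of t] t by simp
    moreover have "\<nu> \<le> degree g"
      using dvd_imp_degree_le[OF \<open>cyc \<nu> u dvd g\<close> assms(2)] by (simp add: degree_cyc)
    ultimately show "\<nu> \<in> ?L" using t e by simp
  qed
  moreover have "card ((\<lambda>t. e * t) ` {1..m}) = m" using e(1) by (subst card_image) (auto simp: inj_on_def)
  ultimately show ?thesis by (simp add: m_def)
qed

text \<open>Each root is counted as often as its multiplicity. This replaces unique factorisation
  over \<open>GF q\<close>: it is the logarithmic derivative of the Euler product, read off for a
  single \<open>g\<close>.\<close>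

lemma sum_card_cyc_dvd:
  assumes "over_GF g" and "g \<noteq> 0"
  shows "(\<Sum>\<nu>\<in>{1..degree g}. card {u \<in> GF (q ^ \<nu>). cyc \<nu> u dvd g}) = degree g"
proof -
  let ?R = "{u. poly g u = 0}"
  have fin: "finite ?R" using assms(2) by (rule poly_roots_finite)
  have "{u \<in> GF (q ^ \<nu>). cyc \<nu> u dvd g} = {u \<in> ?R. u \<in> GF (q ^ \<nu>) \<and> cyc \<nu> u dvd g}" if "\<nu> \<ge> 1" for \<nu>
  proof -
    have "poly g u = 0" if "cyc \<nu> u dvd g" for u
    proof -
      have "poly (cyc \<nu> u) u = 0" using \<open>\<nu> \<ge> 1\<close>
        unfolding cyc_def poly_prod by (intro prod_zero bexI[of _ 0]) auto
      thus ?thesis using that by (auto elim!: dvdE)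
    qed
    thus ?thesis by auto
  qed
  hence "(\<Sum>\<nu>\<in>{1..degree g}. card {u \<in> GF (q ^ \<nu>). cyc \<nu> u dvd g}) =
      (\<Sum>\<nu>\<in>{1..degree g}. \<Sum>u\<in>?R. if u \<in> GF (q ^ \<nu>) \<and> cyc \<nu> u dvd g then 1 else 0)"
    using fin by (intro sum.cong) (simp_all flip: sum.inter_filter)
  also have "\<dots> = (\<Sum>u\<in>?R. card {\<nu> \<in> {1..degree g}. u \<in> GF (q ^ \<nu>) \<and> cyc \<nu> u dvd g})"
    by (subst sum.swap) (simp flip: sum.inter_filter)
  also have "\<dots> = (\<Sum>u\<in>?R. Polynomial.order u g)"
    using card_cyc_dvd_orders[OF assms] by (intro sum.cong) auto
  also have "\<dots> = degree g" by (rule sum_order_eq_degree[OF assms(2)])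
  finally show ?thesis .
qed

section \<open>The L-function of the character sum\<close>

definition monic_polys :: "nat \<Rightarrow> 'a poly set" where
  "monic_polys k = {g. degree g = k \<and> lead_coeff g = 1 \<and> over_GF g}"

lemma finite_monic_polys: "finite (monic_polys k)"
proof -
  have "monic_polys k \<subseteq> Poly ` {xs. set xs \<subseteq> GF q \<and> length xs = Suc k}"
  proof
    fix g assume g: "g \<in> monic_polys k"
    hence "g \<noteq> 0" by (auto simp: monic_polys_def)
    hence "length (coeffs g) = Suc k" using g by (simp add: length_coeffs monic_polys_def)
    moreover have "set (coeffs g) \<subseteq> GF q"
    proof
      fix x assume "x \<in> set (coeffs g)"
      hence "x \<in> range (poly.coeff g)" by (simp add: range_coeff)
      thus "x \<in> GF q" using g by (auto simp: monic_polys_def over_GF_def)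
    qed
    ultimately show "g \<in> Poly ` {xs. set xs \<subseteq> GF q \<and> length xs = Suc k}"
      by (intro image_eqI[of _ _ "coeffs g"]) auto
  qed
  moreover have "finite {xs. set xs \<subseteq> (GF q :: 'a set) \<and> length xs = Suc k}"
    by (rule finite_lists_length_eq) simp
  ultimately show ?thesis by (metis finite_imageI finite_subset)
qed

text \<open>A completely multiplicative function on polynomials over \<open>GF q\<close>. At
  \<open>cyc \<nu> u\<close> it takes the summand of \<open>ext_sum\<close> belonging to
  \<open>u\<close>, which ties the coefficients \<open>lcoeff\<close> of its L-function to these
  sums.\<close>

definition lfun :: "int \<Rightarrow> int \<Rightarrow> int \<Rightarrow> 'a \<Rightarrow> 'a poly \<Rightarrow> complex" where
  "lfun a b c v g = chi a (poly g 0) * chi b (poly g 1) * chi c (poly g v)"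

definition lcoeff :: "int \<Rightarrow> int \<Rightarrow> int \<Rightarrow> 'a \<Rightarrow> nat \<Rightarrow> complex" where
  "lcoeff a b c v k = (\<Sum>g\<in>monic_polys k. lfun a b c v g)"

lemma lfun_mult:
  assumes "over_GF g" and "over_GF h" and "v \<in> GF q"
  shows "lfun a b c v (g * h) = lfun a b c v g * lfun a b c v h"
  unfolding lfun_def using assms by (simp add: chi_mult poly_in_GF one_in_GF)

lemma lfun_cyc:
  "v \<in> GF q \<Longrightarrow> lfun a b c v (cyc \<nu> u) = chi a (Nm \<nu> u) * chi b (Nm \<nu> (u + 1)) * chi c (Nm \<nu> (u + v))"
  by (simp add: lfun_def poly_cyc one_in_GF)

text \<open>Coefficientwise this says that \<open>T * L' / L\<close> is the generating series of
  \<open>ext_sum\<close>. The factor \<open>k\<close> is expanded as the number of pairs of \<nu>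
  and \<open>u\<close> with \<open>cyc \<nu> u\<close> dividing \<open>g\<close>; writing
  \<open>g\<close> as \<open>cyc \<nu> u * h\<close> and using multiplicativity then separates the
  sums.\<close>

lemma newton_identity:
  assumes v: "v \<in> GF q"
  shows "of_nat k * lcoeff a b c v k = (\<Sum>\<nu>\<in>{1..k}. ext_sum a b c v \<nu> * lcoeff a b c v (k - \<nu>))"
proof -
  have MP: "over_GF g" "g \<noteq> 0" "degree g = k" if "g \<in> monic_polys k" for g k
    using that by (auto simp: monic_polys_def)
  have finF: "finite (GF (q ^ \<nu>) :: 'a set)" if "\<nu> \<ge> 1" for \<nu>
    using finite_GF_2[of "K * \<nu>"] that K by (simp add: q_power)
  have "of_nat k * lcoeff a b c v k =
      (\<Sum>g\<in>monic_polys k. of_nat (\<Sum>\<nu>\<in>{1..k}. card {u \<in> GF (q ^ \<nu>). cyc \<nu> u dvd g}) * lfun a b c v g)"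
    unfolding lcoeff_def sum_distrib_left
  proof (rule sum.cong[OF refl])
    fix g assume g: "g \<in> monic_polys k"
    show "of_nat k * lfun a b c v g =
        of_nat (\<Sum>\<nu>\<in>{1..k}. card {u \<in> GF (q ^ \<nu>). cyc \<nu> u dvd g}) * lfun a b c v g"
      using sum_card_cyc_dvd[OF MP(1,2)[OF g]] MP(3)[OF g] by simp
  qed
  also have "\<dots> = (\<Sum>g\<in>monic_polys k. \<Sum>\<nu>\<in>{1..k}. \<Sum>u\<in>GF (q ^ \<nu>). if cyc \<nu> u dvd g then lfun a b c v g else 0)"
    unfolding of_nat_sum sum_distrib_right
    by (intro sum.cong refl) (simp add: finF flip: sum.inter_filter)
  also have "\<dots> = (\<Sum>\<nu>\<in>{1..k}. \<Sum>g\<in>monic_polys k. \<Sum>u\<in>GF (q ^ \<nu>). if cyc \<nu> u dvd g then lfun a b c v g else 0)"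
    by (rule sum.swap)
  also have "\<dots> = (\<Sum>\<nu>\<in>{1..k}. ext_sum a b c v \<nu> * lcoeff a b c v (k - \<nu>))"
  proof (rule sum.cong[OF refl])
    fix \<nu> assume \<nu>: "\<nu> \<in> {1..k}"
    have "(\<Sum>g\<in>monic_polys k. \<Sum>u\<in>GF (q ^ \<nu>). if cyc \<nu> u dvd g then lfun a b c v g else 0) =
        (\<Sum>u\<in>GF (q ^ \<nu>). \<Sum>g\<in>{g \<in> monic_polys k. cyc \<nu> u dvd g}. lfun a b c v g)"
      by (subst sum.swap) (simp add: finite_monic_polys flip: sum.inter_filter)
    also have "\<dots> = (\<Sum>u\<in>GF (q ^ \<nu>). lfun a b c v (cyc \<nu> u) * lcoeff a b c v (k - \<nu>))"
    proof (rule sum.cong[OF refl])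
      fix u :: 'a assume u: "u \<in> GF (q ^ \<nu>)"
      note cyc = over_GF_cyc[OF u]
      have "(\<Sum>g\<in>{g \<in> monic_polys k. cyc \<nu> u dvd g}. lfun a b c v g) =
          (\<Sum>h\<in>monic_polys (k - \<nu>). lfun a b c v (cyc \<nu> u * h))"
      proof (rule sum.reindex_bij_witness[of _ "\<lambda>h. cyc \<nu> u * h" "\<lambda>g. g div cyc \<nu> u"])
        fix g assume "g \<in> {g \<in> monic_polys k. cyc \<nu> u dvd g}"
        then obtain h where g: "g \<in> monic_polys k" and h: "g = cyc \<nu> u * h" by (auto elim: dvdE)
        have "h \<noteq> 0" using MP(2)[OF g] h by auto
        moreover have "over_GF h" using over_GF_cancel[OF cyc _ cyc_nz] MP(1)[OF g] h by simp
        moreover have "lead_coeff h = 1"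
          using g unfolding monic_polys_def by (simp add: h lead_coeff_mult lead_coeff_cyc)
        moreover have "degree h = k - \<nu>"
          using MP(3)[OF g] \<open>h \<noteq> 0\<close> cyc_nz by (simp add: h degree_mult_eq degree_cyc)
        moreover have "g div cyc \<nu> u = h" using h cyc_nz by simp
        ultimately show "g div cyc \<nu> u \<in> monic_polys (k - \<nu>)" "cyc \<nu> u * (g div cyc \<nu> u) = g"
          using h by (simp_all add: monic_polys_def)
        show "lfun a b c v (cyc \<nu> u * (g div cyc \<nu> u)) = lfun a b c v g" using h cyc_nz by simp
      next
        fix h assume h: "h \<in> monic_polys (k - \<nu>)"
        show "cyc \<nu> u * h div cyc \<nu> u = h" using cyc_nz by simp
        show "cyc \<nu> u * h \<in> {g \<in> monic_polys k. cyc \<nu> u dvd g}"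
          using h MP(1,2)[OF h] cyc cyc_nz[of \<nu> u] \<nu> lead_coeff_cyc[of \<nu> u] lead_coeff_mult[of "cyc \<nu> u" h]
          by (auto simp: monic_polys_def degree_mult_eq over_GF_mult degree_cyc)
      qed
      also have "\<dots> = lfun a b c v (cyc \<nu> u) * lcoeff a b c v (k - \<nu>)"
        unfolding lcoeff_def sum_distrib_left
        by (intro sum.cong refl lfun_mult[OF cyc _ v]) (auto simp: monic_polys_def)
      finally show "(\<Sum>g\<in>{g \<in> monic_polys k. cyc \<nu> u dvd g}. lfun a b c v g) =
        lfun a b c v (cyc \<nu> u) * lcoeff a b c v (k - \<nu>)" .
    qed
    finally show "(\<Sum>g\<in>monic_polys k. \<Sum>u\<in>GF (q ^ \<nu>). if cyc \<nu> u dvd g then lfun a b c v g else 0) =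
        ext_sum a b c v \<nu> * lcoeff a b c v (k - \<nu>)"
      by (simp add: ext_sum_def sum_distrib_right lfun_cyc[OF v])
  qed
  finally show ?thesis .
qed

lemma lcoeff_0: "lcoeff a b c v 0 = 1"
proof -
  have "monic_polys 0 = {1}"
    by (auto simp: monic_polys_def over_GF_def coeff_1 one_in_GF elim!: degree_eq_zeroE)
  thus ?thesis by (simp add: lcoeff_def lfun_def)
qed

text \<open>The quadratic \<open>L\<close> interpolates \<open>0, 1, 0\<close> at
  \<open>0, 1, v\<close>. Adding multiples of it keeps a polynomial of degree at least three monic,
  fixes its values at \<open>0\<close> and \<open>v\<close>, and moves the value at \<open>1\<close>
  through all of \<open>GF q\<close>, where the nontrivial character \<open>chi b\<close>
  cancels.\<close>

lemma lcoeff_eq_0: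
  assumes "\<not> int n dvd b" and v: "v \<in> GF q" "v \<noteq> 1" and "k \<ge> 3"
  shows "lcoeff a b c v k = 0"
proof -
  define L where "L = smult (inverse (1 + v)) ([:0, 1:] * [:v, 1:])"
  have "1 + v \<noteq> 0" using v(2) by (simp add: add_eq_0)
  have L: "poly L 0 = 0" "poly L 1 = 1" "poly L v = 0"
    using left_inverse[OF \<open>1 + v \<noteq> 0\<close>] by (simp_all add: L_def distrib_left add.commute two_eq_0)
  have degL: "degree L < 3" by (simp add: L_def)
  have "over_GF ([:0, 1:] * [:v, 1:])"
    using v one_in_GF by (intro over_GF_mult) (auto simp: over_GF_def coeff_pCons split: nat.splits)
  hence "over_GF L" unfolding L_def
    by (rule over_GF_smult) (use v one_in_GF in \<open>auto intro: inverse_in_GF add_in_GF_q\<close>)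
  have step: "g + smult t L \<in> monic_polys k" if "g \<in> monic_polys k" "t \<in> GF q" for g t
  proof -
    have "degree (smult t L) < degree g" using degL that(1) assms(4) degree_smult_le[of t L]
      by (auto simp: monic_polys_def)
    hence "degree (g + smult t L) = degree g" "poly.coeff (smult t L) (degree g) = 0"
      by (rule degree_add_eq_left, rule coeff_eq_0)
    moreover have "over_GF (g + smult t L)"
      using that \<open>over_GF L\<close> by (simp add: monic_polys_def over_GF_add over_GF_smult)
    moreover have "degree g = k" "poly.coeff g k = 1" using that(1) by (auto simp: monic_polys_def)
    ultimately show ?thesis by (simp only: monic_polys_def mem_Collect_eq coeff_add) simp
  qed
  have inv: "g + smult t L + smult t L = g" for g t
    using add_self[of t] by (simp add: add.assoc flip: smult_add_left)
  have shift: "lcoeff a b c v k = (\<Sum>g\<in>monic_polys k. lfun a b c v (g + smult t L))" if "t \<in> GF q" for t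
    unfolding lcoeff_def
    by (rule sum.reindex_bij_witness[of _ "\<lambda>g. g + smult t L" "\<lambda>g. g + smult t L"])
      (simp_all only: inv step[OF _ that])
  have "of_nat q * lcoeff a b c v k = (\<Sum>t\<in>(GF q :: 'a set). lcoeff a b c v k)" by (simp add: card_GF_q)
  also have "\<dots> = (\<Sum>t\<in>GF q. \<Sum>g\<in>monic_polys k. lfun a b c v (g + smult t L))"
    using shift by (intro sum.cong) auto
  also have "\<dots> = (\<Sum>g\<in>monic_polys k. \<Sum>t\<in>GF q. lfun a b c v (g + smult t L))" by (rule sum.swap)
  also have "\<dots> = 0"
  proof (rule sum.neutral, rule ballI)
    fix g assume g: "g \<in> monic_polys k"
    have g1: "poly g 1 \<in> GF q" using g one_in_GF by (intro poly_in_GF) (auto simp: monic_polys_def)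
    have "(\<Sum>t\<in>GF q. lfun a b c v (g + smult t L)) =
        chi a (poly g 0) * chi c (poly g v) * (\<Sum>t\<in>GF q. chi b (poly g 1 + t))"
      by (simp add: lfun_def L sum_distrib_left mult_ac)
    also have "(\<Sum>t\<in>GF q. chi b (poly g 1 + t)) = (\<Sum>t\<in>GF q. chi b t)"
      by (rule sum.reindex_bij_witness[of _ "\<lambda>t. poly g 1 + t" "\<lambda>t. poly g 1 + t"])
        (use g1 add_in_GF_q in \<open>auto simp flip: add.assoc\<close>)
    finally show "(\<Sum>t\<in>GF q. lfun a b c v (g + smult t L)) = 0" using sum_chi_eq_0[OF assms(1)] by simp
  qed
  finally show ?thesis using q_gt_1 by simp
qed

text \<open>The L-function is \<open>1 + A1 * T + A2 * T\<^sup>2 = (1 - \<omega> * T) * (1 -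
  \<omega>' * T)\<close>, so Newton's identities give the sum over each extension from
  \<open>\<omega>\<close> and \<open>\<omega>'\<close> alone. Their growth, and hence their size, is
  controlled by the estimate for even degrees.\<close>

theorem weil_bound:
  assumes v: "v \<in> GF q" "v \<noteq> 0" "v \<noteq> 1" and b: "\<not> int n dvd b"
  shows "norm (\<Sum>u\<in>GF q. chi a u * chi b (u + 1) * chi c (u + v)) \<le> 2 * sqrt q"
proof -
  let ?S = "ext_sum a b c v" and ?A = "lcoeff a b c v"
  define A1 A2 where "A1 = ?A 1" and "A2 = ?A 2"
  obtain \<omega> where "poly [:A2, A1, 1:] \<omega> = 0"
    using alg_closed_imp_poly_has_root[of "[:A2, A1, 1:]"] by auto
  hence \<omega>: "\<omega>\<^sup>2 = - A1 * \<omega> - A2" by (simp add: power2_eq_square algebra_simps eq_neg_iff_add_eq_0)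
  define \<omega>' where "\<omega>' = - A1 - \<omega>"
  have A1: "A1 = - (\<omega> + \<omega>')" by (simp add: \<omega>'_def)
  have A2: "A2 = \<omega> * \<omega>'" using \<omega> by (simp add: \<omega>'_def power2_eq_square algebra_simps)
  have A0: "?A 0 = 1" by (rule lcoeff_0)
  have S1: "?S 1 = A1" using newton_identity[OF v(1), of 1 a b c] A0 by (simp add: A1_def)
  have S2: "?S 2 = 2 * A2 - A1\<^sup>2"
  proof -
    have "{1..2::nat} = {1, 2}" by auto
    hence "2 * A2 = ?S 1 * A1 + ?S 2"
      using newton_identity[OF v(1), of 2 a b c] A0 by (simp add: A1_def A2_def)
    thus ?thesis using S1 by (simp add: power2_eq_square)
  qed
  have S_rec: "?S k = - A1 * ?S (k - 1) - A2 * ?S (k - 2)" if "k \<ge> 3" for k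
  proof -
    have "0 = (\<Sum>\<nu>\<in>{1..k}. ?S \<nu> * ?A (k - \<nu>))"
      using newton_identity[OF v(1), of k a b c] lcoeff_eq_0[OF b v(1,3) that] by simp
    also have "\<dots> = (\<Sum>\<nu>\<in>{k, k - 1, k - 2}. ?S \<nu> * ?A (k - \<nu>))"
    proof (rule sum.mono_neutral_right)
      show "\<forall>\<nu>\<in>{1..k} - {k, k - 1, k - 2}. ?S \<nu> * ?A (k - \<nu>) = 0"
      proof
        fix \<nu> assume "\<nu> \<in> {1..k} - {k, k - 1, k - 2}"
        hence "k - \<nu> \<ge> 3" by auto
        thus "?S \<nu> * ?A (k - \<nu>) = 0" using lcoeff_eq_0[OF b v(1,3)] by simp
      qed
    qed (use that in auto)
    also have "\<dots> = ?S k + ?S (k - 1) * A1 + ?S (k - 2) * A2"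
    proof -
      define j where "j = k - 3"
      have "k = Suc (Suc (Suc j))" using that by (simp add: j_def)
      thus ?thesis using A0 by (simp add: A1_def A2_def numeral_2_eq_2)
    qed
    finally show ?thesis by (simp add: algebra_simps eq_neg_iff_add_eq_0)
  qed
  have S: "?S k = - (\<omega> ^ k + \<omega>' ^ k)" if "k \<ge> 1" for k
    using that
  proof (induction k rule: less_induct)
    case (less k)
    consider "k = 1" | "k = 2" | "k \<ge> 3" using less.prems by linarith
    thus ?case
    proof cases
      case 1
      thus ?thesis using S1 A1 by simp
    next
      case 2
      thus ?thesis using S2 by (simp add: A1 A2 power2_eq_square algebra_simps)
    next
      case 3
      then obtain j where j: "k = Suc (Suc j)" "j \<ge> 1" by (metis add_2_eq_Suc le_Suc_ex numeral_3_eq_3 Suc_le_eq One_nat_def add_Suc le_add1)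
      have "?S k = - A1 * ?S (Suc j) - A2 * ?S j" using S_rec[OF 3] by (simp add: j)
      also have "\<dots> = - (\<omega> ^ k + \<omega>' ^ k)"
      proof -
        have "?S (Suc j) = - (\<omega> ^ Suc j + \<omega>' ^ Suc j)" "?S j = - (\<omega> ^ j + \<omega>' ^ j)"
          using less.IH[of "Suc j"] less.IH[of j] j by simp_all
        thus ?thesis by (simp only: A1 A2 j(1) power_Suc) (simp add: algebra_simps)
      qed
      finally show ?thesis .
    qed
  qed
  obtain C k\<^sub>0 where C: "\<And>k. k \<ge> k\<^sub>0 \<Longrightarrow> norm (?S (2 * k)) \<le> C * real q ^ k"
    using ext_sum_bound[OF v b, of a c] by blast
  \<comment> \<open>Squares, because only degrees \<open>2 * k\<close> are estimated; division by
    \<open>q\<close> turns the bound \<open>C * q ^ k\<close> into \<open>C\<close>.\<close>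
  define z z' where "z = \<omega>\<^sup>2 / of_nat q" and "z' = \<omega>'\<^sup>2 / of_nat q"
  have "norm (z ^ k + z' ^ k) \<le> C" if "k \<ge> max 1 k\<^sub>0" for k
  proof -
    have "?S (2 * k) = - (z ^ k + z' ^ k) * of_nat q ^ k"
    proof -
      have "z ^ k = \<omega> ^ (2 * k) / of_nat q ^ k" "z' ^ k = \<omega>' ^ (2 * k) / of_nat q ^ k"
        by (simp_all only: z_def z'_def power_divide power_mult)
      hence "- (z ^ k + z' ^ k) * of_nat q ^ k = - (\<omega> ^ (2 * k) + \<omega>' ^ (2 * k))"
        using q_gt_1 by (simp add: field_simps)
      thus ?thesis using S[of "2 * k"] that by simp
    qed
    moreover have "norm (?S (2 * k)) \<le> C * real q ^ k" using C[of k] that by simp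
    ultimately have "norm (z ^ k + z' ^ k) * real q ^ k \<le> C * real q ^ k"
      by (simp only: norm_mult norm_power norm_minus_cancel norm_of_nat)
    thus ?thesis using q_gt_1 by simp
  qed
  note bd = this
  have "norm z \<le> 1" by (rule bounded_power_sum_imp_norm_le_1[OF bd])
  moreover have "norm z' \<le> 1"
    by (rule bounded_power_sum_imp_norm_le_1[of "max 1 k\<^sub>0" z' z C]) (use bd in \<open>simp add: add.commute\<close>)
  ultimately have "norm \<omega> \<le> sqrt q" "norm \<omega>' \<le> sqrt q"
    using q_gt_1 by (auto simp: z_def z'_def norm_divide norm_power divide_le_eq intro!: real_le_rsqrt)
  moreover have "norm (?S 1) = norm (\<omega> + \<omega>')"
    by (subst S) (simp_all only: norm_minus_cancel power_one_right le_refl)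
  ultimately have "norm (?S 1) \<le> 2 * sqrt q" using norm_triangle_ineq[of \<omega> \<omega>'] by linarith
  moreover have "?S 1 = (\<Sum>u\<in>GF q. chi a u * chi b (u + 1) * chi c (u + v))"
    by (simp add: ext_sum_def Nm_def)
  ultimately show ?thesis by simp
qed

end

section \<open>Gauss and Jacobi sums\<close>

lemma sum_product4:
  fixes f g h k :: "'i \<Rightarrow> 'c::comm_semiring_0"
  shows "sum f A * sum g B * sum h C * sum k D = (\<Sum>x\<in>A. \<Sum>y\<in>B. \<Sum>z\<in>C. \<Sum>w\<in>D. f x * g y * h z * k w)"
  by (simp only: sum_distrib_left[symmetric] sum_distrib_right[symmetric])

lemma sum_rotate3: "(\<Sum>x\<in>A. \<Sum>y\<in>B. \<Sum>z\<in>C. f x y z) = (\<Sum>z\<in>C. \<Sum>x\<in>A. \<Sum>y\<in>B. f x y z)"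
proof -
  have "(\<Sum>x\<in>A. \<Sum>y\<in>B. \<Sum>z\<in>C. f x y z) = (\<Sum>x\<in>A. \<Sum>z\<in>C. \<Sum>y\<in>B. f x y z)"
    by (intro sum.cong refl sum.swap)
  also have "\<dots> = (\<Sum>z\<in>C. \<Sum>x\<in>A. \<Sum>y\<in>B. f x y z)" by (rule sum.swap)
  finally show ?thesis .
qed

section \<open>Additive characters and Gauss sums\<close>

context char2_field
begin

text \<open>On \<open>GF (2 ^ k)\<close> this is the absolute trace, with values \<open>0\<close>
  and \<open>1\<close>, and \<open>psi k\<close> is the canonical additive character.\<close>

definition trace2 :: "nat \<Rightarrow> 'a \<Rightarrow> 'a" where
  "trace2 k x = (\<Sum>i<k. x ^ 2 ^ i)"

definition psi :: "nat \<Rightarrow> 'a \<Rightarrow> complex" where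
  "psi k x = (if trace2 k x = 0 then 1 else - 1)"

lemma trace2_add: "trace2 k (x + y) = trace2 k x + trace2 k y"
  by (simp add: trace2_def frobenius_add sum.distrib)

lemma trace2_0 [simp]: "trace2 k 0 = 0"
  by (simp add: trace2_def power_0_left)

lemma psi_0 [simp]: "psi k 0 = 1" by (simp add: psi_def)

lemma trace2_cases:
  assumes "x \<in> GF (2 ^ k)"
  shows "trace2 k x = 0 \<or> trace2 k x = 1"
proof -
  have "trace2 k x ^ 2 = (\<Sum>i<k. x ^ 2 ^ Suc i)"
    using frobenius_sum[of "\<lambda>i. x ^ 2 ^ i" "{..<k}" 1]
    by (simp add: trace2_def mult.commute flip: power_mult)
  also have "\<dots> + x = (\<Sum>i<Suc k. x ^ 2 ^ i)" by (subst sum.lessThan_Suc_shift) (simp add: add.commute)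
  also have "\<dots> = trace2 k x + x" using assms by (simp add: trace2_def GF_def)
  finally have "trace2 k x ^ 2 = trace2 k x" by simp
  hence "trace2 k x * (trace2 k x - 1) = 0" by (simp add: power2_eq_square right_diff_distrib del: minus_eq)
  thus ?thesis by auto
qed

lemma psi_add:
  assumes "x \<in> GF (2 ^ k)" and "y \<in> GF (2 ^ k)"
  shows "psi k (x + y) = psi k x * psi k y"
  using trace2_cases[OF assms(1)] trace2_cases[OF assms(2)] by (auto simp: psi_def trace2_add)

lemma cnj_psi [simp]: "cnj (psi k x) = psi k x" by (simp add: psi_def)

lemma sum_psi_mult:
  assumes k: "k > 0" and c: "c \<in> GF (2 ^ k)"
  shows "(\<Sum>x\<in>GF (2 ^ k). psi k (c * x)) = (if c = 0 then 2 ^ k else 0)"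
proof (cases "c = 0")
  case True
  thus ?thesis using card_GF_2[OF k] by simp
next
  case False
  have "\<exists>x\<in>GF (2 ^ k). trace2 k x \<noteq> 0"
  proof (rule ccontr)
    assume "\<not> (\<exists>x\<in>GF (2 ^ k). trace2 k x \<noteq> 0)"
    hence all0: "\<And>x. x \<in> GF (2 ^ k) \<Longrightarrow> trace2 k x = 0" by blast
    \<comment> \<open>The trace is a nonzero polynomial of degree at most
      \<open>2 ^ (k - 1)\<close>, so it cannot vanish at all \<open>2 ^ k\<close> points.\<close>
    define p :: "'a poly" where "p = (\<Sum>i<k. Polynomial.monom 1 (2 ^ i))"
    have "poly.coeff p 1 = (\<Sum>i<k. if i = 0 then 1 else 0)"
      unfolding p_def coeff_sum coeff_monom by (intro sum.cong) auto
    hence "poly.coeff p 1 = 1" using k by simp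
    hence p0: "p \<noteq> 0" by (metis coeff_0 zero_neq_one)
    have "degree p \<le> 2 ^ (k - 1)" unfolding p_def
      by (intro degree_sum_le) (auto simp: degree_monom_eq)
    also have "\<dots> < 2 ^ k" using k by simp
    finally have deg: "degree p < 2 ^ k" .
    have "GF (2 ^ k) \<subseteq> {x. poly p x = 0}"
      using all0 by (auto simp: p_def poly_sum poly_monom trace2_def)
    hence "card (GF (2 ^ k) :: 'a set) \<le> card {x. poly p x = 0}"
      by (rule card_mono[OF poly_roots_finite[OF p0]])
    also have "\<dots> \<le> degree p" by (rule card_poly_roots_bound[OF p0])
    finally show False using deg card_GF_2[OF k] by simp
  qed
  then obtain x0 where x0: "x0 \<in> GF (2 ^ k)" "psi k x0 = - 1" by (auto simp: psi_def)
  have "(\<Sum>x\<in>GF (2 ^ k). psi k (c * x)) = (\<Sum>x\<in>GF (2 ^ k). psi k x)"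
    by (rule sum.reindex_bij_witness[of _ "\<lambda>x. x / c" "\<lambda>x. c * x"])
      (use False c in \<open>auto intro: mult_in_GF divide_in_GF\<close>)
  moreover have "(\<Sum>x\<in>GF (2 ^ k). psi k x) = 0"
  proof -
    have "(\<Sum>x\<in>GF (2 ^ k). psi k x) = (\<Sum>x\<in>GF (2 ^ k). psi k (x0 + x))"
      by (rule sum.reindex_bij_witness[of _ "\<lambda>x. x0 + x" "\<lambda>x. x0 + x"])
        (use x0 in \<open>auto intro: add_in_GF simp flip: add.assoc\<close>)
    also have "\<dots> = - (\<Sum>x\<in>GF (2 ^ k). psi k x)"
      using x0 by (simp add: psi_add sum_negf)
    finally have "2 * (\<Sum>x\<in>GF (2 ^ k). psi k x) = 0"
      by (metis (no_types) add.right_inverse mult_2)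
    thus ?thesis by simp
  qed
  ultimately show ?thesis using False by simp
qed

text \<open>The character is an abstract \<open>\<mu>\<close> because the result serves twice: for
  \<open>chi\<close> on \<open>GF q\<close>, and for \<open>chi\<close> restricted to the subfield.
  The substitution of \<open>t * y\<close> for \<open>x\<close> cancels \<open>\<mu> y\<close>
  against its conjugate, and the sum over \<open>y\<close> then isolates
  \<open>t = 1\<close>.\<close>

lemma norm_gauss_sum:
  fixes \<mu> :: "'a \<Rightarrow> complex"
  assumes k: "k > 0" and \<mu>0: "\<mu> 0 = 0"
    and \<mu>_mult: "\<And>x y. x \<in> GF (2 ^ k) \<Longrightarrow> y \<in> GF (2 ^ k) \<Longrightarrow> \<mu> (x * y) = \<mu> x * \<mu> y"
    and \<mu>_norm: "\<And>x. x \<in> GF (2 ^ k) \<Longrightarrow> x \<noteq> 0 \<Longrightarrow> norm (\<mu> x) = 1"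
    and sum0: "(\<Sum>x\<in>GF (2 ^ k). \<mu> x) = 0"
  shows "norm (\<Sum>x\<in>GF (2 ^ k). \<mu> x * psi k x) ^ 2 = 2 ^ k"
proof -
  let ?X = "GF (2 ^ k) :: 'a set"
  let ?G = "\<Sum>x\<in>?X. \<mu> x * psi k x"
  have fin: "finite ?X" using finite_GF_2[OF k] .
  have one: "1 \<in> ?X" by (rule one_in_GF)
  have zero: "0 \<in> ?X" by (rule zero_in_GF) simp
  have \<mu>cnj: "\<mu> y * cnj (\<mu> y) = 1" if "y \<in> ?X" "y \<noteq> 0" for y
    using \<mu>_norm[OF that] by (simp add: complex_norm_square[symmetric])
  have "\<mu> 1 = 1"
  proof -
    have "\<mu> 1 * \<mu> 1 = \<mu> 1 * 1" using \<mu>_mult[OF one one] by simp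
    moreover have "\<mu> 1 \<noteq> 0" using \<mu>_norm[OF one] by auto
    ultimately show ?thesis by (metis mult_left_cancel)
  qed
  have "complex_of_real (norm ?G ^ 2) = ?G * cnj ?G" by (simp only: complex_norm_square)
  also have "\<dots> = (\<Sum>x\<in>?X. \<Sum>y\<in>?X. (\<mu> x * psi k x) * (cnj (\<mu> y) * psi k y))"
    by (simp add: sum_product)
  also have "\<dots> = (\<Sum>y\<in>?X. \<Sum>x\<in>?X. (\<mu> x * psi k x) * (cnj (\<mu> y) * psi k y))" by (rule sum.swap)
  also have "\<dots> = (\<Sum>y\<in>?X - {0}. \<Sum>x\<in>?X. (\<mu> x * psi k x) * (cnj (\<mu> y) * psi k y))"
    using fin by (intro sum.mono_neutral_right) (auto simp: \<mu>0)
  also have "\<dots> = (\<Sum>y\<in>?X - {0}. \<Sum>t\<in>?X. \<mu> t * psi k ((t + 1) * y))"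
  proof (rule sum.cong[OF refl])
    fix y assume y: "y \<in> ?X - {0}"
    have "(\<Sum>x\<in>?X. (\<mu> x * psi k x) * (cnj (\<mu> y) * psi k y)) =
        (\<Sum>t\<in>?X. (\<mu> (t * y) * psi k (t * y)) * (cnj (\<mu> y) * psi k y))"
      by (rule sum.reindex_bij_witness[of _ "\<lambda>t. t * y" "\<lambda>x. x / y"])
        (use y in \<open>auto intro: mult_in_GF divide_in_GF\<close>)
    also have "\<dots> = (\<Sum>t\<in>?X. \<mu> t * psi k ((t + 1) * y))"
    proof (rule sum.cong[OF refl])
      fix t assume t: "t \<in> ?X"
      have "\<mu> (t * y) * psi k (t * y) * (cnj (\<mu> y) * psi k y) = \<mu> t * (\<mu> y * cnj (\<mu> y)) * (psi k (t * y) * psi k y)"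
        using y t by (simp add: \<mu>_mult mult_ac)
      also have "\<dots> = \<mu> t * psi k (t * y + y)"
        using y t \<mu>cnj[of y] by (simp add: psi_add mult_in_GF)
      finally show "\<mu> (t * y) * psi k (t * y) * (cnj (\<mu> y) * psi k y) = \<mu> t * psi k ((t + 1) * y)"
        by (simp add: distrib_right)
    qed
    finally show "(\<Sum>x\<in>?X. (\<mu> x * psi k x) * (cnj (\<mu> y) * psi k y)) = (\<Sum>t\<in>?X. \<mu> t * psi k ((t + 1) * y))" .
  qed
  also have "\<dots> = (\<Sum>t\<in>?X. \<mu> t * (\<Sum>y\<in>?X - {0}. psi k ((t + 1) * y)))"
    by (subst sum.swap) (simp add: sum_distrib_left)
  also have "\<dots> = (\<Sum>t\<in>?X. \<mu> t * ((if t = 1 then 2 ^ k else 0) - 1))"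
  proof (rule sum.cong[OF refl])
    fix t assume t: "t \<in> ?X"
    have "(\<Sum>y\<in>?X. psi k ((t + 1) * y)) = (if t + 1 = 0 then 2 ^ k else 0)"
      by (rule sum_psi_mult[OF k]) (use t one in \<open>auto intro: add_in_GF\<close>)
    moreover have "(\<Sum>y\<in>?X - {0}. psi k ((t + 1) * y)) = (\<Sum>y\<in>?X. psi k ((t + 1) * y)) - 1"
      using sum.remove[OF fin zero, of "\<lambda>y. psi k ((t + 1) * y)"] by simp
    ultimately show "\<mu> t * (\<Sum>y\<in>?X - {0}. psi k ((t + 1) * y)) = \<mu> t * ((if t = 1 then 2 ^ k else 0) - 1)"
      by (simp only: add_eq_0)
  qed
  also have "\<dots> = (\<Sum>t\<in>?X. if t = 1 then \<mu> t * 2 ^ k else 0) - (\<Sum>t\<in>?X. \<mu> t)"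
    unfolding sum_subtractf[symmetric] by (intro sum.cong) (auto simp: algebra_simps)
  also have "\<dots> = 2 ^ k" using fin one \<open>\<mu> 1 = 1\<close> sum0 by simp
  finally have "complex_of_real (norm ?G ^ 2) = complex_of_real (2 ^ k)" by simp
  thus ?thesis by (simp only: of_real_eq_iff)
qed

definition gauss :: "int \<Rightarrow> complex" where
  "gauss k = (\<Sum>x\<in>GF q. chi k x * psi K x)"

lemma chi_trivial: "int n dvd k \<Longrightarrow> chi k x = (if x = 0 then 0 else 1)"
  using chi_cong[of k 0 x] by (simp add: chi_def cong_0_iff)

lemma sum_chi: "(\<Sum>x\<in>GF q. chi k x) = (if int n dvd k then of_nat n else 0)"
proof (cases "int n dvd k")
  case True
  hence "(\<Sum>x\<in>GF q. chi k x) = (\<Sum>x\<in>(GF q :: 'a set). if x = 0 then 0 else 1)"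
    by (simp only: chi_trivial)
  also have "\<dots> = (\<Sum>x\<in>(GF q :: 'a set) - {0}. 1)"
    by (rule sum.mono_neutral_cong_right) auto
  also have "\<dots> = of_nat n" by (simp add: card_GF_q n_def)
  finally show ?thesis using True by simp
qed (use sum_chi_eq_0 in simp)

lemma psi_add_q: "x \<in> GF q \<Longrightarrow> y \<in> GF q \<Longrightarrow> psi K (x + y) = psi K x * psi K y"
  unfolding q_def by (rule psi_add)

lemma gauss_trivial: "int n dvd k \<Longrightarrow> gauss k = - 1"
proof -
  assume "int n dvd k"
  hence "gauss k = (\<Sum>x\<in>GF q. if x = 0 then 0 else psi K x)"
    unfolding gauss_def by (intro sum.cong) (auto simp: chi_trivial)
  also have "\<dots> = (\<Sum>x\<in>GF q - {0}. psi K x)"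
    by (rule sum.mono_neutral_cong_right) auto
  also have "\<dots> = (\<Sum>x\<in>GF q. psi K x) - 1"
    by (subst sum.remove[of _ 0]) simp_all
  also have "(\<Sum>x\<in>GF q. psi K x) = 0"
    using sum_psi_mult[OF K one_in_GF] by (simp add: q_def)
  finally show ?thesis by simp
qed

lemma norm_gauss: "\<not> int n dvd k \<Longrightarrow> norm (gauss k) ^ 2 = q"
  using norm_gauss_sum[OF K, of "chi k"] sum_chi[of k]
  by (simp add: gauss_def q_def chi_mult norm_chi)

lemma norm_gauss_le: "norm (gauss k) \<le> sqrt q"
proof (cases "int n dvd k")
  case True
  thus ?thesis using q_gt_1 by (simp add: gauss_trivial)
next
  case False
  thus ?thesis using norm_gauss[OF False] by (metis norm_ge_zero order_refl real_sqrt_unique)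
qed

text \<open>For \<open>t = 0\<close> the first summand vanishes since \<open>chi\<close> does; the
  second one supplies the value of the plain character sum.\<close>

lemma sum_chi_psi:
  assumes "t \<in> GF q"
  shows "(\<Sum>x\<in>GF q. chi k x * psi K (x * t)) =
    chi (- k) t * gauss k + (if t = 0 \<and> int n dvd k then of_nat n else 0)"
proof (cases "t = 0")
  case True
  thus ?thesis by (simp add: sum_chi)
next
  case False
  have "(\<Sum>x\<in>GF q. chi k x * psi K (x * t)) = (\<Sum>y\<in>GF q. chi k (y * inverse t) * psi K y)"
    by (rule sum.reindex_bij_witness[of _ "\<lambda>y. y * inverse t" "\<lambda>x. x * t"])
      (use False assms in \<open>auto intro: mult_in_GF inverse_in_GF simp: mult.assoc\<close>)
  also have "\<dots> = chi (- k) t * gauss k"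
    unfolding gauss_def sum_distrib_left
    by (intro sum.cong) (auto simp: chi_mult assms inverse_in_GF chi_inverse chi_uminus)
  finally show ?thesis using False by simp
qed

lemma sum_k_chi:
  assumes "x \<in> GF q" and "x \<noteq> 0"
  shows "(\<Sum>k<n. chi (int k) x) = (if x = 1 then of_nat n else 0)"
proof (cases "x = 1")
  case False
  obtain i where i: "x = \<theta> ^ i" using \<theta>_power_dlog assms by metis
  have pow: "chi (int k) x = chi 1 x ^ k" for k
    using assms(2) by (simp add: chi_def Complex.DeMoivre mult_ac)
  have "chi (int i) \<theta> = chi 1 x" using chi_\<theta>[of 1 i] chi_\<theta>[of "int i" 1] i by simp
  moreover have "\<not> int n dvd int i" using False \<theta>_power_eq_1_iff[of i] i by simp
  ultimately have ne: "chi 1 x \<noteq> 1" using chi_eq_1_iff[of "int i"] by simp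
  have "chi 1 x ^ n = 1"
  proof -
    have "x ^ n = 1" using assms q_gt_1 by (simp add: GF_iff n_def)
    thus ?thesis using chi_power[OF assms(1), of 1 n] by simp
  qed
  thus ?thesis using False ne unfolding pow by (simp add: sum_gp_strict)
qed simp

text \<open>The fourth moment of Gauss sums, twisted by a character of \<open>k\<close>. The twist
  by \<open>v\<close> in the subfield is what the expansion of the subfield factors
  produces.\<close>

definition gauss4 :: "int \<Rightarrow> int \<Rightarrow> int \<Rightarrow> 'a \<Rightarrow> complex" where
  "gauss4 a b c v = (\<Sum>k<n. chi (int k) v *
     (gauss (int k + a) * gauss (int k + b) * cnj (gauss (int k + c)) * cnj (gauss (int k))))"

text \<open>Orthogonality in \<open>k\<close> forces \<open>w = v * x * y / z\<close>. With
  \<open>x = z * u\<close> the argument of the additive character becomes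
  \<open>z * (u + 1) + y * (1 + v * u)\<close>, so the sums over \<open>z\<close> and
  \<open>y\<close> separate and each is a Gauss sum.\<close>

lemma gauss4_eq:
  assumes v: "v \<in> GF q" "v \<noteq> 0"
  shows "gauss4 a b c v = of_nat n * (\<Sum>u\<in>GF q. chi a u *
    ((\<Sum>z\<in>GF q. chi (a - c) z * psi K (z * (u + 1))) *
     (\<Sum>y\<in>GF q. chi b y * psi K (y * (1 + v * u)))))"
proof -
  let ?X = "GF q :: 'a set" and ?Y = "GF q - {0} :: 'a set"
  have nz: "sum f ?X = sum f ?Y" if "f 0 = 0" for f :: "'a \<Rightarrow> complex"
    by (rule sum.mono_neutral_right) (use that in auto)
  define P where "P x y z = chi a x * chi b y * cnj (chi c z)" for x y z
  have term_eq: "chi (int k) v * (gauss (int k + a) * gauss (int k + b) * cnj (gauss (int k + c)) * cnj (gauss (int k))) =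
      (\<Sum>x\<in>?Y. \<Sum>y\<in>?Y. \<Sum>z\<in>?Y. \<Sum>w\<in>?Y. P x y z * psi K (x + y + z + w) * chi (int k) (v * x * y / (z * w)))" for k
  proof -
    have "chi (int k) v * (gauss (int k + a) * gauss (int k + b) * cnj (gauss (int k + c)) * cnj (gauss (int k))) =
      chi (int k) v * (\<Sum>x\<in>?Y. \<Sum>y\<in>?Y. \<Sum>z\<in>?Y. \<Sum>w\<in>?Y.
        (chi (int k + a) x * psi K x) * (chi (int k + b) y * psi K y) * cnj (chi (int k + c) z * psi K z) * cnj (chi (int k) w * psi K w))"
      by (simp only: gauss_def nz chi_0 mult_zero_left cnj_sum sum_product4)
    also have "\<dots> = (\<Sum>x\<in>?Y. \<Sum>y\<in>?Y. \<Sum>z\<in>?Y. \<Sum>w\<in>?Y. P x y z * psi K (x + y + z + w) * chi (int k) (v * x * y / (z * w)))"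
      unfolding sum_distrib_left
    proof (intro sum.cong refl)
      fix x y z w assume *: "x \<in> ?Y" "y \<in> ?Y" "z \<in> ?Y" "w \<in> ?Y"
      have "chi (int k) (v * x * y / (z * w)) = chi (int k) (v * x * y * inverse z * inverse w)"
        by (simp add: field_simps)
      also have "\<dots> = chi (int k) v * chi (int k) x * chi (int k) y * cnj (chi (int k) z) * cnj (chi (int k) w)"
        using * v by (simp add: chi_mult mult_in_GF inverse_in_GF chi_inverse)
      finally show "chi (int k) v * ((chi (int k + a) x * psi K x) * (chi (int k + b) y * psi K y) * cnj (chi (int k + c) z * psi K z) * cnj (chi (int k) w * psi K w))
        = P x y z * psi K (x + y + z + w) * chi (int k) (v * x * y / (z * w))"
        using * by (simp add: P_def psi_add_q add_in_GF_q chi_add)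
    qed
    finally show ?thesis .
  qed
  have "gauss4 a b c v = (\<Sum>x\<in>?Y. \<Sum>y\<in>?Y. \<Sum>z\<in>?Y. \<Sum>w\<in>?Y.
      P x y z * psi K (x + y + z + w) * (\<Sum>k<n. chi (int k) (v * x * y / (z * w))))"
    unfolding gauss4_def term_eq sum_distrib_left
    by (subst sum.swap, rule sum.cong[OF refl], subst sum.swap, rule sum.cong[OF refl],
        subst sum.swap, rule sum.cong[OF refl], rule sum.swap)
  also have "\<dots> = (\<Sum>x\<in>?Y. \<Sum>y\<in>?Y. \<Sum>z\<in>?Y. of_nat n * (P x y z * psi K (x + y + z + v * x * y / z)))"
  proof (intro sum.cong refl)
    fix x y z assume *: "x \<in> ?Y" "y \<in> ?Y" "z \<in> ?Y"
    have "(\<Sum>w\<in>?Y. P x y z * psi K (x + y + z + w) * (\<Sum>k<n. chi (int k) (v * x * y / (z * w)))) =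
        (\<Sum>w\<in>?Y. if w = v * x * y / z then of_nat n * (P x y z * psi K (x + y + z + w)) else 0)"
    proof (intro sum.cong refl)
      fix w assume w: "w \<in> ?Y"
      have "v * x * y / (z * w) = 1 \<longleftrightarrow> w = v * x * y / z" using * w v by (auto simp: field_simps)
      moreover have "(\<Sum>k<n. chi (int k) (v * x * y / (z * w))) = (if v * x * y / (z * w) = 1 then of_nat n else 0)"
        by (rule sum_k_chi) (use * w v in \<open>auto intro!: divide_in_GF mult_in_GF\<close>)
      ultimately show "P x y z * psi K (x + y + z + w) * (\<Sum>k<n. chi (int k) (v * x * y / (z * w))) =
          (if w = v * x * y / z then of_nat n * (P x y z * psi K (x + y + z + w)) else 0)"
        by simp
    qed
    moreover have "v * x * y / z \<in> ?Y" using * v by (auto intro!: divide_in_GF mult_in_GF)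
    ultimately show "(\<Sum>w\<in>?Y. P x y z * psi K (x + y + z + w) * (\<Sum>k<n. chi (int k) (v * x * y / (z * w)))) =
        of_nat n * (P x y z * psi K (x + y + z + v * x * y / z))" by simp
  qed
  also have "\<dots> = of_nat n * (\<Sum>z\<in>?Y. \<Sum>x\<in>?Y. \<Sum>y\<in>?Y. P x y z * psi K (x + y + z + v * x * y / z))"
    unfolding sum_distrib_left by (rule sum_rotate3)
  also have "(\<Sum>z\<in>?Y. \<Sum>x\<in>?Y. \<Sum>y\<in>?Y. P x y z * psi K (x + y + z + v * x * y / z)) =
      (\<Sum>z\<in>?Y. \<Sum>u\<in>?Y. \<Sum>y\<in>?Y. chi a u * (chi (a - c) z * psi K (z * (u + 1))) * (chi b y * psi K (y * (1 + v * u))))"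
  proof (rule sum.cong[OF refl])
    fix z assume z: "z \<in> ?Y"
    have "(\<Sum>x\<in>?Y. \<Sum>y\<in>?Y. P x y z * psi K (x + y + z + v * x * y / z)) =
        (\<Sum>u\<in>?Y. \<Sum>y\<in>?Y. P (z * u) y z * psi K (z * u + y + z + v * (z * u) * y / z))"
      by (rule sum.reindex_bij_witness[of _ "\<lambda>u. z * u" "\<lambda>x. x / z"])
        (use z in \<open>auto intro: mult_in_GF divide_in_GF\<close>)
    also have "\<dots> = (\<Sum>u\<in>?Y. \<Sum>y\<in>?Y. chi a u * (chi (a - c) z * psi K (z * (u + 1))) * (chi b y * psi K (y * (1 + v * u))))"
    proof (intro sum.cong refl)
      fix u y assume *: "u \<in> ?Y" "y \<in> ?Y"
      have "psi K (z * u + y + z + v * (z * u) * y / z) = psi K (z * (u + 1) + y * (1 + v * u))"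
        using z by (simp add: field_simps)
      also have "\<dots> = psi K (z * (u + 1)) * psi K (y * (1 + v * u))"
        by (rule psi_add_q) (use z * v one_in_GF in \<open>auto intro!: mult_in_GF add_in_GF_q\<close>)
      finally show "P (z * u) y z * psi K (z * u + y + z + v * (z * u) * y / z) =
          chi a u * (chi (a - c) z * psi K (z * (u + 1))) * (chi b y * psi K (y * (1 + v * u)))"
        using z * chi_add[of a "- c" z] by (simp add: P_def chi_mult chi_uminus)
    qed
    finally show "(\<Sum>x\<in>?Y. \<Sum>y\<in>?Y. P x y z * psi K (x + y + z + v * x * y / z)) =
      (\<Sum>u\<in>?Y. \<Sum>y\<in>?Y. chi a u * (chi (a - c) z * psi K (z * (u + 1))) * (chi b y * psi K (y * (1 + v * u))))" .
  qed
  also have "\<dots> = (\<Sum>u\<in>?X. chi a u * ((\<Sum>z\<in>?X. chi (a - c) z * psi K (z * (u + 1))) * (\<Sum>y\<in>?X. chi b y * psi K (y * (1 + v * u)))))"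
    by (subst sum.swap) (simp add: nz sum_product sum_distrib_left mult_ac)
  finally show ?thesis .
qed

end

section \<open>Bounds for twisted moments of Gauss sums\<close>

context char2_field
begin

lemma norm_chi_le: "norm (chi k x) \<le> 1"
  by (cases "x = 0") (simp_all add: norm_chi)

text \<open>Weil's bound is applied with a trivial third character at a spare point
  \<open>w\<close>, which exists since \<open>K \<ge> 2\<close>. Only the term \<open>u = w\<close>
  goes missing, so the bound becomes \<open>2 * sqrt q + 1\<close>. If \<open>chi b\<close> is
  trivial, the substitution of \<open>u + 1\<close> for \<open>u\<close> exchanges the
  roles.\<close>

lemma jacobi_bound:
  assumes "K \<ge> 2" and "\<not> (int n dvd a \<and> int n dvd b)"
  shows "norm (\<Sum>u\<in>GF q. chi a u * chi b (u + 1)) \<le> 3 * sqrt q"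
proof -
  have main: "norm (\<Sum>u\<in>GF q. chi a u * chi b (u + 1)) \<le> 3 * sqrt q" if b: "\<not> int n dvd b" for a b
  proof -
    have "2 ^ 2 \<le> q" unfolding q_def using assms(1) by (intro power_increasing) auto
    hence "card {0, 1 :: 'a} < card (GF q :: 'a set)" by (simp add: card_GF_q)
    hence "\<not> GF q \<subseteq> {0, 1 :: 'a}" using card_mono[of "{0, 1 :: 'a}" "GF q"] by auto
    then obtain w :: 'a where w: "w \<in> GF q" "w \<noteq> 0" "w \<noteq> 1" by blast
    have "(\<Sum>u\<in>GF q. chi a u * chi b (u + 1)) =
        (\<Sum>u\<in>GF q. chi a u * chi b (u + 1) * chi 0 (u + w) + (if u = w then chi a w * chi b (w + 1) else 0))"
      by (intro sum.cong) (auto simp: chi_trivial add_eq_0)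
    also have "\<dots> = (\<Sum>u\<in>GF q. chi a u * chi b (u + 1) * chi 0 (u + w)) + chi a w * chi b (w + 1)"
      using w by (simp add: sum.distrib)
    also have "norm \<dots> \<le> 2 * sqrt q + 1"
    proof (rule order.trans[OF norm_triangle_ineq add_mono])
      show "norm (chi a w * chi b (w + 1)) \<le> 1"
        using mult_mono[OF norm_chi_le[of a w] norm_chi_le[of b "w + 1"]] by (simp add: norm_mult)
    qed (rule weil_bound[OF w b])
    also have "\<dots> \<le> 3 * sqrt q" using q_gt_1 by simp
    finally show ?thesis .
  qed
  show ?thesis
  proof (cases "int n dvd b")
    case True
    have "(\<Sum>u\<in>GF q. chi a u * chi b (u + 1)) = (\<Sum>u\<in>GF q. chi b u * chi a (u + 1))"
      by (rule sum.reindex_bij_witness[of _ "\<lambda>u. u + 1" "\<lambda>u. u + 1"])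
        (auto simp: add.assoc one_in_GF intro: add_in_GF_q)
    thus ?thesis using main[of a b] True assms(2) by simp
  qed (rule main)
qed

text \<open>In the generic case two Gauss sums of size at most \<open>sqrt q\<close> multiply a
  character sum of size \<open>3 * sqrt q\<close>. When one of the two inner characters is trivial,
  its Gauss sum is \<open>- 1\<close> and the trivial estimate is enough. By \<open>np1\<close> both
  cannot be trivial.\<close>

lemma norm_gauss4_le:
  assumes "K \<ge> 2" and v: "v \<in> GF q" "v \<noteq> 0"
    and np1: "\<not> (int n dvd a - c \<and> int n dvd b)"
    and np2: "v = 1 \<Longrightarrow> \<not> (int n dvd a \<and> int n dvd b - c)"
  shows "norm (gauss4 a b c v) \<le> n * (3 * q * sqrt q)"
proof -
  define E1 where "E1 u = (\<Sum>z\<in>GF q. chi (a - c) z * psi K (z * (u + 1)))" for u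
  define E2 where "E2 u = (\<Sum>y\<in>GF q. chi b y * psi K (y * (1 + v * u)))" for u
  have E1: "E1 u = chi (c - a) (u + 1) * gauss (a - c) + (if u = 1 \<and> int n dvd a - c then of_nat n else 0)"
    if "u \<in> GF q" for u
    unfolding E1_def using that one_in_GF by (subst sum_chi_psi) (auto intro: add_in_GF_q simp: add_eq_0)
  have vu: "1 + v * u = 0 \<longleftrightarrow> u = inverse v" for u
    using v(2) by (auto simp: add_eq_0 field_simps)
  have E2: "E2 u = chi (- b) (1 + v * u) * gauss b + (if u = inverse v \<and> int n dvd b then of_nat n else 0)"
    if "u \<in> GF q" for u
    unfolding E2_def using that one_in_GF v by (subst sum_chi_psi) (auto intro: add_in_GF_q mult_in_GF simp: vu)
  have sq: "sqrt q * sqrt q = q" by simp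
  have n_le_q: "real n \<le> q" by (simp add: q_eq)
  have "norm (\<Sum>u\<in>GF q. chi a u * (E1 u * E2 u)) \<le> 3 * q * sqrt q"
  proof -
    consider "\<not> int n dvd a - c" "\<not> int n dvd b" | "int n dvd a - c" "\<not> int n dvd b"
      | "\<not> int n dvd a - c" "int n dvd b" using np1 by blast
    thus ?thesis
    proof cases
      case 1
      have "(\<Sum>u\<in>GF q. chi a u * (E1 u * E2 u)) =
          gauss (a - c) * gauss b * (\<Sum>u\<in>GF q. chi a u * chi (c - a) (u + 1) * chi (- b) (1 + v * u))"
        unfolding sum_distrib_left using 1 by (intro sum.cong refl) (simp add: E1 E2 mult_ac)
      moreover have "norm (\<Sum>u\<in>GF q. chi a u * chi (c - a) (u + 1) * chi (- b) (1 + v * u)) \<le> 3 * sqrt q"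
      \<comment> \<open>For \<open>v = 1\<close> the second and third character sit at the same
        point and merge; \<open>np2\<close> keeps the remaining Jacobi sum nontrivial.\<close>
      proof (cases "v = 1")
        case True
        have "(\<Sum>u\<in>GF q. chi a u * chi (c - a) (u + 1) * chi (- b) (1 + v * u)) =
            (\<Sum>u\<in>GF q. chi a u * chi (c - a - b) (u + 1))"
          using True chi_add[of "c - a" "- b"] by (simp add: add.commute mult.assoc)
        also have "norm \<dots> \<le> 3 * sqrt q"
        proof (rule jacobi_bound[OF assms(1)], safe)
          assume *: "int n dvd a" "int n dvd c - a - b"
          hence "int n dvd - (c - a - b) - a" by (intro dvd_diff) (simp_all only: dvd_minus_iff)
          thus False using np2[OF True] * by simp
        qed
        finally show ?thesis .
      next
        case False
        have "(\<Sum>u\<in>GF q. chi a u * chi (c - a) (u + 1) * chi (- b) (1 + v * u)) =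
            chi (- b) v * (\<Sum>u\<in>GF q. chi a u * chi (c - a) (u + 1) * chi (- b) (u + inverse v))"
          unfolding sum_distrib_left
        proof (intro sum.cong refl)
          fix u :: 'a assume u: "u \<in> GF q"
          have "1 + v * u = v * (u + inverse v)" using v(2) by (simp add: distrib_left)
          hence "chi (- b) (1 + v * u) = chi (- b) v * chi (- b) (u + inverse v)"
            using u v by (simp add: chi_mult add_in_GF_q inverse_in_GF)
          thus "chi a u * chi (c - a) (u + 1) * chi (- b) (1 + v * u) =
            chi (- b) v * (chi a u * chi (c - a) (u + 1) * chi (- b) (u + inverse v))" by simp
        qed
        also have "norm \<dots> = norm (\<Sum>u\<in>GF q. chi a u * chi (c - a) (u + 1) * chi (- b) (u + inverse v))"
          using v(2) by (simp add: norm_mult norm_chi)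
        also have "\<dots> \<le> 2 * sqrt q"
        proof (rule weil_bound)
          show "\<not> int n dvd c - a" using 1(1) by (metis dvd_minus_iff minus_diff_eq)
        qed (use v False in \<open>auto intro: inverse_in_GF\<close>)
        finally show ?thesis by (smt (verit) real_sqrt_ge_zero of_nat_0_le_iff)
      qed
      moreover have "norm (gauss (a - c) * gauss b) \<le> sqrt q * sqrt q"
        unfolding norm_mult by (intro mult_mono norm_gauss_le) auto
      ultimately have "norm (\<Sum>u\<in>GF q. chi a u * (E1 u * E2 u)) \<le> (sqrt q * sqrt q) * (3 * sqrt q)"
        by (simp only: norm_mult[of "gauss (a - c) * gauss b"]) (intro mult_mono, auto)
      thus ?thesis by (simp add: sq)
    next
      \<comment> \<open>Here \<open>gauss (a - c) = - 1\<close>, so \<open>E1\<close> has size at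
        most \<open>1\<close>, apart from an extra \<open>n\<close> at \<open>u = 1\<close>.
        Absolute values therefore give \<open>(q + n) * sqrt q\<close>.\<close>
      case 2
      have "norm (\<Sum>u\<in>GF q. chi a u * (E1 u * E2 u)) \<le> (\<Sum>u\<in>(GF q :: 'a set). (1 + (if u = 1 then real n else 0)) * sqrt q)"
      proof (rule sum_norm_le)
        fix u :: 'a assume u: "u \<in> GF q"
        have "norm (E1 u) \<le> norm (chi (c - a) (u + 1) * gauss (a - c)) + norm (if u = 1 then of_nat n else 0 :: complex)"
          using 2 unfolding E1[OF u] by (simp add: norm_triangle_ineq)
        also have "\<dots> \<le> 1 + (if u = 1 then real n else 0)"
          using 2 norm_chi_le by (intro add_mono) (auto simp: norm_mult gauss_trivial)
        finally have e1: "norm (E1 u) \<le> 1 + (if u = 1 then real n else 0)" .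
        have e2: "norm (E2 u) \<le> sqrt q"
          using 2 mult_mono[OF norm_chi_le[of "-b" "1 + v * u"] norm_gauss_le[of b]] by (simp add: E2[OF u] norm_mult)
        have "norm (chi a u) * (norm (E1 u) * norm (E2 u)) \<le> 1 * ((1 + (if u = 1 then real n else 0)) * sqrt q)"
          using e1 e2 norm_chi_le by (intro mult_mono) auto
        thus "norm (chi a u * (E1 u * E2 u)) \<le> (1 + (if u = 1 then real n else 0)) * sqrt q"
          by (simp add: norm_mult)
      qed
      also have "\<dots> = (q + n) * sqrt q"
        by (simp add: sum_distrib_right[symmetric] sum.distrib card_GF_q one_in_GF)
      also have "\<dots> \<le> 3 * q * sqrt q" using n_le_q by (intro mult_right_mono) auto
      finally show ?thesis .
    next
      case 3
      have "norm (\<Sum>u\<in>GF q. chi a u * (E1 u * E2 u)) \<le> (\<Sum>u\<in>GF q. sqrt q * (1 + (if u = inverse v then real n else 0)))"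
      proof (rule sum_norm_le)
        fix u :: 'a assume u: "u \<in> GF q"
        have "norm (E2 u) \<le> norm (chi (- b) (1 + v * u) * gauss b) + norm (if u = inverse v then of_nat n else 0 :: complex)"
          using 3 unfolding E2[OF u] by (simp add: norm_triangle_ineq)
        also have "\<dots> \<le> 1 + (if u = inverse v then real n else 0)"
          using 3 norm_chi_le by (intro add_mono) (auto simp: norm_mult gauss_trivial)
        finally have e2: "norm (E2 u) \<le> 1 + (if u = inverse v then real n else 0)" .
        have e1: "norm (E1 u) \<le> sqrt q"
          using 3 mult_mono[OF norm_chi_le[of "c - a" "u + 1"] norm_gauss_le[of "a - c"]] by (simp add: E1[OF u] norm_mult)
        have "norm (chi a u) * (norm (E1 u) * norm (E2 u)) \<le> 1 * (sqrt q * (1 + (if u = inverse v then real n else 0)))"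
          using e1 e2 norm_chi_le by (intro mult_mono) auto
        thus "norm (chi a u * (E1 u * E2 u)) \<le> sqrt q * (1 + (if u = inverse v then real n else 0))"
          by (simp add: norm_mult)
      qed
      also have "\<dots> = (q + n) * sqrt q"
        using v by (simp add: sum_distrib_left[symmetric] sum.distrib card_GF_q inverse_in_GF mult.commute)
      also have "\<dots> \<le> 3 * q * sqrt q" using n_le_q by (intro mult_right_mono) auto
      finally show ?thesis .
    qed
  qed
  hence "real n * norm (\<Sum>u\<in>GF q. chi a u * (E1 u * E2 u)) \<le> n * (3 * q * sqrt q)"
    by (intro mult_left_mono) auto
  thus ?thesis unfolding gauss4_eq[OF v] E1_def[symmetric] E2_def[symmetric] by (simp add: norm_mult)
qed

end

section \<open>The Fourier transform of a Gordon-Mills-Welch sequence\<close>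

locale gmw_field = char2_field +
  fixes k m l :: nat and B :: "'a set"
  assumes k: "k > 0" and m: "m \<ge> 2" and K_eq: "K = k * m"
    and B: "B \<subseteq> GF (2 ^ k) - {0}" and card_B: "2 * card B = 2 ^ k"
    and diff: "\<And>g. g \<in> GF (2 ^ k) \<Longrightarrow> g \<noteq> 0 \<Longrightarrow> g \<noteq> 1 \<Longrightarrow>
      card {(x, y). x \<in> B \<and> y \<in> B \<and> x / y = g} = l"
begin

definition s :: nat where "s = 2 ^ k"

definition Tr :: "'a \<Rightarrow> 'a" where "Tr x = (\<Sum>j<m. x ^ s ^ j)"

definition delta :: "'a \<Rightarrow> complex" where "delta y = (if y \<in> B then 1 else - 1)"

definition dhat :: "'a \<Rightarrow> complex" where
  "dhat e = (\<Sum>b\<in>GF s. delta b * psi k (e * b)) / of_nat s"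

definition gcoef :: "int \<Rightarrow> complex" where
  "gcoef t = (\<Sum>e\<in>GF s. dhat e * cnj (chi t e))"

text \<open>An element lies in the Gordon-Mills-Welch set exactly when its trace to the subfield
  lies in \<open>B\<close>, so \<open>delta (Tr x)\<close> is the sign at \<open>x\<close> and this
  is its multiplicative Fourier transform.\<close>

definition ft :: "int \<Rightarrow> complex" where
  "ft t = (\<Sum>x\<in>GF q. delta (Tr x) * chi t x)"

lemma q_s: "q = s ^ m" unfolding q_def s_def by (simp only: K_eq power_mult)

lemma finite_GF_s [simp]: "finite (GF s :: 'a set)" and card_GF_s: "card (GF s :: 'a set) = s"
  unfolding s_def using finite_GF_2[OF k] card_GF_2[OF k] by simp_all

lemma s_pos: "s > 0" by (simp add: s_def)

lemma zero_in_GF_s [simp]: "0 \<in> GF s" by (rule zero_in_GF[OF s_pos])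

lemma add_in_GF_s: "x \<in> GF s \<Longrightarrow> y \<in> GF s \<Longrightarrow> (x + y :: 'a) \<in> GF s"
  unfolding s_def by (rule add_in_GF)

lemma GF_s_q: "(x :: 'a) \<in> GF s \<Longrightarrow> x \<in> GF q"
  unfolding q_s by (rule GF_power)

lemma finite_B: "finite B" using B finite_GF_s by (metis Diff_subset finite_subset s_def)

lemma s_sq_le_q: "s\<^sup>2 \<le> q"
  unfolding q_s using m s_pos by (intro power_increasing) auto

lemma K_ge_2: "K \<ge> 2" unfolding K_eq using k m mult_le_mono[of 1 k 2 m] by simp

lemma GF_s_power: "x \<in> GF s \<Longrightarrow> x ^ s ^ j = (x::'a)"
  using GF_power[of x s j] by (simp add: GF_def)

lemma Tr_mult: "c \<in> GF s \<Longrightarrow> Tr (c * x) = c * Tr x"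
  by (simp add: Tr_def power_mult_distrib GF_s_power sum_distrib_left)

lemma Tr_in_GF: "x \<in> GF q \<Longrightarrow> Tr x \<in> GF s"
proof -
  assume x: "x \<in> GF q"
  have "Tr x ^ s + x = (\<Sum>j<m. x ^ s ^ Suc j) + x"
    unfolding Tr_def s_def by (simp add: frobenius_sum mult.commute flip: power_mult)
  also have "\<dots> = (\<Sum>j<Suc m. x ^ s ^ j)" by (subst sum.lessThan_Suc_shift) (simp add: add.commute)
  also have "\<dots> = Tr x + x" using x by (simp add: Tr_def GF_def q_s)
  finally show ?thesis by (simp add: GF_def)
qed

text \<open>Transitivity of the trace: the exponents \<open>j * k + i\<close> run through all
  numbers below \<open>K = k * m\<close>.\<close>

lemma psi_Tr: "psi K x = psi k (Tr x)"
proof -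
  have "trace2 k (Tr x) = (\<Sum>i<k. \<Sum>j<m. x ^ 2 ^ (j * k + i))"
    unfolding trace2_def Tr_def s_def
    by (simp add: frobenius_sum power_add mult.commute flip: power_mult)
  also have "\<dots> = (\<Sum>j<m. \<Sum>i<k. x ^ 2 ^ (j * k + i))" by (rule sum.swap)
  also have "\<dots> = (\<Sum>j<m. \<Sum>i\<in>{j * k..<j * k + k}. x ^ 2 ^ i)"
    by (rule sum.cong[OF refl]) (simp add: sum.atLeastLessThan_shift_0[of _ "_ * k"] atLeast0LessThan)
  also have "\<dots> = trace2 K x" by (simp add: sum.nat_group trace2_def K_eq mult.commute)
  finally show ?thesis by (simp add: psi_def)
qed

lemma sum_psi_s: "c \<in> GF s \<Longrightarrow> (\<Sum>x\<in>GF s. psi k (c * x)) = (if c = 0 then of_nat s else 0)"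
  unfolding s_def by (subst sum_psi_mult[OF k]) simp_all

lemma delta_inversion:
  assumes "b \<in> GF s"
  shows "delta b = (\<Sum>e\<in>GF s. dhat e * psi k (e * b))"
proof -
  have "(\<Sum>e\<in>GF s. dhat e * psi k (e * b)) =
      (\<Sum>e\<in>GF s. \<Sum>b'\<in>GF s. delta b' * psi k ((b' + b) * e) / of_nat s)"
    unfolding dhat_def sum_divide_distrib sum_distrib_right
  proof (intro sum.cong refl)
    fix e b' :: 'a assume "e \<in> GF s" "b' \<in> GF s"
    hence "psi k (e * b' + e * b) = psi k (e * b') * psi k (e * b)"
      using assms mult_in_GF unfolding s_def by (intro psi_add) auto
    thus "delta b' * psi k (e * b') / of_nat s * psi k (e * b) = delta b' * psi k ((b' + b) * e) / of_nat s"
      by (simp add: algebra_simps)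
  qed
  also have "\<dots> = (\<Sum>b'\<in>GF s. delta b' * (\<Sum>e\<in>GF s. psi k ((b' + b) * e)) / of_nat s)"
    by (subst sum.swap) (simp add: sum_distrib_left sum_divide_distrib)
  also have "\<dots> = (\<Sum>b'\<in>GF s. if b' = b then delta b' else 0)"
    using assms s_pos by (intro sum.cong refl) (auto simp: sum_psi_s add_in_GF_s add_eq_0)
  also have "\<dots> = delta b" using assms by simp
  finally show ?thesis ..
qed

lemma sum_delta: "(\<Sum>b\<in>GF s. delta b) = 0"
proof -
  have "(\<Sum>b\<in>GF s. delta b) = (\<Sum>b\<in>GF s. 2 * (if b \<in> B then 1 else 0) - 1)"
    by (intro sum.cong) (auto simp: delta_def)
  also have "\<dots> = 2 * (\<Sum>b\<in>GF s. if b \<in> B then 1 else 0) - of_nat s"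
    by (simp add: sum_subtractf sum_distrib_left card_GF_s)
  also have "(\<Sum>b\<in>GF s. if b \<in> B then 1 else 0 :: complex) = (\<Sum>b\<in>B. 1)"
    by (rule sum.mono_neutral_cong_right) (use B in \<open>auto simp: s_def[symmetric]\<close>)
  also have "2 * (\<Sum>b\<in>B. 1) = complex_of_nat (2 * card B)" by simp
  finally show ?thesis by (simp only: card_B s_def) simp
qed

lemma dhat_0: "dhat 0 = 0"
  by (simp add: dhat_def sum_delta)

text \<open>Fourier inversion over the subfield writes \<open>delta (Tr x)\<close> as a combination
  of additive characters \<open>psi K (x * e)\<close>; each \<open>e\<close> only rescales the Gauss
  sum. The term \<open>e = 0\<close> would not fit this pattern, but it has coefficient
  \<open>0\<close> because \<open>B\<close> fills half of the subfield.\<close>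

lemma ft_eq: "ft t = gauss t * gcoef t"
proof -
  have "ft t = (\<Sum>x\<in>GF q. \<Sum>e\<in>GF s. dhat e * (chi t x * psi K (x * e)))"
    unfolding ft_def
  proof (rule sum.cong[OF refl])
    fix x :: 'a assume x: "x \<in> GF q"
    have "delta (Tr x) * chi t x = (\<Sum>e\<in>GF s. dhat e * psi k (e * Tr x)) * chi t x"
      by (subst delta_inversion[OF Tr_in_GF[OF x]]) simp
    also have "\<dots> = (\<Sum>e\<in>GF s. dhat e * (chi t x * psi K (x * e)))"
      unfolding sum_distrib_right by (intro sum.cong refl) (simp add: psi_Tr Tr_mult mult_ac)
    finally show "delta (Tr x) * chi t x = (\<Sum>e\<in>GF s. dhat e * (chi t x * psi K (x * e)))" .
  qed
  also have "\<dots> = (\<Sum>e\<in>GF s. dhat e * (\<Sum>x\<in>GF q. chi t x * psi K (x * e)))"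
    by (subst sum.swap) (simp add: sum_distrib_left)
  also have "\<dots> = (\<Sum>e\<in>GF s. gauss t * (dhat e * cnj (chi t e)))"
  proof (intro sum.cong refl)
    fix e :: 'a assume e: "e \<in> GF s"
    show "dhat e * (\<Sum>x\<in>GF q. chi t x * psi K (x * e)) = gauss t * (dhat e * cnj (chi t e))"
      by (cases "e = 0") (simp_all add: dhat_0 sum_chi_psi[OF GF_s_q[OF e]] chi_uminus)
  qed
  also have "\<dots> = gauss t * gcoef t" by (simp add: gcoef_def sum_distrib_left)
  finally show ?thesis .
qed

lemma delta_0: "delta 0 = - 1" using B by (auto simp: delta_def)

text \<open>The quotients of elements of \<open>B\<close> hit \<open>1\<close> exactly
  \<open>card B\<close> times and every other nonzero element \<open>l\<close> times; the uniform
  part cancels by \<open>sum0\<close>.\<close>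

lemma norm_sum_B:
  assumes sum0: "(\<Sum>x\<in>GF s. chi t x) = 0"
  shows "norm (\<Sum>b\<in>B. chi t b) ^ 2 = real (card B) - real l"
proof -
  have Bs: "b \<in> GF s" "b \<noteq> 0" if "b \<in> B" for b using that B by (auto simp: s_def)
  have fin: "finite (B \<times> B)" using finite_B by simp
  let ?Y = "GF s - {0} :: 'a set"
  have one: "1 \<in> (GF s :: 'a set)" by (rule one_in_GF)
  have cnt1: "card {p \<in> B \<times> B. fst p / snd p = 1} = card B"
  proof -
    have "{p \<in> B \<times> B. fst p / snd p = 1} = (\<lambda>b. (b, b)) ` B" using Bs by (auto simp: image_iff)
    thus ?thesis by (simp add: card_image inj_on_def)
  qed
  have cnt: "card {p \<in> B \<times> B. fst p / snd p = g} = (if g = 1 then card B else l)" if "g \<in> ?Y" for g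
  proof -
    have "{p \<in> B \<times> B. fst p / snd p = g} = {(x, y). x \<in> B \<and> y \<in> B \<and> x / y = g}" by auto
    thus ?thesis using diff[of g] that cnt1 by (auto simp: s_def)
  qed
  have "complex_of_real (norm (\<Sum>b\<in>B. chi t b) ^ 2) = (\<Sum>b\<in>B. chi t b) * cnj (\<Sum>b\<in>B. chi t b)"
    by (simp only: complex_norm_square)
  also have "\<dots> = (\<Sum>p\<in>B \<times> B. chi t (fst p / snd p))"
    unfolding cnj_sum sum_product sum.cartesian_product
    by (intro sum.cong refl) (auto simp: divide_inverse chi_mult chi_inverse Bs GF_s_q inverse_in_GF)
  also have "\<dots> = (\<Sum>g\<in>?Y. \<Sum>p\<in>{p \<in> B \<times> B. fst p / snd p = g}. chi t (fst p / snd p))"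
    by (rule sum.group[symmetric]) (use fin Bs in \<open>auto intro: divide_in_GF\<close>)
  also have "\<dots> = (\<Sum>g\<in>?Y. of_nat (card {p \<in> B \<times> B. fst p / snd p = g}) * chi t g)"
    by (intro sum.cong refl) simp
  also have "\<dots> = (\<Sum>g\<in>?Y. of_nat l * chi t g + (if g = 1 then of_nat (card B) - of_nat l else 0))"
    by (intro sum.cong refl) (simp add: cnt)
  also have "\<dots> = of_nat l * (\<Sum>g\<in>?Y. chi t g) + (of_nat (card B) - of_nat l)"
    using one by (simp add: sum.distrib sum_distrib_left)
  also have "(\<Sum>g\<in>?Y. chi t g) = (\<Sum>g\<in>GF s. chi t g)"
    by (rule sum.mono_neutral_left) auto
  finally have "complex_of_real (norm (\<Sum>b\<in>B. chi t b) ^ 2) = complex_of_real (real (card B) - real l)"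
    by (simp add: sum0)
  thus ?thesis by (simp only: of_real_eq_iff)
qed

text \<open>Counting all quotients gives \<open>card B ^ 2 = card B + (s - 2) * l\<close> with
  \<open>s = 2 * card B\<close>, and \<open>card B - 1\<close> is cancelled. For
  \<open>s = 2\<close> that factor is zero and \<open>l\<close> is unconstrained.\<close>

lemma card_B_eq:
  assumes "s > 2"
  shows "card B = 2 * l"
proof -
  have Bs: "b \<in> GF s" "b \<noteq> 0" if "b \<in> B" for b using that B by (auto simp: s_def)
  let ?Y = "GF s - {0} :: 'a set"
  have one: "1 \<in> ?Y" using one_in_GF by simp
  have "card B * card B = card (B \<times> B)" by (rule card_cartesian_product[symmetric])
  also have "\<dots> = (\<Sum>g\<in>?Y. card {p \<in> B \<times> B. fst p / snd p = g})"
  proof -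
    have "(\<lambda>p. fst p / snd p) ` (B \<times> B) \<subseteq> ?Y" using Bs by (auto intro: divide_in_GF)
    from sum.group[OF _ _ this, of "\<lambda>_. 1::nat"] show ?thesis using finite_B by simp
  qed
  also have "\<dots> = card {p \<in> B \<times> B. fst p / snd p = 1} + (\<Sum>g\<in>?Y - {1}. card {p \<in> B \<times> B. fst p / snd p = g})"
    using one by (intro sum.remove) auto
  also have "{p \<in> B \<times> B. fst p / snd p = 1} = (\<lambda>b. (b, b)) ` B" using Bs by (auto simp: image_iff)
  also have "card \<dots> = card B" by (simp add: card_image inj_on_def)
  also have "(\<Sum>g\<in>?Y - {1}. card {p \<in> B \<times> B. fst p / snd p = g}) = (\<Sum>g\<in>?Y - {1}. l)"
  proof (intro sum.cong refl)
    fix g assume g: "g \<in> ?Y - {1}"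
    have "{p \<in> B \<times> B. fst p / snd p = g} = {(x, y). x \<in> B \<and> y \<in> B \<and> x / y = g}" by auto
    thus "card {p \<in> B \<times> B. fst p / snd p = g} = l" using diff[of g] g by (auto simp: s_def)
  qed
  also have "\<dots> = (s - 2) * l" using one by (simp add: card_Diff_subset card_GF_s numeral_2_eq_2)
  also have "s - 2 = 2 * (card B - 1)" using card_B by (simp add: s_def)
  finally have eq: "card B * card B = card B + 2 * (card B - 1) * l" .
  have "card B > 1" using assms card_B by (simp add: s_def)
  then obtain j where "card B = Suc j" "j > 0" by (cases "card B") auto
  moreover from this eq have "j * Suc j = j * (2 * l)" by (simp add: algebra_simps)
  ultimately show ?thesis by (simp only: mult_cancel1) simp
qed

text \<open>If the character is trivial on the subfield, Fourier inversion at \<open>0\<close> gives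
  \<open>delta 0 = - 1\<close>. Otherwise \<open>gcoef t\<close> is \<open>2 / s\<close> times a
  Gauss sum of squared modulus \<open>s\<close> over the subfield and a sum over \<open>B\<close> of
  squared modulus \<open>card B - l = s / 4\<close>.\<close>

lemma norm_gcoef: "norm (gcoef t) = 1"
proof (cases "\<forall>e\<in>GF s - {0}. chi t e = 1")
  case True
  have "gcoef t = (\<Sum>e\<in>GF s. dhat e * psi k (e * 0))"
    unfolding gcoef_def using True by (intro sum.cong refl) (auto simp: dhat_0)
  also have "\<dots> = - 1" using delta_inversion[of 0] by (simp add: delta_0)
  finally show ?thesis by simp
next
  case False
  then obtain e0 where e0: "e0 \<in> GF s" "e0 \<noteq> 0" "chi t e0 \<noteq> 1" by blast
  have s2: "s > 2"
  proof (rule ccontr)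
    assume "\<not> s > 2"
    moreover have "s \<ge> 2" using k power_increasing[of 1 k "2::nat"] by (simp add: s_def)
    ultimately have "s = 2" by simp
    hence "e0 = 1" using e0 by (simp add: GF_def power2_eq_square)
    thus False using e0(3) by simp
  qed
  have sum0: "(\<Sum>x\<in>GF s. chi t x) = 0"
  proof -
    have "(\<Sum>x\<in>GF s. chi t x) = (\<Sum>x\<in>GF s. chi t (e0 * x))"
      by (rule sum.reindex_bij_witness[of _ "\<lambda>x. e0 * x" "\<lambda>x. x / e0"])
        (use e0 in \<open>auto intro: mult_in_GF divide_in_GF\<close>)
    also have "\<dots> = chi t e0 * (\<Sum>x\<in>GF s. chi t x)"
      unfolding sum_distrib_left using e0 by (intro sum.cong refl) (simp add: chi_mult GF_s_q)
    finally have "(1 - chi t e0) * (\<Sum>x\<in>GF s. chi t x) = 0" by (simp add: algebra_simps)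
    thus ?thesis using e0(3) by simp
  qed
  define Gs where "Gs = (\<Sum>x\<in>GF s. chi (- t) x * psi k x)"
  have sum0': "(\<Sum>x\<in>GF s. chi (- t) x) = 0" unfolding chi_uminus by (metis cnj_sum complex_cnj_zero sum0)
  have Gs: "norm Gs ^ 2 = s"
  proof -
    have "norm Gs ^ 2 = 2 ^ k" unfolding Gs_def s_def
      by (rule norm_gauss_sum[OF k]) (use sum0' GF_s_q in \<open>auto simp: chi_mult norm_chi s_def\<close>)
    thus ?thesis by (simp add: s_def)
  qed
  have inner: "(\<Sum>e\<in>GF s. chi (- t) e * psi k (e * b)) = chi t b * Gs" if b: "b \<in> GF s" for b
  proof (cases "b = 0")
    case True
    thus ?thesis by (simp add: sum0')
  next
    case False
    have "(\<Sum>e\<in>GF s. chi (- t) e * psi k (e * b)) = (\<Sum>x\<in>GF s. chi (- t) (x * inverse b) * psi k x)"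
      by (rule sum.reindex_bij_witness[of _ "\<lambda>x. x * inverse b" "\<lambda>e. e * b"])
        (use False b in \<open>auto intro: mult_in_GF inverse_in_GF simp: mult.assoc\<close>)
    also have "\<dots> = chi t b * Gs"
      unfolding Gs_def sum_distrib_left using b
      by (intro sum.cong refl) (simp add: chi_mult GF_s_q inverse_in_GF chi_inverse chi_uminus)
    finally show ?thesis .
  qed
  have "gcoef t = (\<Sum>e\<in>GF s. \<Sum>b\<in>GF s. delta b * (chi (- t) e * psi k (e * b)) / of_nat s)"
    unfolding gcoef_def dhat_def sum_divide_distrib sum_distrib_right chi_uminus
    by (intro sum.cong refl) simp
  also have "\<dots> = (\<Sum>b\<in>GF s. delta b * (\<Sum>e\<in>GF s. chi (- t) e * psi k (e * b)) / of_nat s)"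
    by (subst sum.swap) (simp add: sum_distrib_left sum_divide_distrib)
  also have "\<dots> = Gs / of_nat s * (\<Sum>b\<in>GF s. delta b * chi t b)"
    unfolding sum_distrib_left[of "Gs / of_nat s"]
  proof (intro sum.cong refl)
    fix b :: 'a assume b: "b \<in> GF s"
    show "delta b * (\<Sum>e\<in>GF s. chi (- t) e * psi k (e * b)) / of_nat s = Gs / of_nat s * (delta b * chi t b)"
      unfolding inner[OF b] by simp
  qed
  also have "(\<Sum>b\<in>GF s. delta b * chi t b) = (\<Sum>b\<in>GF s. 2 * (if b \<in> B then chi t b else 0) - chi t b)"
    by (intro sum.cong) (auto simp: delta_def)
  also have "\<dots> = 2 * (\<Sum>b\<in>GF s. if b \<in> B then chi t b else 0)"
    by (simp add: sum_subtractf sum_distrib_left sum0)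
  also have "(\<Sum>b\<in>GF s. if b \<in> B then chi t b else 0) = (\<Sum>b\<in>B. chi t b)"
    by (rule sum.mono_neutral_cong_right) (use B in \<open>auto simp: s_def[symmetric]\<close>)
  finally have "gcoef t = Gs / of_nat s * (2 * (\<Sum>b\<in>B. chi t b))" .
  hence "norm (gcoef t) ^ 2 = norm Gs ^ 2 / real s ^ 2 * (4 * norm (\<Sum>b\<in>B. chi t b) ^ 2)"
    by (simp add: norm_mult norm_divide power_mult_distrib power_divide)
  also have "\<dots> = 1"
  proof -
    have "s = 4 * l" using card_B card_B_eq[OF s2] by (simp add: s_def[symmetric])
    hence "4 * (real (card B) - real l) = real s" using card_B_eq[OF s2] by simp
    thus ?thesis unfolding Gs norm_sum_B[OF sum0] using s_pos by (simp add: power2_eq_square)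
  qed
  finally show ?thesis using norm_ge_zero[of "gcoef t"] unfolding power2_eq_1_iff by linarith
qed

end

section \<open>Moments of the Fourier transform of a Gordon-Mills-Welch sequence\<close>

context gmw_field
begin

text \<open>Linear combinations of the characters \<open>t \<mapsto> chi t v\<close> with \<open>v\<close> in the multiplicative group of
  the subfield. The coefficients of \<open>h\<close> are square summable with total mass \<open>1\<close> if \<open>h\<close> is unimodular;
  compared with the trivial bound this saves a factor \<open>sqrt s\<close> in the fourth moment below.\<close>

definition sub_rep :: "(int \<Rightarrow> complex) \<Rightarrow> bool" where
  "sub_rep h \<longleftrightarrow> (\<exists>c. \<forall>t. h t = (\<Sum>v\<in>GF s - {0}. c v * chi t v))"

lemma sub_rep_cnj: "sub_rep h \<Longrightarrow> sub_rep (\<lambda>t. cnj (h t))"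
proof -
  assume "sub_rep h"
  then obtain c where c: "\<And>t. h t = (\<Sum>v\<in>GF s - {0}. c v * chi t v)" by (auto simp: sub_rep_def)
  have "cnj (h t) = (\<Sum>v\<in>GF s - {0}. cnj (c (inverse v)) * chi t v)" for t
  proof -
    have "cnj (h t) = (\<Sum>v\<in>GF s - {0}. cnj (c v) * chi t (inverse v))"
      unfolding c cnj_sum by (intro sum.cong refl) (auto simp: chi_inverse GF_s_q)
    also have "\<dots> = (\<Sum>v\<in>GF s - {0}. cnj (c (inverse v)) * chi t v)"
      by (rule sum.reindex_bij_witness[of _ inverse inverse]) (auto intro: inverse_in_GF)
    finally show ?thesis .
  qed
  thus ?thesis unfolding sub_rep_def by (intro exI[of _ "\<lambda>v. cnj (c (inverse v))"]) blast
qed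

lemma sub_rep_gcoef: "sub_rep (\<lambda>t. gcoef (t + a))"
proof -
  have "gcoef (t + a) = (\<Sum>v\<in>GF s - {0}. dhat (inverse v) * cnj (chi a (inverse v)) * chi t v)" for t
  proof -
    have "gcoef (t + a) = (\<Sum>e\<in>GF s - {0}. dhat e * cnj (chi a e) * chi t (inverse e))"
      unfolding gcoef_def
      by (rule sum.mono_neutral_cong_right) (auto simp: chi_add chi_inverse GF_s_q)
    also have "\<dots> = (\<Sum>v\<in>GF s - {0}. dhat (inverse v) * cnj (chi a (inverse v)) * chi t v)"
      by (rule sum.reindex_bij_witness[of _ inverse inverse]) (auto intro: inverse_in_GF)
    finally show ?thesis .
  qed
  thus ?thesis unfolding sub_rep_def
    by (intro exI[of _ "\<lambda>v. dhat (inverse v) * cnj (chi a (inverse v))"] allI)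
qed

lemma sub_rep_mult:
  assumes "sub_rep g" and "sub_rep h"
  shows "sub_rep (\<lambda>t. g t * h t)"
proof -
  let ?Y = "GF s - {0} :: 'a set"
  obtain c where c: "\<And>t. g t = (\<Sum>v\<in>?Y. c v * chi t v)" using assms(1) by (auto simp: sub_rep_def)
  obtain d where d: "\<And>t. h t = (\<Sum>v\<in>?Y. d v * chi t v)" using assms(2) by (auto simp: sub_rep_def)
  have "g t * h t = (\<Sum>u\<in>?Y. (\<Sum>v\<in>?Y. c v * d (u / v)) * chi t u)" for t
  proof -
    have "g t * h t = (\<Sum>v\<in>?Y. \<Sum>w\<in>?Y. c v * d w * chi t (v * w))"
      unfolding c d sum_product by (intro sum.cong refl) (auto simp: chi_mult GF_s_q)
    also have "\<dots> = (\<Sum>v\<in>?Y. \<Sum>u\<in>?Y. c v * d (u / v) * chi t u)"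
    proof (rule sum.cong[OF refl])
      fix v assume v: "v \<in> ?Y"
      show "(\<Sum>w\<in>?Y. c v * d w * chi t (v * w)) = (\<Sum>u\<in>?Y. c v * d (u / v) * chi t u)"
        by (rule sum.reindex_bij_witness[of _ "\<lambda>u. u / v" "\<lambda>w. v * w"])
          (use v in \<open>auto intro: mult_in_GF divide_in_GF\<close>)
    qed
    also have "\<dots> = (\<Sum>u\<in>?Y. (\<Sum>v\<in>?Y. c v * d (u / v)) * chi t u)"
      by (subst sum.swap) (simp add: sum_distrib_right)
    finally show ?thesis .
  qed
  thus ?thesis unfolding sub_rep_def
    by (intro exI[of _ "\<lambda>u. \<Sum>v\<in>?Y. c v * d (u / v)"] allI)
qed

lemma sub_rep_bound:
  assumes "sub_rep h" and h: "\<And>t. norm (h t) = 1"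
    and M: "\<And>v. v \<in> GF s \<Longrightarrow> v \<noteq> 0 \<Longrightarrow> norm (\<Sum>t<n. chi (int t) v * p (int t)) \<le> M"
  shows "norm (\<Sum>t<n. h (int t) * p (int t)) \<le> sqrt s * M"
proof -
  let ?Y = "GF s - {0} :: 'a set"
  obtain c where c: "\<And>t. h t = (\<Sum>v\<in>?Y. c v * chi t v)" using assms(1) by (auto simp: sub_rep_def)
  have M0: "M \<ge> 0" using order.trans[OF norm_ge_zero M[OF one_in_GF]] by simp
  \<comment> \<open>Parseval: \<open>n\<close> is the sum of \<open>norm (h t) ^ 2\<close> over a
    period, and the characters of \<open>t\<close> attached to distinct \<open>v\<close> are
    orthogonal there.\<close>
  have "complex_of_real (real n) = (\<Sum>t<n. h (int t) * cnj (h (int t)))"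
    using h by (simp add: complex_norm_square[symmetric])
  also have "\<dots> = (\<Sum>t<n. \<Sum>v\<in>?Y. \<Sum>w\<in>?Y. c v * cnj (c w) * chi (int t) (v * inverse w))"
    unfolding c cnj_sum sum_product
    by (intro sum.cong refl) (auto simp: chi_mult chi_inverse inverse_in_GF GF_s_q)
  also have "\<dots> = (\<Sum>v\<in>?Y. \<Sum>w\<in>?Y. c v * cnj (c w) * (\<Sum>t<n. chi (int t) (v * inverse w)))"
    unfolding sum_distrib_left by (subst sum.swap, rule sum.cong[OF refl], rule sum.swap)
  also have "\<dots> = (\<Sum>v\<in>?Y. \<Sum>w\<in>?Y. if w = v then of_nat n * (c v * cnj (c v)) else 0)"
  proof (intro sum.cong refl)
    fix v w assume vw: "v \<in> ?Y" "w \<in> ?Y"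
    have "v * inverse w = 1 \<longleftrightarrow> w = v" using vw by (auto simp: field_simps)
    moreover have "(\<Sum>t<n. chi (int t) (v * inverse w)) = (if v * inverse w = 1 then of_nat n else 0)"
      by (rule sum_k_chi) (use vw GF_s_q in \<open>auto intro!: mult_in_GF inverse_in_GF\<close>)
    ultimately show "c v * cnj (c w) * (\<Sum>t<n. chi (int t) (v * inverse w)) =
        (if w = v then of_nat n * (c v * cnj (c v)) else 0)" by simp
  qed
  also have "\<dots> = (\<Sum>v\<in>?Y. of_nat n * (c v * cnj (c v)))" by (intro sum.cong refl) simp
  also have "\<dots> = complex_of_real (n * (\<Sum>v\<in>?Y. norm (c v) ^ 2))"
    by (simp add: sum_distrib_left complex_norm_square[symmetric] flip: of_real_power)
  finally have "real n = n * (\<Sum>v\<in>?Y. norm (c v) ^ 2)" by (simp only: of_real_eq_iff)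
  hence mass: "(\<Sum>v\<in>?Y. norm (c v) ^ 2) = 1" using n_pos by simp
  have "(\<Sum>v\<in>?Y. norm (c v))\<^sup>2 \<le> (\<Sum>v\<in>?Y. norm (c v) ^ 2) * card ?Y"
    by (rule sum_squared_le_sum_of_squares)
  also have "\<dots> \<le> s" using card_GF_s by (simp add: mass card_Diff_singleton)
  finally have l1: "(\<Sum>v\<in>?Y. norm (c v)) \<le> sqrt s" by (rule real_le_rsqrt)
  have "(\<Sum>t<n. h (int t) * p (int t)) = (\<Sum>v\<in>?Y. c v * (\<Sum>t<n. chi (int t) v * p (int t)))"
    unfolding c sum_distrib_right sum_distrib_left by (subst sum.swap) (simp add: mult.assoc)
  also have "norm \<dots> \<le> (\<Sum>v\<in>?Y. norm (c v) * M)"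
    by (rule sum_norm_le) (auto simp: norm_mult intro!: mult_left_mono M)
  also have "\<dots> = (\<Sum>v\<in>?Y. norm (c v)) * M" by (simp add: sum_distrib_right)
  also have "\<dots> \<le> sqrt s * M" using l1 M0 by (rule mult_right_mono)
  finally show ?thesis .
qed

definition moment :: "int \<Rightarrow> int \<Rightarrow> int \<Rightarrow> complex" where
  "moment a b c = (\<Sum>t<n. ft (int t + a) * ft (int t + b) * cnj (ft (int t + c)) * cnj (ft (int t)))"

text \<open>The four factors \<open>gcoef\<close> combine to a unimodular combination of twists
  \<open>chi t v\<close>, and each twist leaves a sum \<open>gauss4\<close>. The subfield is proper,
  so \<open>s \<le> sqrt q\<close> and the loss \<open>sqrt s\<close> is at most
  \<open>q ^ (1 / 4)\<close>.\<close>

lemma moment_unpaired: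
  assumes "\<not> (int n dvd a - c \<and> int n dvd b)" and "\<not> (int n dvd a \<and> int n dvd b - c)"
  shows "norm (moment a b c) \<le> 3 * q\<^sup>2 * sqrt q * sqrt (sqrt q)"
proof -
  define h where "h t = gcoef (t + a) * gcoef (t + b) * cnj (gcoef (t + c)) * cnj (gcoef (t + 0))" for t
  define p where "p t = gauss (t + a) * gauss (t + b) * cnj (gauss (t + c)) * cnj (gauss t)" for t
  have "sub_rep h" unfolding h_def
    by (intro sub_rep_mult sub_rep_cnj sub_rep_gcoef)
  moreover have "norm (h t) = 1" for t by (simp add: h_def norm_mult norm_gcoef)
  moreover have "norm (\<Sum>t<n. chi (int t) v * p (int t)) \<le> n * (3 * q * sqrt q)"
    if "v \<in> GF s" "v \<noteq> 0" for v
    using norm_gauss4_le[OF K_ge_2 GF_s_q[OF that(1)] that(2) assms] by (simp add: gauss4_def p_def)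
  ultimately have "norm (\<Sum>t<n. h (int t) * p (int t)) \<le> sqrt s * (n * (3 * q * sqrt q))"
    by (rule sub_rep_bound)
  also have "(\<Sum>t<n. h (int t) * p (int t)) = moment a b c"
    unfolding moment_def h_def p_def ft_eq by (intro sum.cong refl) (simp add: mult_ac)
  also have "sqrt s * (n * (3 * q * sqrt q)) \<le> sqrt (sqrt q) * (q * (3 * q * sqrt q))"
  proof (intro mult_mono)
    have "real (s\<^sup>2) \<le> real q" using s_sq_le_q by (simp only: of_nat_le_iff)
    hence "real s \<le> sqrt q" by (intro real_le_rsqrt) simp
    thus "sqrt s \<le> sqrt (sqrt q)" by simp
  qed (auto simp: q_eq)
  finally show ?thesis by (simp add: power2_eq_square mult_ac)
qed

lemma ft_cong: "[x = y] (mod int n) \<Longrightarrow> ft x = ft y"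
  unfolding ft_def by (simp add: chi_cong)

lemma norm_ft: "norm (ft t) ^ 2 = (if int n dvd t then 1 else q)"
  by (simp add: ft_eq norm_mult norm_gcoef gauss_trivial norm_gauss)

lemma sum_dvd_shift_le: "(\<Sum>t<n. if int n dvd int t + a then 1 else 0 :: real) \<le> 1"
proof -
  have "t = t'" if "t < n" "t' < n" "int n dvd int t + a" "int n dvd int t' + a" for t t'
  proof -
    have "int n dvd (int t + a) - (int t' + a)" using that(3,4) by (rule dvd_diff)
    hence "[int t = int t'] (mod int n)" by (simp add: cong_iff_dvd_diff)
    thus ?thesis using that(1,2) by (simp add: cong_int_iff cong_less_modulus_unique_nat)
  qed
  hence "card {t \<in> {..<n}. int n dvd int t + a} \<le> 1"
    by (intro card_le_Suc0_iff_eq[THEN iffD2, unfolded One_nat_def[symmetric]]) auto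
  moreover have "(\<Sum>t<n. if int n dvd int t + a then 1 else 0 :: real) = real (card {t \<in> {..<n}. int n dvd int t + a})"
    by (simp flip: sum.inter_filter)
  ultimately show ?thesis by simp
qed

text \<open>All squared moduli are \<open>q\<close>, except at the at most two indices where one
  argument is a multiple of \<open>n\<close>. Replacing \<open>n * q\<^sup>2\<close> by
  \<open>n ^ 3\<close> costs \<open>2 * n\<^sup>2 + n\<close>, which is of the same order.\<close>

lemma paired_sum: "\<bar>(\<Sum>t<n. norm (ft (int t + a)) ^ 2 * norm (ft (int t)) ^ 2) - real n ^ 3\<bar> \<le> 2 * q\<^sup>2"
proof -
  let ?S = "\<Sum>t<n. norm (ft (int t + a)) ^ 2 * norm (ft (int t)) ^ 2"
  have q1: "real q \<ge> 1" using q_gt_1 by simp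
  have "?S \<le> (\<Sum>t<n. (real q)\<^sup>2)"
  proof (rule sum_mono)
    fix t
    have "norm (ft x) ^ 2 \<le> q" for x using q1 by (simp add: norm_ft)
    hence "norm (ft (int t + a)) ^ 2 * norm (ft (int t)) ^ 2 \<le> real q * real q"
      by (intro mult_mono) auto
    thus "norm (ft (int t + a)) ^ 2 * norm (ft (int t)) ^ 2 \<le> (real q)\<^sup>2"
      by (simp add: power2_eq_square)
  qed
  hence up: "?S \<le> n * (real q)\<^sup>2" by simp
  have "(\<Sum>t<n. (real q)\<^sup>2 - (real q)\<^sup>2 * (if int n dvd int t + a then 1 else 0) - (real q)\<^sup>2 * (if int n dvd int t + 0 then 1 else 0)) \<le> ?S"
    by (rule sum_mono) (use q1 in \<open>auto simp: norm_ft simp flip: power2_eq_square intro: order.trans[OF _ zero_le_power2]\<close>)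
  also have "(\<Sum>t<n. (real q)\<^sup>2 - (real q)\<^sup>2 * (if int n dvd int t + a then 1 else 0) - (real q)\<^sup>2 * (if int n dvd int t + 0 then 1 else 0)) =
      n * (real q)\<^sup>2 - (real q)\<^sup>2 * (\<Sum>t<n. if int n dvd int t + a then 1 else 0)
        - (real q)\<^sup>2 * (\<Sum>t<n. if int n dvd int t + 0 then 1 else 0)"
    unfolding sum_subtractf sum_distrib_left by simp
  finally have "n * (real q)\<^sup>2 - (real q)\<^sup>2 * 1 - (real q)\<^sup>2 * 1 \<le> ?S"
    using mult_left_mono[OF sum_dvd_shift_le[of a], of "(real q)\<^sup>2"]
      mult_left_mono[OF sum_dvd_shift_le[of 0], of "(real q)\<^sup>2"] by simp
  moreover have "n * (real q)\<^sup>2 - real n ^ 3 = 2 * (real n)\<^sup>2 + n"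
    unfolding q_eq by (simp add: power2_eq_square power3_eq_cube algebra_simps)
  moreover have "2 * (real n)\<^sup>2 + n \<le> 2 * (real q)\<^sup>2"
    unfolding q_eq by (simp add: power2_eq_square algebra_simps)
  moreover have "0 \<le> 2 * (real n)\<^sup>2 + n" by simp
  ultimately show ?thesis using up by (simp only: of_nat_power of_nat_mult of_nat_numeral)
qed

theorem moment_estimate:
  "norm (moment a b c -
      (if int n dvd a - c \<and> int n dvd b \<or> int n dvd a \<and> int n dvd b - c then of_nat n ^ 3 else 0))
    \<le> 3 * q\<^sup>2 * sqrt q * sqrt (sqrt q)"
proof -
  have P: "norm (moment a b c - of_nat n ^ 3) \<le> 3 * q\<^sup>2 * sqrt q * sqrt (sqrt q)"
    if "moment a b c = (\<Sum>t<n. complex_of_real (norm (ft (int t + e)) ^ 2 * norm (ft (int t)) ^ 2))" for e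
  proof -
    have "moment a b c - of_nat n ^ 3 =
        complex_of_real ((\<Sum>t<n. norm (ft (int t + e)) ^ 2 * norm (ft (int t)) ^ 2) - real n ^ 3)"
      unfolding that by simp
    hence "norm (moment a b c - of_nat n ^ 3) \<le> 2 * q\<^sup>2"
      using paired_sum[of e] by (simp only: norm_of_real)
    also have "\<dots> \<le> 3 * q\<^sup>2 * (sqrt q * sqrt (sqrt q))"
    proof -
      have "1 \<le> sqrt q * sqrt (sqrt q)" using q_gt_1 mult_mono[of 1 "sqrt q" 1 "sqrt (sqrt q)"] by simp
      hence "2 * real (q\<^sup>2) * 1 \<le> 3 * real (q\<^sup>2) * (sqrt q * sqrt (sqrt q))" by (intro mult_mono) auto
      thus ?thesis by simp
    qed
    finally show ?thesis by (simp add: mult_ac)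
  qed
  consider "int n dvd a - c" "int n dvd b" | "int n dvd a" "int n dvd b - c"
    | "\<not> (int n dvd a - c \<and> int n dvd b)" "\<not> (int n dvd a \<and> int n dvd b - c)" by blast
  thus ?thesis
  proof cases
    case 1
    have "moment a b c = (\<Sum>t<n. complex_of_real (norm (ft (int t + c)) ^ 2 * norm (ft (int t)) ^ 2))"
      unfolding moment_def
    proof (intro sum.cong refl)
      fix t
      have "ft (int t + a) = ft (int t + c)" "ft (int t + b) = ft (int t)"
        using 1 by (auto intro!: ft_cong simp: cong_iff_dvd_diff)
      thus "ft (int t + a) * ft (int t + b) * cnj (ft (int t + c)) * cnj (ft (int t)) =
        complex_of_real (norm (ft (int t + c)) ^ 2 * norm (ft (int t)) ^ 2)"
        unfolding of_real_mult complex_norm_square by (simp add: mult_ac)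
    qed
    from P[OF this] show ?thesis using 1 by simp
  next
    case 2
    have "moment a b c = (\<Sum>t<n. complex_of_real (norm (ft (int t + c)) ^ 2 * norm (ft (int t)) ^ 2))"
      unfolding moment_def
    proof (intro sum.cong refl)
      fix t
      have "ft (int t + b) = ft (int t + c)" "ft (int t + a) = ft (int t)"
        using 2 by (auto intro!: ft_cong simp: cong_iff_dvd_diff)
      thus "ft (int t + a) * ft (int t + b) * cnj (ft (int t + c)) * cnj (ft (int t)) =
        complex_of_real (norm (ft (int t + c)) ^ 2 * norm (ft (int t)) ^ 2)"
        unfolding of_real_mult complex_norm_square by (simp add: mult_ac)
    qed
    from P[OF this] show ?thesis using 2 by simp
  next
    case 3
    thus ?thesis using moment_unpaired[of a c b] by auto
  qed
qed

lemma ft_eq_dft: "ft t = (\<Sum>j<n. delta (Tr (\<theta> ^ j)) * cis (2 * pi * t * j / n))"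
proof -
  have "ft t = (\<Sum>x\<in>GF q - {0}. delta (Tr x) * chi t x)"
    unfolding ft_def by (rule sum.mono_neutral_right) auto
  also have "\<dots> = (\<Sum>j<n. delta (Tr (\<theta> ^ j)) * chi t (\<theta> ^ j))"
    by (rule sum.reindex_bij_betw[OF bij_betw_\<theta>, symmetric])
  finally show ?thesis by (simp add: chi_\<theta>)
qed

end

section \<open>Window sums of periodic sequences\<close>

definition root_unity :: "nat \<Rightarrow> int \<Rightarrow> complex" where
  "root_unity N x = cis (2 * pi * x / N)"

lemma root_unity_add: "root_unity N (x + y) = root_unity N x * root_unity N y"
  by (simp add: root_unity_def cis_mult add_divide_distrib[symmetric] algebra_simps)

lemma root_unity_0 [simp]: "root_unity N 0 = 1"
  by (simp add: root_unity_def)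

lemma root_unity_uminus: "root_unity N (- x) = cnj (root_unity N x)"
  by (simp add: root_unity_def cis_cnj)

lemma norm_root_unity [simp]: "norm (root_unity N x) = 1"
  by (simp add: root_unity_def)

lemma root_unity_power: "root_unity N x ^ j = root_unity N (int j * x)"
  by (simp add: root_unity_def Complex.DeMoivre mult_ac)

lemma root_unity_eq_1_iff: "N > 0 \<Longrightarrow> root_unity N x = 1 \<longleftrightarrow> int N dvd x"
proof
  assume N: "N > 0" and "root_unity N x = 1"
  hence "cos (2 * pi * x / N) = 1" by (simp add: root_unity_def complex_eq_iff)
  then obtain m :: int where "2 * pi * x / N = 2 * pi * m" by (auto simp: cos_one_2pi_int)
  hence "real_of_int x = real_of_int (int N * m)" using N by (simp add: field_simps)
  thus "int N dvd x" unfolding of_int_eq_iff by simp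
next
  assume N: "N > 0" and "int N dvd x"
  then obtain m where "x = int N * m" by (rule_tac dvdE)
  hence "2 * pi * x / N = 2 * pi * m" using N by (simp add: field_simps)
  thus "root_unity N x = 1" by (simp add: root_unity_def cis_multiple_2pi)
qed

lemma root_unity_cong: "N > 0 \<Longrightarrow> int N dvd x - y \<Longrightarrow> root_unity N x = root_unity N y"
  using root_unity_add[of N "x - y" y] root_unity_eq_1_iff[of N "x - y"] by simp

lemma root_unity_mult: "M > 0 \<Longrightarrow> root_unity (M * n) (int M * x) = root_unity n x"
  by (simp add: root_unity_def mult.assoc)

lemma sum_root_unity:
  assumes "N > 0"
  shows "(\<Sum>l<N. root_unity N (x * int l)) = (if int N dvd x then of_nat N else 0)"
proof (cases "int N dvd x")
  case True
  hence "root_unity N (x * int l) = 1" for l using assms by (simp add: root_unity_eq_1_iff)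
  thus ?thesis using True by simp
next
  case False
  have "(\<Sum>l<N. root_unity N (x * int l)) = (\<Sum>l<N. root_unity N x ^ l)"
    by (simp add: root_unity_power mult.commute)
  moreover have "root_unity N x ^ N = 1"
    using assms by (simp add: root_unity_power root_unity_eq_1_iff)
  moreover have "root_unity N x \<noteq> 1" using False assms by (simp add: root_unity_eq_1_iff)
  ultimately show ?thesis using False by (simp add: sum_gp_strict)
qed

lemma sum_periodic_reindex:
  fixes g :: "int \<Rightarrow> 'b::comm_monoid_add"
  assumes per: "\<And>x y. int n dvd x - y \<Longrightarrow> g x = g y"
    and inj: "\<And>x y. int n dvd h x - h y \<Longrightarrow> int n dvd x - y"
  shows "(\<Sum>k<n. g (h (int k))) = (\<Sum>k<n. g (int k))"
proof (cases "n = 0")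
  case False
  define \<pi> where "\<pi> k = nat (h (int k) mod int n)" for k
  have \<pi>: "int (\<pi> k) = h (int k) mod int n" for k using False by (simp add: \<pi>_def)
  have \<pi>_lt: "\<pi> k < n" for k using False \<pi>[of k] by (metis of_nat_less_iff pos_mod_bound of_nat_0_less_iff neq0_conv)
  have "inj_on \<pi> {..<n}"
  proof (rule inj_onI)
    fix k k' assume k: "k \<in> {..<n}" "k' \<in> {..<n}" "\<pi> k = \<pi> k'"
    hence "h (int k) mod int n = h (int k') mod int n" using \<pi> by metis
    hence "int n dvd h (int k) - h (int k')" by (simp add: mod_eq_dvd_iff)
    hence "int n dvd int k - int k'" by (rule inj)
    hence "int k mod int n = int k' mod int n" by (simp add: mod_eq_dvd_iff)
    thus "k = k'" using k by simp
  qed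
  moreover have "\<pi> ` {..<n} \<subseteq> {..<n}" using \<pi>_lt by auto
  ultimately have bij: "bij_betw \<pi> {..<n} {..<n}"
    by (simp add: bij_betw_def endo_inj_surj)
  have "(\<Sum>k<n. g (h (int k))) = (\<Sum>k<n. g (int (\<pi> k)))"
    by (intro sum.cong refl per) (simp add: \<pi> flip: mod_eq_dvd_iff)
  also have "\<dots> = (\<Sum>k<n. g (int k))" by (rule sum.reindex_bij_betw[OF bij])
  finally show ?thesis .
qed simp

lemma sum_periodic_shift:
  fixes g :: "int \<Rightarrow> 'b::comm_monoid_add"
  assumes "\<And>x y. int n dvd x - y \<Longrightarrow> g x = g y"
  shows "(\<Sum>k<n. g (int k + a)) = (\<Sum>k<n. g (int k))"
  using sum_periodic_reindex[of n g "\<lambda>x. x + a"] assms by simp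

lemma sum_periodic_reflect:
  fixes g :: "int \<Rightarrow> 'b::comm_monoid_add"
  assumes "\<And>x y. int n dvd x - y \<Longrightarrow> g x = g y"
  shows "(\<Sum>k<n. g (a - int k)) = (\<Sum>k<n. g (int k))"
proof (rule sum_periodic_reindex[OF assms])
  fix x y assume "int n dvd (a - x) - (a - y)"
  hence "int n dvd - (x - y)" by simp
  thus "int n dvd x - y" by (simp only: dvd_minus_iff)
qed

lemma dft_inversion:
  fixes d :: "int \<Rightarrow> complex"
  assumes n: "n > 0" and per: "\<And>x y. int n dvd x - y \<Longrightarrow> d x = d y"
    and F: "\<And>t. F t = (\<Sum>j<n. d (int j) * root_unity n (t * int j))"
  shows "d i = (\<Sum>k<n. F (int k) * root_unity n (- int k * i)) / of_nat n"
proof -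
  have "(\<Sum>k<n. F (int k) * root_unity n (- int k * i)) = (\<Sum>k<n. \<Sum>j<n. d (int j) * root_unity n ((int j - i) * int k))"
    unfolding F sum_distrib_right
  proof (intro sum.cong refl)
    fix j k
    have "(int j - i) * int k = int k * int j + - int k * i" by (simp add: algebra_simps)
    thus "d (int j) * root_unity n (int k * int j) * root_unity n (- int k * i) = d (int j) * root_unity n ((int j - i) * int k)"
      by (simp only: root_unity_add mult.assoc)
  qed
  also have "\<dots> = (\<Sum>j<n. d (int j) * (if int n dvd int j - i then of_nat n else 0))"
    by (subst sum.swap) (simp add: sum_distrib_left[symmetric] sum_root_unity[OF n])
  also have "\<dots> = (\<Sum>j<n. d i * (if int n dvd (int j - i) then of_nat n else 0))"
    by (intro sum.cong refl) (auto simp: per)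
  also have "\<dots> = d i * (\<Sum>j<n. (\<lambda>x. if int n dvd x then of_nat n else 0) (int j + (- i)))"
    by (simp add: sum_distrib_left)
  also have "(\<Sum>j<n. (\<lambda>x. if int n dvd x then of_nat n else 0) (int j + (- i))) =
      (\<Sum>j<n. (\<lambda>x. if int n dvd x then of_nat n else 0 :: complex) (int j))"
    by (rule sum_periodic_shift) (metis dvd_add_right_iff diff_add_cancel dvd_add_left_iff)
  also have "\<dots> = (\<Sum>j<n. if j = 0 then of_nat n else 0)"
    by (intro sum.cong refl) (auto dest: dvd_imp_le)
  finally show ?thesis using n by simp
qed

definition dirichlet :: "nat \<Rightarrow> nat \<Rightarrow> int \<Rightarrow> complex" where
  "dirichlet N t x = (\<Sum>j<t. root_unity N (int j * x))"

lemma dirichlet_cong: "N > 0 \<Longrightarrow> int N dvd x - y \<Longrightarrow> dirichlet N t x = dirichlet N t y"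
  unfolding dirichlet_def
  by (intro sum.cong refl root_unity_cong) (simp_all flip: right_diff_distrib)

lemma norm_dirichlet_le: "norm (dirichlet N t x) \<le> t"
  unfolding dirichlet_def using sum_norm_le[of "{..<t}" "\<lambda>j. root_unity N (int j * x)" "\<lambda>_. 1"] by simp

lemma sin_ge_linear:
  assumes "0 \<le> x" and "x \<le> pi / 2"
  shows "sin x \<ge> 2 / pi * x"
proof -
  have "convex_on {0..pi/2} (\<lambda>x. - sin x)"
    by (rule f''_ge0_imp_convex[where f' = "\<lambda>x. - cos x" and f'' = sin])
      (auto intro!: derivative_eq_intros sin_ge_zero)
  from convex_onD_Icc'[OF this, of x] assms show ?thesis by simp
qed

text \<open>The geometric series is at most \<open>1 / sin (pi * x / N)\<close>, and Jordan's
  inequality applies at the nearer end of the period. Adding the bounds for both ends spares later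
  uses a case distinction.\<close>

lemma norm_dirichlet_le2:
  assumes "0 < x" and "x < int N"
  shows "norm (dirichlet N t x) \<le> real N / (2 * real_of_int x) + real N / (2 * (real N - real_of_int x))"
proof -
  define y where "y = pi * x / N"
  have N: "N > 0" using assms by simp
  have y: "0 < y" "y < pi" using assms N by (auto simp: y_def field_simps)
  have "\<not> int N dvd x" using assms by (auto dest: zdvd_imp_le)
  hence ne: "root_unity N x \<noteq> 1" using N by (simp add: root_unity_eq_1_iff)
  have "dirichlet N t x = (\<Sum>j<t. root_unity N x ^ j)"
    by (simp add: dirichlet_def root_unity_power)
  also have "\<dots> = (1 - root_unity N x ^ t) / (1 - root_unity N x)" using ne by (simp add: sum_gp_strict)
  finally have "norm (dirichlet N t x) = norm (1 - root_unity N x ^ t) / norm (root_unity N x - 1)"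
    by (simp add: norm_divide norm_minus_commute)
  also have "norm (root_unity N x - 1) = 2 * \<bar>sin y\<bar>"
    using dist_exp_i_1[of "2 * y"] by (simp add: root_unity_def y_def cis_conv_exp mult_ac)
  also have "norm (1 - root_unity N x ^ t) \<le> 2"
    using norm_triangle_ineq4[of 1 "root_unity N x ^ t"] by (simp add: norm_power)
  finally have 1: "norm (dirichlet N t x) \<le> 1 / sin y"
    using sin_gt_zero[OF y] by (simp add: divide_right_mono)
  have 2: "1 / sin z \<le> pi / (2 * z)" if "0 < z" "z \<le> pi / 2" for z
  proof -
    have "0 < 2 / pi * z" using that by simp
    moreover have "2 / pi * z \<le> sin z" using that by (intro sin_ge_linear) auto
    ultimately have "1 / sin z \<le> 1 / (2 / pi * z)" by (intro frac_le) auto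
    thus ?thesis by (simp add: field_simps)
  qed
  show ?thesis
  proof (cases "y \<le> pi / 2")
    case True
    have "1 / sin y \<le> pi / (2 * y)" using 2 y True by simp
    also have "pi / (2 * y) = real N / (2 * real_of_int x)" using N assms by (simp add: y_def field_simps)
    also have "\<dots> \<le> real N / (2 * real_of_int x) + real N / (2 * (real N - real_of_int x))" using assms by simp
    finally show ?thesis using 1 by simp
  next
    case False
    have "1 / sin y = 1 / sin (pi - y)" by simp
    also have "\<dots> \<le> pi / (2 * (pi - y))" using 2[of "pi - y"] y False by simp
    also have "pi / (2 * (pi - y)) = real N / (2 * (real N - real_of_int x))" using N assms by (simp add: y_def field_simps)
    also have "\<dots> \<le> real N / (2 * real_of_int x) + real N / (2 * (real N - real_of_int x))" using assms by simp
    finally show ?thesis using 1 by simp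
  qed
qed

text \<open>By periodicity the arguments may be taken as \<open>x0 + M * a\<close> with
  \<open>0 \<le> x0 < M\<close>. The two extreme values of \<open>a\<close> can lie close to a
  multiple of the period and get the trivial bound \<open>t\<close> each; the others give
  \<open>n / (2 * a)\<close> and \<open>n / (2 * (n - 1 - a))\<close>, which sum to at most
  \<open>n * harm n\<close>.\<close>

lemma sum_norm_dirichlet_le:
  assumes n: "n > 0" and M: "M > 0"
  shows "(\<Sum>a<n. norm (dirichlet (M * n) t (x - int M * int a))) \<le> 2 * t + n * harm n"
proof -
  let ?N = "M * n" let ?D = "\<lambda>x. norm (dirichlet (M * n) t x)"
  have N: "?N > 0" using n M by simp
  define x0 where "x0 = x mod int M"
  define a0 where "a0 = x div int M"
  have x: "x = x0 + int M * a0" by (simp add: x0_def a0_def)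
  have x0: "0 \<le> x0" "x0 < int M" using M by (simp_all add: x0_def)
  define g where "g a = ?D (x0 + int M * a)" for a
  have g_per: "g a = g b" if "int n dvd a - b" for a b
  proof -
    have "int ?N dvd (x0 + int M * a) - (x0 + int M * b)"
      using mult_dvd_mono[OF dvd_refl that, of "int M"] by (simp add: right_diff_distrib)
    thus ?thesis unfolding g_def using dirichlet_cong[OF N] by metis
  qed
  have "(\<Sum>a<n. ?D (x - int M * int a)) = (\<Sum>a<n. g (a0 - int a))"
    unfolding g_def x by (simp add: algebra_simps)
  also have "\<dots> = (\<Sum>a<n. g (int a))" by (rule sum_periodic_reflect[OF g_per])
  also have "\<dots> \<le> (\<Sum>a<n. (if a = 0 then t else 0) + (if a = n - 1 then t else 0)
      + real n * ((if a = 0 then 0 else 1 / (2 * real a)) + (if a = n - 1 then 0 else 1 / (2 * real (n - 1 - a)))))"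
  proof (rule sum_mono)
    fix a assume a: "a \<in> {..<n}"
    show "g (int a) \<le> real ((if a = 0 then t else 0) + (if a = n - 1 then t else 0))
      + real n * ((if a = 0 then 0 else 1 / (2 * real a)) + (if a = n - 1 then 0 else 1 / (2 * real (n - 1 - a))))"
    proof (cases "a = 0 \<or> a = n - 1")
      case True
      have "g (int a) \<le> t" unfolding g_def by (rule norm_dirichlet_le)
      thus ?thesis using True by (auto intro: add_increasing2)
    next
      case False
      define z where "z = x0 + int M * int a"
      have a1: "a \<ge> 1" "a + 1 < n" using False a by auto
      have z1: "int M * int a \<le> z" using x0 by (simp add: z_def)
      have z2: "z + int M * int (n - 1 - a) < int ?N"
      proof -
        have "int M * int (n - 1 - a) + int M * int a + int M = int M * (int (n - 1 - a) + int a + 1)"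
          by (simp add: algebra_simps)
        also have "int (n - 1 - a) + int a + 1 = int n" using a1 by simp
        finally show ?thesis using x0 by (simp add: z_def)
      qed
      have Ma: "0 < int M * int a" "0 < int M * int (n - 1 - a)" using M a1 by simp_all
      have zpos: "0 < z" "z < int ?N" using z1 z2 Ma by linarith+
      have "g (int a) \<le> real ?N / (2 * real_of_int z) + real ?N / (2 * (real ?N - real_of_int z))"
        unfolding g_def z_def[symmetric] by (rule norm_dirichlet_le2[OF zpos])
      also have "real ?N / (2 * real_of_int z) \<le> real ?N / (2 * (real M * real a))"
      proof (intro divide_left_mono mult_left_mono)
        have "real_of_int (int M * int a) \<le> real_of_int z" using z1 by (simp only: of_int_le_iff)
        thus "real M * real a \<le> real_of_int z" by simp
      qed (use M a1 zpos in auto)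
      also have "real ?N / (2 * (real ?N - real_of_int z)) \<le> real ?N / (2 * (real M * real (n - 1 - a)))"
      proof (intro divide_left_mono mult_left_mono)
        have "real_of_int (int M * int (n - 1 - a)) \<le> real_of_int (int ?N - z)"
          using z2 unfolding of_int_le_iff by linarith
        thus "real M * real (n - 1 - a) \<le> real ?N - real_of_int z" by simp
        have "real_of_int z < real_of_int (int ?N)" using zpos(2) by (simp only: of_int_less_iff)
        thus "0 < 2 * (real ?N - real_of_int z) * (2 * (real M * real (n - 1 - a)))"
          using M a1 by (intro mult_pos_pos) auto
      qed auto
      also have "real ?N / (2 * (real M * real a)) + real ?N / (2 * (real M * real (n - 1 - a))) = real n * (1 / (2 * real a) + 1 / (2 * real (n - 1 - a)))"
        using M by (simp add: field_simps)
      finally show ?thesis using False by simp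
    qed
  qed
  also have "\<dots> = 2 * t + n * ((\<Sum>a<n. if a = 0 then 0 else 1 / (2 * real a)) + (\<Sum>a<n. if a = n - 1 then 0 else 1 / (2 * real (n - 1 - a))))"
    using n by (simp add: sum.distrib sum_distrib_left[symmetric] if_distrib[of real] cong: if_cong)
  also have "(\<Sum>a<n. if a = n - 1 then 0 else 1 / (2 * real (n - 1 - a))) = (\<Sum>a<n. if a = 0 then 0 else 1 / (2 * real a))"
    by (rule sum.reindex_bij_witness[of _ "\<lambda>a. n - 1 - a" "\<lambda>a. n - 1 - a"]) (use n in auto)
  also have "(\<Sum>a<n. if a = 0 then 0 else 1 / (2 * real a)) + (\<Sum>a<n. if a = 0 then 0 else 1 / (2 * real a)) \<le> harm n"
  proof -
    have "(\<Sum>a<n. if a = 0 then 0 else 1 / (2 * real a)) + (\<Sum>a<n. if a = 0 then 0 else 1 / (2 * real a)) =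
        (\<Sum>a<n. if a = 0 then 0 else inverse (real a))"
      unfolding sum.distrib[symmetric] by (intro sum.cong refl) (auto simp: field_simps)
    also have "\<dots> = (\<Sum>a\<in>{1..<n}. inverse (real a))"
      by (rule sum.mono_neutral_cong_right) auto
    also have "\<dots> \<le> harm n" unfolding harm_def by (rule sum_mono2) auto
    finally show ?thesis .
  qed
  finally show ?thesis by (simp add: mult_left_mono)
qed

section \<open>Mean values of products of Dirichlet kernels\<close>

lemma int_dvd_small_iff: "\<bar>x\<bar> < int N \<Longrightarrow> int N dvd x \<longleftrightarrow> x = 0"
  by (metis abs_of_nat dvd_0_right dvd_imp_le_int not_less)

text \<open>For \<open>\<bar>\<delta>\<bar> < t\<close> this is the number of pairs of indices below
  \<open>t\<close> with difference \<open>\<delta>\<close>, the Fejer weight. All sums are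
  restricted to that range, beyond which the formula would be negative.\<close>

definition lag_weight :: "nat \<Rightarrow> int \<Rightarrow> real" where
  "lag_weight t \<delta> = real_of_int (int t - \<bar>\<delta>\<bar>)"

lemma card_lag:
  assumes "\<delta> \<in> {- int t<..<int t}"
  shows "card {p \<in> {..<t} \<times> {..<t}. int (fst p) - int (snd p) = \<delta>} = nat (int t - \<bar>\<delta>\<bar>)"
proof (cases "\<delta> \<ge> 0")
  case True
  have "{p \<in> {..<t} \<times> {..<t}. int (fst p) - int (snd p) = \<delta>} = (\<lambda>j. (j + nat \<delta>, j)) ` {..<t - nat \<delta>}"
    using True by (auto simp: image_iff)
  thus ?thesis using True by (simp add: card_image inj_on_def nat_diff_distrib)
next
  case False
  have "{p \<in> {..<t} \<times> {..<t}. int (fst p) - int (snd p) = \<delta>} = (\<lambda>j. (j, j + nat (- \<delta>))) ` {..<t - nat (- \<delta>)}"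
    using False by (auto simp: image_iff)
  thus ?thesis using False by (simp add: card_image inj_on_def nat_diff_distrib)
qed

lemma norm_dirichlet_sq:
  "dirichlet N t x * cnj (dirichlet N t x) =
    (\<Sum>\<delta>\<in>{- int t<..<int t}. of_real (lag_weight t \<delta>) * root_unity N (\<delta> * x))"
proof -
  let ?T = "{..<t} \<times> {..<t}" and ?\<Delta> = "{- int t<..<int t}"
  have "dirichlet N t x * cnj (dirichlet N t x) = (\<Sum>p\<in>?T. root_unity N ((int (fst p) - int (snd p)) * x))"
    unfolding dirichlet_def cnj_sum sum_product sum.cartesian_product
  proof (intro sum.cong refl)
    fix p :: "nat \<times> nat"
    have "(int (fst p) - int (snd p)) * x = int (fst p) * x + - (int (snd p) * x)" by (simp add: algebra_simps)
    thus "(case p of (i, j) \<Rightarrow> root_unity N (int i * x) * cnj (root_unity N (int j * x))) =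
        root_unity N ((int (fst p) - int (snd p)) * x)"
      by (simp only: root_unity_add root_unity_uminus case_prod_unfold)
  qed
  also have "\<dots> = (\<Sum>\<delta>\<in>?\<Delta>. \<Sum>p\<in>{p \<in> ?T. int (fst p) - int (snd p) = \<delta>}. root_unity N ((int (fst p) - int (snd p)) * x))"
    by (rule sum.group[symmetric]) auto
  also have "\<dots> = (\<Sum>\<delta>\<in>?\<Delta>. of_real (lag_weight t \<delta>) * root_unity N (\<delta> * x))"
  proof (intro sum.cong refl)
    fix \<delta> assume \<delta>: "\<delta> \<in> ?\<Delta>"
    have "(\<Sum>p\<in>{p \<in> ?T. int (fst p) - int (snd p) = \<delta>}. root_unity N ((int (fst p) - int (snd p)) * x)) =
        of_nat (nat (int t - \<bar>\<delta>\<bar>)) * root_unity N (\<delta> * x)"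
      by (simp add: card_lag[OF \<delta>])
    also have "of_nat (nat (int t - \<bar>\<delta>\<bar>)) = (of_real (lag_weight t \<delta>) :: complex)"
    proof -
      have "0 \<le> int t - \<bar>\<delta>\<bar>" using \<delta> by auto
      thus ?thesis by (simp only: lag_weight_def of_nat_nat of_real_of_int_eq)
    qed
    finally show "(\<Sum>p\<in>{p \<in> ?T. int (fst p) - int (snd p) = \<delta>}. root_unity N ((int (fst p) - int (snd p)) * x)) =
        of_real (lag_weight t \<delta>) * root_unity N (\<delta> * x)" .
  qed
  finally show ?thesis .
qed

text \<open>Two lags below \<open>t\<close> in absolute value add up to less than
  \<open>2 * t \<le> N\<close>, so their sum is divisible by \<open>N\<close> only if it is
  zero.\<close>

lemma sum_lag_orthogonal:
  assumes N: "N > 0" "2 * t \<le> N" and S: "S \<subseteq> {- int t<..<int t}"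
    and sym: "\<And>\<delta>. \<delta> \<in> S \<Longrightarrow> - \<delta> \<in> S"
  shows "(\<Sum>l<N. (\<Sum>\<delta>\<in>S. of_real (lag_weight t \<delta>) * root_unity N (\<delta> * int l)) *
      (\<Sum>\<delta>\<in>{- int t<..<int t}. of_real (lag_weight t \<delta>) * root_unity N (\<delta> * int l))) =
    of_real (N * (\<Sum>\<delta>\<in>S. (lag_weight t \<delta>)\<^sup>2))"
proof -
  let ?\<Delta> = "{- int t<..<int t}" let ?w = "\<lambda>\<delta>. complex_of_real (lag_weight t \<delta>)"
  have "(\<Sum>l<N. (\<Sum>\<delta>\<in>S. ?w \<delta> * root_unity N (\<delta> * int l)) * (\<Sum>\<delta>\<in>?\<Delta>. ?w \<delta> * root_unity N (\<delta> * int l))) =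
      (\<Sum>l<N. \<Sum>\<delta>\<in>S. \<Sum>\<delta>'\<in>?\<Delta>. ?w \<delta> * ?w \<delta>' * root_unity N ((\<delta> + \<delta>') * int l))"
    unfolding sum_product by (intro sum.cong refl) (simp add: distrib_right root_unity_add)
  also have "\<dots> = (\<Sum>\<delta>\<in>S. \<Sum>\<delta>'\<in>?\<Delta>. ?w \<delta> * ?w \<delta>' * (\<Sum>l<N. root_unity N ((\<delta> + \<delta>') * int l)))"
    unfolding sum_distrib_left by (subst sum.swap, rule sum.cong[OF refl], rule sum.swap)
  also have "\<dots> = (\<Sum>\<delta>\<in>S. \<Sum>\<delta>'\<in>?\<Delta>. if \<delta>' = - \<delta> then of_nat N * (?w \<delta>)\<^sup>2 else 0)"
  proof (intro sum.cong refl)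
    fix \<delta> \<delta>' assume d: "\<delta> \<in> S" "\<delta>' \<in> ?\<Delta>"
    hence "\<delta> \<in> ?\<Delta>" using S by blast
    hence "\<bar>\<delta> + \<delta>'\<bar> < int N" using N(2) d(2) by auto
    hence "int N dvd \<delta> + \<delta>' \<longleftrightarrow> \<delta>' = - \<delta>" by (auto simp: int_dvd_small_iff)
    thus "?w \<delta> * ?w \<delta>' * (\<Sum>l<N. root_unity N ((\<delta> + \<delta>') * int l)) = (if \<delta>' = - \<delta> then of_nat N * (?w \<delta>)\<^sup>2 else 0)"
      unfolding sum_root_unity[OF N(1)] by (auto simp: lag_weight_def power2_eq_square)
  qed
  also have "\<dots> = (\<Sum>\<delta>\<in>S. of_nat N * (?w \<delta>)\<^sup>2)"
    using sym S by (intro sum.cong refl) (auto simp: sum.delta)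
  finally show ?thesis by (simp add: sum_distrib_left)
qed

lemma sum_norm_dirichlet4:
  assumes "N > 0" and "2 * t \<le> N"
  shows "(\<Sum>l<N. norm (dirichlet N t (int l)) ^ 4) = N * (\<Sum>\<delta>\<in>{- int t<..<int t}. (lag_weight t \<delta>)\<^sup>2)"
proof -
  have "complex_of_real (\<Sum>l<N. norm (dirichlet N t (int l)) ^ 4) =
      (\<Sum>l<N. (dirichlet N t (int l) * cnj (dirichlet N t (int l))) * (dirichlet N t (int l) * cnj (dirichlet N t (int l))))"
    unfolding of_real_sum
  proof (intro sum.cong refl)
    fix l
    have "norm (dirichlet N t (int l)) ^ 4 = norm (dirichlet N t (int l)) ^ 2 * norm (dirichlet N t (int l)) ^ 2"
      by (simp flip: power_add)
    thus "complex_of_real (norm (dirichlet N t (int l)) ^ 4) = (dirichlet N t (int l) * cnj (dirichlet N t (int l))) * (dirichlet N t (int l) * cnj (dirichlet N t (int l)))"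
      by (simp only: of_real_mult complex_norm_square)
  qed
  also have "\<dots> = of_real (N * (\<Sum>\<delta>\<in>{- int t<..<int t}. (lag_weight t \<delta>)\<^sup>2))"
    unfolding norm_dirichlet_sq by (rule sum_lag_orthogonal[OF assms]) auto
  finally show ?thesis by (simp only: of_real_eq_iff)
qed

text \<open>A shift by \<open>M * a\<close> multiplies the lag term for \<open>\<delta>\<close> by
  an \<open>n\<close>-th root of unity, so the sum over \<open>a\<close> retains just the lags
  divisible by \<open>n\<close>.\<close>

lemma sum_norm_dirichlet_shifted:
  assumes n: "n > 0" and M: "M > 0" and "2 * t \<le> M * n"
  shows "(\<Sum>l<M * n. \<Sum>a<n. norm (dirichlet (M * n) t (int l - int M * int a)) ^ 2 * norm (dirichlet (M * n) t (int l)) ^ 2) =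
    real n * (M * n) * (\<Sum>\<delta>\<in>{\<delta> \<in> {- int t<..<int t}. int n dvd \<delta>}. (lag_weight t \<delta>)\<^sup>2)"
proof -
  let ?N = "M * n" let ?\<Delta> = "{- int t<..<int t}" let ?S = "{\<delta> \<in> ?\<Delta>. int n dvd \<delta>}"
  let ?w = "\<lambda>\<delta>. complex_of_real (lag_weight t \<delta>)"
  have N: "?N > 0" using n M by simp
  have inner: "(\<Sum>a<n. complex_of_real (norm (dirichlet ?N t (x - int M * int a)) ^ 2)) =
      of_nat n * (\<Sum>\<delta>\<in>?S. ?w \<delta> * root_unity ?N (\<delta> * x))" for x
  proof -
    have "(\<Sum>a<n. complex_of_real (norm (dirichlet ?N t (x - int M * int a)) ^ 2)) =
        (\<Sum>a<n. \<Sum>\<delta>\<in>?\<Delta>. ?w \<delta> * root_unity ?N (\<delta> * x) * root_unity n (- \<delta> * int a))"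
      unfolding complex_norm_square norm_dirichlet_sq
    proof (intro sum.cong refl)
      fix a \<delta>
      have "\<delta> * (x - int M * int a) = \<delta> * x + int M * (- \<delta> * int a)" by (simp add: algebra_simps)
      thus "?w \<delta> * root_unity ?N (\<delta> * (x - int M * int a)) = ?w \<delta> * root_unity ?N (\<delta> * x) * root_unity n (- \<delta> * int a)"
        by (simp only: root_unity_add root_unity_mult[OF M] mult.assoc)
    qed
    also have "\<dots> = (\<Sum>\<delta>\<in>?\<Delta>. ?w \<delta> * root_unity ?N (\<delta> * x) * (\<Sum>a<n. root_unity n (- \<delta> * int a)))"
      unfolding sum_distrib_left by (rule sum.swap)
    also have "\<dots> = (\<Sum>\<delta>\<in>?\<Delta>. if int n dvd \<delta> then of_nat n * (?w \<delta> * root_unity ?N (\<delta> * x)) else 0)"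
      unfolding sum_root_unity[OF n] by (intro sum.cong refl) simp
    also have "\<dots> = (\<Sum>\<delta>\<in>?S. of_nat n * (?w \<delta> * root_unity ?N (\<delta> * x)))"
      by (rule sum.mono_neutral_cong_right) auto
    finally show ?thesis by (simp add: sum_distrib_left)
  qed
  have "complex_of_real (\<Sum>l<?N. \<Sum>a<n. norm (dirichlet ?N t (int l - int M * int a)) ^ 2 * norm (dirichlet ?N t (int l)) ^ 2) =
      (\<Sum>l<?N. (\<Sum>a<n. complex_of_real (norm (dirichlet ?N t (int l - int M * int a)) ^ 2)) * complex_of_real (norm (dirichlet ?N t (int l)) ^ 2))"
    by (simp add: sum_distrib_right)
  also have "\<dots> = (\<Sum>l<?N. of_nat n * (\<Sum>\<delta>\<in>?S. ?w \<delta> * root_unity ?N (\<delta> * int l)) * complex_of_real (norm (dirichlet ?N t (int l)) ^ 2))"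
    by (simp only: inner)
  also have "\<dots> = of_nat n * (\<Sum>l<?N. (\<Sum>\<delta>\<in>?S. ?w \<delta> * root_unity ?N (\<delta> * int l)) * (\<Sum>\<delta>\<in>?\<Delta>. ?w \<delta> * root_unity ?N (\<delta> * int l)))"
    by (subst sum_distrib_left) (simp only: complex_norm_square norm_dirichlet_sq mult.assoc)
  also have "\<dots> = of_nat n * of_real (?N * (\<Sum>\<delta>\<in>?S. (lag_weight t \<delta>)\<^sup>2))"
    by (subst sum_lag_orthogonal[OF N assms(3)]) auto
  also have "\<dots> = complex_of_real (real n * (M * n) * (\<Sum>\<delta>\<in>?S. (lag_weight t \<delta>)\<^sup>2))" by simp
  finally show ?thesis by (simp only: of_real_eq_iff)
qed

lemma sum_window_le:
  fixes n M t :: nat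
  assumes n: "n > 0" and M: "M > 0"
  defines "D \<equiv> dirichlet (M * n) t"
  shows "(\<Sum>l<M * n. \<Sum>a<n. \<Sum>b<n. \<Sum>c<n. norm (D (int l - int M * int a)) * norm (D (int l - int M * int b)) *
      norm (D (int l - int M * int c)) * norm (D (int l))) \<le> M * (2 * real t + real n * harm n) ^ 4"
proof -
  let ?N = "M * n" define \<beta> :: real where "\<beta> = 2 * real t + real n * harm n"
  have N: "?N > 0" using n M by simp
  have \<beta>0: "\<beta> \<ge> 0" by (simp add: \<beta>_def harm_nonneg)
  have \<beta>: "(\<Sum>a<n. norm (D (x - int M * int a))) \<le> \<beta>" for x
    unfolding D_def \<beta>_def by (rule sum_norm_dirichlet_le[OF n M])
  \<comment> \<open>The unshifted sum over all \<open>M * n\<close> points equals each of its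
    translates by multiples of \<open>M\<close>. Averaging over \<open>n\<close> of them brings it
    under the bound \<open>\<beta>\<close> for shifted sums.\<close>
  have l1: "(\<Sum>l<?N. norm (D (int l))) \<le> M * \<beta>"
  proof -
    have "(\<Sum>l<?N. norm (D (int l))) = (\<Sum>l<?N. norm (D (int l - int M * int a)))" for a
      using sum_periodic_shift[of ?N "\<lambda>x. norm (D x)" "- (int M * int a)"] dirichlet_cong[OF N]
      unfolding D_def by (metis (no_types, lifting) uminus_add_conv_diff add.commute sum.cong)
    hence "real n * (\<Sum>l<?N. norm (D (int l))) = (\<Sum>a<n. \<Sum>l<?N. norm (D (int l - int M * int a)))" by simp
    also have "\<dots> = (\<Sum>l<?N. \<Sum>a<n. norm (D (int l - int M * int a)))" by (rule sum.swap)
    also have "\<dots> \<le> (\<Sum>l<?N. \<beta>)" by (rule sum_mono) (rule \<beta>)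
    also have "\<dots> = real n * (M * \<beta>)" by simp
    finally show ?thesis using n by simp
  qed
  have "(\<Sum>l<?N. \<Sum>a<n. \<Sum>b<n. \<Sum>c<n. norm (D (int l - int M * int a)) * norm (D (int l - int M * int b)) *
      norm (D (int l - int M * int c)) * norm (D (int l))) = (\<Sum>l<?N. (\<Sum>a<n. norm (D (int l - int M * int a))) ^ 3 * norm (D (int l)))"
    by (intro sum.cong refl) (simp only: power3_eq_cube sum_distrib_left[symmetric] sum_distrib_right[symmetric])
  also have "\<dots> \<le> (\<Sum>l<?N. \<beta> ^ 3 * norm (D (int l)))"
    by (intro sum_mono mult_right_mono power_mono \<beta> sum_nonneg) auto
  also have "\<dots> = \<beta> ^ 3 * (\<Sum>l<?N. norm (D (int l)))" by (simp add: sum_distrib_left)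
  also have "\<dots> \<le> \<beta> ^ 3 * (M * \<beta>)" using l1 \<beta>0 by (intro mult_left_mono) auto
  also have "\<dots> = M * \<beta> ^ 4" by (simp add: power3_eq_cube power4_eq_xxxx)
  finally show ?thesis by (simp add: \<beta>_def)
qed

text \<open>The window enters only through Dirichlet kernels and the sequence only through moments.
  Replacing every moment by its model value costs \<open>\<eta>\<close> times the absolute sum of
  the weights, and the model value leaves lag sums. The length \<open>t\<close> may exceed the
  period \<open>n\<close>; sampling at order \<open>M * n\<close> keeps the sequence periodic,
  because shifts of its transform become shifts of the kernel by multiples of
  \<open>M\<close>.\<close>

theorem fourth_mean_estimate:
  fixes d F :: "int \<Rightarrow> complex" and r :: int
  assumes n: "n > 0" and M: "M > 0" and tN: "2 * t \<le> M * n"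
    and per: "\<And>x y. int n dvd x - y \<Longrightarrow> d x = d y"
    and F: "\<And>k. F k = (\<Sum>j<n. d (int j) * root_unity n (k * int j))"
    and mom: "\<And>a b c. norm ((\<Sum>k<n. F (int k + a) * F (int k + b) * cnj (F (int k + c)) * cnj (F (int k))) -
        (if int n dvd a - c \<and> int n dvd b \<or> int n dvd a \<and> int n dvd b - c then of_nat n ^ 3 else 0)) \<le> \<eta>"
  shows "\<bar>(\<Sum>l<M * n. norm (\<Sum>j<t. d (int j + r) * root_unity (M * n) (int j * int l)) ^ 4) / (M * n) -
      (2 * (\<Sum>\<delta>\<in>{\<delta> \<in> {- int t<..<int t}. int n dvd \<delta>}. (lag_weight t \<delta>)\<^sup>2)
        - (\<Sum>\<delta>\<in>{- int t<..<int t}. (lag_weight t \<delta>)\<^sup>2) / n)\<bar>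
    \<le> \<eta> * (2 * real t + real n * harm n) ^ 4 / n ^ 5"
proof -
  let ?N = "M * n"
  define D where "D = dirichlet ?N t"
  \<comment> \<open>The shift by \<open>r\<close> only twists the transform by roots of unity, so
    the estimate does not depend on \<open>r\<close>.\<close>
  define Fr where "Fr k = F k * root_unity n (- k * r)" for k
  define p where "p l = (\<Sum>j<t. d (int j + r) * root_unity ?N (int j * l))" for l
  define W where "W x a b c = D (x - int M * a) * D (x - int M * b) * cnj (D (x - int M * c)) * cnj (D x)" for x a b c
  define Wd where "Wd a b c = (\<Sum>l<?N. W (int l) a b c)" for a b c
  define G where "G a b c = (\<Sum>k<n. Fr (int k + a) * Fr (int k + b) * cnj (Fr (int k + c)) * cnj (Fr (int k)))" for a b c
  have N: "?N > 0" using n M by simp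
  have D_per: "D x = D y" if "int ?N dvd x - y" for x y
    unfolding D_def using dirichlet_cong[OF N that] .
  have F_per: "F x = F y" if "int n dvd x - y" for x y
    unfolding F using that by (intro sum.cong refl arg_cong2[of _ _ _ _ "(*)"] root_unity_cong[OF n]) (auto simp flip: left_diff_distrib)
  have Fr_per: "Fr x = Fr y" if "int n dvd x - y" for x y
  proof -
    have "- x * r - - y * r = (x - y) * - r" by (simp add: algebra_simps)
    hence "int n dvd - x * r - - y * r" using dvd_mult2[OF that] by simp
    thus ?thesis unfolding Fr_def using F_per[OF that] root_unity_cong[OF n] by metis
  qed
  have np: "of_nat n * p l = (\<Sum>k<n. Fr (int k) * D (l - int M * int k))" for l
  proof -
    have "of_nat n * p l = (\<Sum>j<t. (\<Sum>k<n. F (int k) * root_unity n (- int k * (int j + r))) * root_unity ?N (int j * l))"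
      unfolding p_def using n dft_inversion[OF n per F] by (simp add: sum_distrib_left)
    also have "\<dots> = (\<Sum>j<t. \<Sum>k<n. Fr (int k) * root_unity ?N (int j * (l - int M * int k)))"
      unfolding sum_distrib_right
    proof (intro sum.cong refl)
      fix j k
      have "- int k * (int j + r) = - int k * r + - int k * int j" by (simp add: algebra_simps)
      moreover have "int j * (l - int M * int k) = int j * l + int M * (- int k * int j)" by (simp add: algebra_simps)
      ultimately show "F (int k) * root_unity n (- int k * (int j + r)) * root_unity ?N (int j * l) =
          Fr (int k) * root_unity ?N (int j * (l - int M * int k))"
        unfolding Fr_def by (simp only: root_unity_add root_unity_mult[OF M] mult_ac)
    qed
    also have "\<dots> = (\<Sum>k<n. Fr (int k) * D (l - int M * int k))"
      unfolding D_def dirichlet_def sum_distrib_left by (rule sum.swap)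
    finally show ?thesis .
  qed
  \<comment> \<open>Three of the four sums are started at \<open>k\<close>. Then \<open>k\<close>
    enters the product of transforms as the summation index of a moment, and enters the kernels as a
    translation by \<open>M * k\<close>, which the full sum over \<open>l\<close> absorbs.\<close>
  have np_shift: "of_nat n * p l = (\<Sum>a<n. Fr (int k + int a) * D (l - int M * (int k + int a)))" for l k
  proof -
    define g where "g x = Fr x * D (l - int M * x)" for x
    have "g x = g y" if "int n dvd x - y" for x y
    proof -
      have "int ?N dvd (l - int M * x) - (l - int M * y)"
      proof -
        have "(l - int M * x) - (l - int M * y) = int M * (x - y) * - 1" by (simp add: algebra_simps)
        moreover have "int ?N dvd int M * (x - y)" using mult_dvd_mono[OF dvd_refl that, of "int M"] by simp
        ultimately show ?thesis by (simp only: dvd_mult2)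
      qed
      thus ?thesis unfolding g_def using Fr_per[OF that] D_per by metis
    qed
    hence "(\<Sum>a<n. g (int a + int k)) = (\<Sum>a<n. g (int a))" by (rule sum_periodic_shift)
    thus ?thesis unfolding np g_def by (simp add: add.commute)
  qed
  have W_shift: "(\<Sum>l<?N. W (int l - int M * int k) a b c) = Wd a b c" for k a b c
  proof -
    have "W x a b c = W y a b c" if "int ?N dvd x - y" for x y
      unfolding W_def using that D_per[of x y] D_per[of "x - int M * a" "y - int M * a"]
        D_per[of "x - int M * b" "y - int M * b"] D_per[of "x - int M * c" "y - int M * c"] by simp
    from sum_periodic_shift[of ?N "\<lambda>x. W x a b c", OF this, of "- (int M * int k)"]
    show ?thesis by (simp add: Wd_def)
  qed
  have total: "of_nat n ^ 4 * complex_of_real (\<Sum>l<?N. norm (p (int l)) ^ 4) =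
      (\<Sum>a<n. \<Sum>b<n. \<Sum>c<n. G (int a) (int b) (int c) * Wd (int a) (int b) (int c))"
  proof -
    have "of_nat n ^ 4 * complex_of_real (norm (p l) ^ 4) = (\<Sum>k<n. \<Sum>a<n. \<Sum>b<n. \<Sum>c<n.
        (Fr (int k + int a) * Fr (int k + int b) * cnj (Fr (int k + int c)) * cnj (Fr (int k))) * W (l - int M * int k) (int a) (int b) (int c))" for l
    proof -
      have "norm (p l) ^ 4 = norm (p l) ^ 2 * norm (p l) ^ 2" by (simp flip: power_add)
      hence "complex_of_real (norm (p l) ^ 4) = (p l * cnj (p l)) * (p l * cnj (p l))"
        by (simp only: of_real_mult complex_norm_square)
      hence "of_nat n ^ 4 * complex_of_real (norm (p l) ^ 4) =
          cnj (of_nat n * p l) * ((of_nat n * p l) * (of_nat n * p l) * cnj (of_nat n * p l))"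
        by (simp add: power4_eq_xxxx mult_ac)
      also have "\<dots> = (\<Sum>k<n. cnj (Fr (int k) * D (l - int M * int k)) * ((of_nat n * p l) * (of_nat n * p l) * cnj (of_nat n * p l)))"
        by (subst (1) np) (simp only: cnj_sum sum_distrib_right)
      also have "\<dots> = (\<Sum>k<n. \<Sum>a<n. \<Sum>b<n. \<Sum>c<n.
        (Fr (int k + int a) * Fr (int k + int b) * cnj (Fr (int k + int c)) * cnj (Fr (int k))) * W (l - int M * int k) (int a) (int b) (int c))"
      proof (rule sum.cong[OF refl])
        fix k assume "k \<in> {..<n}"
        let ?f = "\<lambda>a. Fr (int k + int a) * D (l - int M * (int k + int a))"
        have "cnj (Fr (int k) * D (l - int M * int k)) * ((of_nat n * p l) * (of_nat n * p l) * cnj (of_nat n * p l)) =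
            cnj (Fr (int k) * D (l - int M * int k)) * ((\<Sum>a<n. ?f a) * (\<Sum>b<n. ?f b) * (\<Sum>c<n. cnj (?f c)))"
          unfolding np_shift[of l k] cnj_sum ..
        also have "\<dots> = (\<Sum>a<n. \<Sum>b<n. \<Sum>c<n. cnj (Fr (int k) * D (l - int M * int k)) * (?f a * ?f b * cnj (?f c)))"
          by (simp only: sum_distrib_left[symmetric] sum_distrib_right[symmetric])
        also have "\<dots> = (\<Sum>a<n. \<Sum>b<n. \<Sum>c<n.
          (Fr (int k + int a) * Fr (int k + int b) * cnj (Fr (int k + int c)) * cnj (Fr (int k))) * W (l - int M * int k) (int a) (int b) (int c))"
          by (intro sum.cong refl) (simp add: W_def algebra_simps)
        finally show "cnj (Fr (int k) * D (l - int M * int k)) * ((of_nat n * p l) * (of_nat n * p l) * cnj (of_nat n * p l)) =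
          (\<Sum>a<n. \<Sum>b<n. \<Sum>c<n.
          (Fr (int k + int a) * Fr (int k + int b) * cnj (Fr (int k + int c)) * cnj (Fr (int k))) * W (l - int M * int k) (int a) (int b) (int c))" .
      qed
      finally show ?thesis .
    qed
    hence "of_nat n ^ 4 * complex_of_real (\<Sum>l<?N. norm (p (int l)) ^ 4) = (\<Sum>l<?N. \<Sum>k<n. \<Sum>a<n. \<Sum>b<n. \<Sum>c<n.
        (Fr (int k + int a) * Fr (int k + int b) * cnj (Fr (int k + int c)) * cnj (Fr (int k))) * W (int l - int M * int k) (int a) (int b) (int c))"
      unfolding of_real_sum sum_distrib_left by (intro sum.cong refl) blast
    also have "\<dots> = (\<Sum>k<n. \<Sum>a<n. \<Sum>b<n. \<Sum>c<n. \<Sum>l<?N.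
        (Fr (int k + int a) * Fr (int k + int b) * cnj (Fr (int k + int c)) * cnj (Fr (int k))) * W (int l - int M * int k) (int a) (int b) (int c))"
      by (subst sum.swap, rule sum.cong[OF refl], subst sum.swap, rule sum.cong[OF refl],
          subst sum.swap, rule sum.cong[OF refl], rule sum.swap)
    also have "\<dots> = (\<Sum>k<n. \<Sum>a<n. \<Sum>b<n. \<Sum>c<n.
        (Fr (int k + int a) * Fr (int k + int b) * cnj (Fr (int k + int c)) * cnj (Fr (int k))) * Wd (int a) (int b) (int c))"
      by (simp only: sum_distrib_left[symmetric] W_shift)
    also have "\<dots> = (\<Sum>a<n. \<Sum>b<n. \<Sum>c<n. \<Sum>k<n.
        (Fr (int k + int a) * Fr (int k + int b) * cnj (Fr (int k + int c)) * cnj (Fr (int k))) * Wd (int a) (int b) (int c))"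
      by (subst sum.swap, rule sum.cong[OF refl], subst sum.swap, rule sum.cong[OF refl], rule sum.swap)
    also have "\<dots> = (\<Sum>a<n. \<Sum>b<n. \<Sum>c<n. G (int a) (int b) (int c) * Wd (int a) (int b) (int c))"
      by (simp only: sum_distrib_right[symmetric] G_def)
    finally show ?thesis .
  qed
  define I where "I a b c = (if a = c \<and> b = 0 \<or> a = 0 \<and> b = c then of_nat n ^ 3 else 0 :: complex)" for a b c :: nat
  have G_I: "norm (G (int a) (int b) (int c) - I a b c) \<le> \<eta>" if abc: "a < n" "b < n" "c < n" for a b c
  proof -
    let ?z = "root_unity n (- r * (int a + int b - int c))"
    let ?S = "\<Sum>k<n. F (int k + int a) * F (int k + int b) * cnj (F (int k + int c)) * cnj (F (int k))"
    have "G (int a) (int b) (int c) = ?z * ?S"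
      unfolding G_def sum_distrib_left
    proof (intro sum.cong refl)
      fix k
      have "root_unity n (- (int k + int a) * r) * root_unity n (- (int k + int b) * r) * cnj (root_unity n (- (int k + int c) * r)) * cnj (root_unity n (- int k * r)) =
          root_unity n (- (int k + int a) * r + - (int k + int b) * r + - (- (int k + int c) * r) + - (- int k * r))"
        by (simp only: root_unity_add root_unity_uminus)
      also have "- (int k + int a) * r + - (int k + int b) * r + - (- (int k + int c) * r) + - (- int k * r) = - r * (int a + int b - int c)"
        by (simp add: algebra_simps)
      finally have *: "root_unity n (- (int k + int a) * r) * root_unity n (- (int k + int b) * r) * cnj (root_unity n (- (int k + int c) * r)) * cnj (root_unity n (- int k * r)) = ?z" .
      show "Fr (int k + int a) * Fr (int k + int b) * cnj (Fr (int k + int c)) * cnj (Fr (int k)) =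
          ?z * (F (int k + int a) * F (int k + int b) * cnj (F (int k + int c)) * cnj (F (int k)))"
        unfolding *[symmetric] Fr_def complex_cnj_mult by (simp only: mult_ac)
    qed
    \<comment> \<open>In both pairings \<open>a + b = c\<close>, so the twist \<open>?z\<close> is
      \<open>1\<close> wherever \<open>I\<close> is nonzero.\<close>
    moreover have "I a b c = ?z * I a b c"
      by (auto simp: I_def)
    ultimately have "G (int a) (int b) (int c) - I a b c = ?z * ?S - ?z * I a b c" by (rule arg_cong2)
    hence "G (int a) (int b) (int c) - I a b c = ?z * (?S - I a b c)" by (simp only: right_diff_distrib)
    moreover have "I a b c = (if int n dvd int a - int c \<and> int n dvd int b \<or> int n dvd int a \<and> int n dvd int b - int c then of_nat n ^ 3 else 0)"
    proof -
      have "int n dvd int x - int y \<longleftrightarrow> x = y" if "x < n" "y < n" for x y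
      proof -
        have "\<bar>int x - int y\<bar> < int n" using that by linarith
        thus ?thesis by (simp add: int_dvd_small_iff)
      qed
      moreover have "int n dvd int x \<longleftrightarrow> x = 0" if "x < n" for x using that by (auto dest: dvd_imp_le)
      ultimately show ?thesis unfolding I_def using abc by simp
    qed
    ultimately show ?thesis
      using mom[of "int a" "int b" "int c"] by (simp only: norm_mult norm_root_unity mult_1)
  qed
  let ?\<Delta> = "{- int t<..<int t}" let ?S = "{\<delta> \<in> ?\<Delta>. int n dvd \<delta>}"
  define A1 where "A1 = (\<Sum>\<delta>\<in>?S. (lag_weight t \<delta>)\<^sup>2)"
  define A2 where "A2 = (\<Sum>\<delta>\<in>?\<Delta>. (lag_weight t \<delta>)\<^sup>2)"
  have Wd1: "(\<Sum>c<n. Wd (int c) 0 (int c)) = of_real (real n * ?N * A1)"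
    and Wd2: "(\<Sum>c<n. Wd 0 (int c) (int c)) = of_real (real n * ?N * A1)"
  proof -
    have "(\<Sum>c<n. Wd (int c) 0 (int c)) = complex_of_real (\<Sum>l<?N. \<Sum>a<n. norm (D (int l - int M * int a)) ^ 2 * norm (D (int l)) ^ 2)"
      unfolding Wd_def W_def of_real_sum of_real_mult complex_norm_square
      by (subst sum.swap) (simp add: mult_ac)
    thus 1: "(\<Sum>c<n. Wd (int c) 0 (int c)) = of_real (real n * ?N * A1)"
      unfolding D_def A1_def sum_norm_dirichlet_shifted[OF n M tN] .
    have "Wd 0 x x = Wd x 0 x" for x by (simp add: Wd_def W_def mult_ac)
    thus "(\<Sum>c<n. Wd 0 (int c) (int c)) = of_real (real n * ?N * A1)" using 1 by simp
  qed
  have Wd0: "Wd 0 0 0 = of_real (?N * A2)"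
  proof -
    have "Wd 0 0 0 = (\<Sum>l<?N. complex_of_real (norm (D (int l)) ^ 4))"
      unfolding Wd_def
    proof (intro sum.cong refl)
      fix l
      have "norm (D (int l)) ^ 4 = norm (D (int l)) ^ 2 * norm (D (int l)) ^ 2" by (simp flip: power_add)
      hence "complex_of_real (norm (D (int l)) ^ 4) = (D (int l) * cnj (D (int l))) * (D (int l) * cnj (D (int l)))"
        by (simp only: of_real_mult complex_norm_square)
      thus "W (int l) 0 0 0 = complex_of_real (norm (D (int l)) ^ 4)" by (simp add: W_def mult_ac)
    qed
    also have "\<dots> = complex_of_real (\<Sum>l<?N. norm (D (int l)) ^ 4)" by simp
    finally show ?thesis unfolding D_def A2_def sum_norm_dirichlet4[OF N tN] .
  qed
  \<comment> \<open>The two pairings contribute the same amount \<open>A1\<close>. They overlap in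
    \<open>a = b = c = 0\<close>, which is counted twice and therefore subtracted once, as
    \<open>A2\<close>.\<close>
  have main: "(\<Sum>a<n. \<Sum>b<n. \<Sum>c<n. I a b c * Wd (int a) (int b) (int c)) = of_real (real n ^ 3 * ?N * (2 * n * A1 - A2))"
  proof -
    have "(\<Sum>a<n. \<Sum>b<n. \<Sum>c<n. I a b c * Wd (int a) (int b) (int c)) =
        (\<Sum>c<n. \<Sum>a<n. \<Sum>b<n. of_nat n ^ 3 * ((if a = c then (if b = 0 then Wd (int c) 0 (int c) else 0) else 0)
          + (if a = 0 then (if b = c then Wd 0 (int c) (int c) else 0) else 0)
          - (if a = 0 then (if b = 0 then (if c = 0 then Wd 0 0 0 else 0) else 0) else 0)))"
      by (subst sum_rotate3, intro sum.cong refl) (auto simp: I_def)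
    also have "\<dots> = (\<Sum>c<n. of_nat n ^ 3 * (Wd (int c) 0 (int c) + Wd 0 (int c) (int c) - (if c = 0 then Wd 0 0 0 else 0)))"
    proof (rule sum.cong[OF refl])
      fix c assume c: "c \<in> {..<n}"
      have delta2: "(\<Sum>a<n. \<Sum>b<n. if a = i then (if b = j then w else 0) else 0) = w"
        if "i < n" "j < n" for i j and w :: complex
      proof -
        have "(\<Sum>a<n. \<Sum>b<n. if a = i then (if b = j then w else 0) else 0) = (\<Sum>a<n. if a = i then w else 0)"
          using that by (intro sum.cong refl) simp
        thus ?thesis using that by simp
      qed
      show "(\<Sum>a<n. \<Sum>b<n. of_nat n ^ 3 * ((if a = c then (if b = 0 then Wd (int c) 0 (int c) else 0) else 0)
          + (if a = 0 then (if b = c then Wd 0 (int c) (int c) else 0) else 0)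
          - (if a = 0 then (if b = 0 then (if c = 0 then Wd 0 0 0 else 0) else 0) else 0))) =
        of_nat n ^ 3 * (Wd (int c) 0 (int c) + Wd 0 (int c) (int c) - (if c = 0 then Wd 0 0 0 else 0))"
        using c n by (simp only: sum_distrib_left[symmetric] sum_subtractf sum.distrib delta2 lessThan_iff)
    qed
    also have "\<dots> = of_nat n ^ 3 * ((\<Sum>c<n. Wd (int c) 0 (int c)) + (\<Sum>c<n. Wd 0 (int c) (int c)) - Wd 0 0 0)"
      unfolding sum_distrib_left[symmetric] sum_subtractf sum.distrib using n by simp
    finally show ?thesis unfolding Wd1 Wd2 Wd0 by (simp add: algebra_simps)
  qed
  have \<eta>0: "\<eta> \<ge> 0" using order.trans[OF norm_ge_zero mom] by blast
  have err: "norm ((\<Sum>a<n. \<Sum>b<n. \<Sum>c<n. G (int a) (int b) (int c) * Wd (int a) (int b) (int c)) -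
      (\<Sum>a<n. \<Sum>b<n. \<Sum>c<n. I a b c * Wd (int a) (int b) (int c))) \<le> \<eta> * (M * (2 * real t + real n * harm n) ^ 4)"
  proof -
    have "(\<Sum>a<n. \<Sum>b<n. \<Sum>c<n. G (int a) (int b) (int c) * Wd (int a) (int b) (int c)) -
        (\<Sum>a<n. \<Sum>b<n. \<Sum>c<n. I a b c * Wd (int a) (int b) (int c)) =
        (\<Sum>a<n. \<Sum>b<n. \<Sum>c<n. (G (int a) (int b) (int c) - I a b c) * Wd (int a) (int b) (int c))"
      by (simp add: sum_subtractf left_diff_distrib)
    also have "norm \<dots> \<le> (\<Sum>a<n. \<Sum>b<n. \<Sum>c<n. \<eta> * (\<Sum>l<?N. norm (W (int l) (int a) (int b) (int c))))"
    proof (intro sum_norm_le)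
      fix a b c assume "a \<in> {..<n}" "b \<in> {..<n}" "c \<in> {..<n}"
      hence "norm (G (int a) (int b) (int c) - I a b c) \<le> \<eta>" by (intro G_I) auto
      moreover have "norm (Wd (int a) (int b) (int c)) \<le> (\<Sum>l<?N. norm (W (int l) (int a) (int b) (int c)))"
        unfolding Wd_def by (rule norm_sum)
      ultimately show "norm ((G (int a) (int b) (int c) - I a b c) * Wd (int a) (int b) (int c))
          \<le> \<eta> * (\<Sum>l<?N. norm (W (int l) (int a) (int b) (int c)))"
        unfolding norm_mult using \<eta>0 by (intro mult_mono) auto
    qed
    also have "\<dots> = \<eta> * (\<Sum>a<n. \<Sum>b<n. \<Sum>c<n. \<Sum>l<?N. norm (W (int l) (int a) (int b) (int c)))"
      by (simp only: sum_distrib_left)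
    also have "(\<Sum>a<n. \<Sum>b<n. \<Sum>c<n. \<Sum>l<?N. norm (W (int l) (int a) (int b) (int c))) =
        (\<Sum>a<n. \<Sum>b<n. \<Sum>l<?N. \<Sum>c<n. norm (W (int l) (int a) (int b) (int c)))"
      by (rule sum.cong[OF refl], rule sum.cong[OF refl], rule sum.swap)
    also have "\<dots> = (\<Sum>l<?N. \<Sum>a<n. \<Sum>b<n. \<Sum>c<n. norm (W (int l) (int a) (int b) (int c)))"
      by (rule sum_rotate3)
    also have "\<dots> \<le> M * (2 * real t + real n * harm n) ^ 4"
      using sum_window_le[OF n M, of t] by (simp add: W_def D_def norm_mult)
    finally show ?thesis using \<eta>0 by (simp add: mult_left_mono)
  qed
  have "complex_of_real (real n ^ 4 * (\<Sum>l<?N. norm (p (int l)) ^ 4) - real n ^ 3 * ?N * (2 * n * A1 - A2)) =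
      (\<Sum>a<n. \<Sum>b<n. \<Sum>c<n. G (int a) (int b) (int c) * Wd (int a) (int b) (int c)) -
      (\<Sum>a<n. \<Sum>b<n. \<Sum>c<n. I a b c * Wd (int a) (int b) (int c))"
    unfolding main total[symmetric] by simp
  hence "norm (complex_of_real (real n ^ 4 * (\<Sum>l<?N. norm (p (int l)) ^ 4) - real n ^ 3 * ?N * (2 * n * A1 - A2)))
      \<le> \<eta> * (M * (2 * real t + real n * harm n) ^ 4)"
    using err by (simp only:)
  hence "\<bar>real n ^ 4 * (\<Sum>l<?N. norm (p (int l)) ^ 4) - real n ^ 3 * ?N * (2 * n * A1 - A2)\<bar> \<le> \<eta> * (M * (2 * real t + real n * harm n) ^ 4)"
    by (simp only: norm_of_real)
  moreover have "real n ^ 4 * (\<Sum>l<?N. norm (p (int l)) ^ 4) - real n ^ 3 * ?N * (2 * n * A1 - A2) =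
      (real n ^ 5 * M) * ((\<Sum>l<?N. norm (p (int l)) ^ 4) / ?N - (2 * A1 - A2 / n))"
  proof -
    have ring_id: "x ^ 4 * (u * (y * x)) - x ^ 3 * (y * x) * (2 * x * A1 - w * x) = x ^ 5 * y * (u - (2 * A1 - w))"
      for x y u w :: real by (simp add: algebra_simps eval_nat_numeral)
    show ?thesis
      using ring_id[of "real n" "(\<Sum>l<?N. norm (p (int l)) ^ 4) / ?N" "real M" "A2 / n"] n M by simp
  qed
  ultimately have "(real n ^ 5 * M) * \<bar>(\<Sum>l<?N. norm (p (int l)) ^ 4) / ?N - (2 * A1 - A2 / n)\<bar> \<le> \<eta> * (M * (2 * real t + real n * harm n) ^ 4)"
    by (simp add: abs_mult)
  hence "\<bar>(\<Sum>l<?N. norm (p (int l)) ^ 4) / ?N - (2 * A1 - A2 / n)\<bar> \<le> \<eta> * (M * (2 * real t + real n * harm n) ^ 4) / (real n ^ 5 * M)"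
    using n M by (subst pos_le_divide_eq) (auto simp: mult.commute)
  thus ?thesis using M by (simp add: p_def A1_def A2_def)
qed

section \<open>The limit of the merit factor\<close>

lemma has_integral_cis:
  fixes m :: int
  shows "((\<lambda>\<phi>. cis (m * \<phi>)) has_integral (if m = 0 then 2 * pi else 0)) {0..2 * pi}"
proof (cases "m = 0")
  case True
  have "((\<lambda>\<phi>. 1 :: complex) has_integral content {0..2 * pi} *\<^sub>R 1) {0..2 * pi}"
    by (rule has_integral_const_real)
  thus ?thesis using True by (simp add: scaleR_conv_of_real)
next
  case False
  have deriv: "((\<lambda>\<phi>. cis (m * \<phi>) / (\<i> * m)) has_vector_derivative cis (real_of_int m * x)) (at x within {0..2 * pi})" for x :: real
    unfolding cis_conv_exp using False
    by (auto intro!: derivative_eq_intros has_vector_derivative_real_field simp: field_simps)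
  have "((\<lambda>\<phi>. cis (m * \<phi>)) has_integral cis (real_of_int m * (2 * pi)) / (\<i> * m) - cis (real_of_int m * 0) / (\<i> * m)) {0..2 * pi}"
    by (rule fundamental_theorem_of_calculus) (use deriv in auto)
  moreover have "cis (real_of_int m * (2 * pi)) = 1" using cis_multiple_2pi[of m] by (simp add: mult_ac)
  ultimately show ?thesis using False by simp
qed

text \<open>The integral and the mean over \<open>N\<close> equidistant points both select frequency
  zero, the latter as long as no other frequency is a multiple of \<open>N\<close>. This replaces
  the integral in the norm by a finite sum.\<close>

lemma trig_poly_mean:
  fixes g :: "real \<Rightarrow> real" and a :: "'i \<Rightarrow> complex" and m :: "'i \<Rightarrow> int"
  assumes fin: "finite I" and g: "\<And>\<phi>::real. complex_of_real (g \<phi>) = (\<Sum>i\<in>I. a i * cis (real_of_int (m i) * \<phi>))"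
  defines "S \<equiv> \<Sum>i\<in>I. if m i = 0 then a i else 0"
  shows "(g has_integral 2 * pi * Re S) {0..2 * pi}"
    and "\<lbrakk>N > 0; \<And>i. i \<in> I \<Longrightarrow> \<bar>m i\<bar> < int N\<rbrakk> \<Longrightarrow> (\<Sum>l<N. g (2 * pi * real l / real N)) / real N = Re S"
proof -
  have "((\<lambda>\<phi>. \<Sum>i\<in>I. a i * cis (m i * \<phi>)) has_integral (\<Sum>i\<in>I. a i * (if m i = 0 then 2 * pi else 0))) {0..2 * pi}"
    by (intro has_integral_sum fin has_integral_mult_right has_integral_cis)
  hence "((\<lambda>\<phi>. complex_of_real (g \<phi>)) has_integral (\<Sum>i\<in>I. a i * (if m i = 0 then 2 * pi else 0))) {0..2 * pi}"
    by (simp only: g)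
  also have "(\<Sum>i\<in>I. a i * (if m i = 0 then 2 * pi else 0)) = 2 * pi * S"
    unfolding S_def sum_distrib_left by (intro sum.cong refl) simp
  finally have "((\<lambda>\<phi>. complex_of_real (g \<phi>)) has_integral 2 * pi * S) {0..2 * pi}" .
  from has_integral_linear[OF this bounded_linear_Re]
  have "((\<lambda>\<phi>. Re (complex_of_real (g \<phi>))) has_integral Re (2 * pi * S)) {0..2 * pi}"
    by (simp only: o_def)
  thus "(g has_integral 2 * pi * Re S) {0..2 * pi}" by simp
next
  assume N: "N > 0" and small: "\<And>i. i \<in> I \<Longrightarrow> \<bar>m i\<bar> < int N"
  have "complex_of_real (\<Sum>l<N. g (2 * pi * real l / real N)) = (\<Sum>l<N. \<Sum>i\<in>I. a i * root_unity N (m i * int l))"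
    unfolding of_real_sum g by (intro sum.cong refl) (simp add: root_unity_def mult_ac)
  also have "\<dots> = (\<Sum>i\<in>I. a i * (\<Sum>l<N. root_unity N (m i * int l)))"
    unfolding sum_distrib_left by (rule sum.swap)
  also have "\<dots> = (\<Sum>i\<in>I. of_nat N * (if m i = 0 then a i else 0))"
    by (intro sum.cong refl) (use small in \<open>simp add: sum_root_unity[OF N] int_dvd_small_iff\<close>)
  also have "\<dots> = of_nat N * S" by (simp add: S_def sum_distrib_left)
  finally have "Re (complex_of_real (\<Sum>l<N. g (2 * pi * real l / real N))) = Re (of_nat N * S)" by simp
  thus "(\<Sum>l<N. g (2 * pi * real l / real N)) / real N = Re S" using N by simp
qed

lemma poly_monom_sum_cis:
  "poly (\<Sum>j<t. Polynomial.monom (c j) j) (cis \<phi>) = (\<Sum>j<t. c j * cis (real j * \<phi>))"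
  by (simp add: poly_sum poly_monom Complex.DeMoivre)

lemma poly_norm_2:
  assumes "\<And>j. j < t \<Longrightarrow> norm (c j) = 1"
  shows "poly_norm 2 (\<Sum>j<t. Polynomial.monom (c j) j) ^ 4 = (real t)\<^sup>2"
proof -
  let ?f = "\<Sum>j<t. Polynomial.monom (c j) j" let ?I = "{..<t} \<times> {..<t}"
  define m where "m p = int (fst p) - int (snd p)" for p :: "nat \<times> nat"
  define a where "a p = c (fst p) * cnj (c (snd p))" for p
  have g: "complex_of_real (norm (poly ?f (cis \<phi>)) ^ 2) = (\<Sum>p\<in>?I. a p * cis (real_of_int (m p) * \<phi>))" for \<phi> :: real
    unfolding complex_norm_square poly_monom_sum_cis cnj_sum sum_product sum.cartesian_product
    by (intro sum.cong refl) (auto simp: a_def m_def cis_cnj cis_mult algebra_simps)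
  have "(\<Sum>p\<in>?I. if m p = 0 then a p else 0) = (\<Sum>i<t. \<Sum>j<t. if j = i then c i * cnj (c i) else 0)"
    unfolding sum.cartesian_product by (intro sum.cong refl) (auto simp: m_def a_def)
  also have "\<dots> = (\<Sum>i<t. 1)"
    by (intro sum.cong refl) (simp add: assms complex_norm_square[symmetric])
  finally have S: "(\<Sum>p\<in>?I. if m p = 0 then a p else 0) = of_nat t" by simp
  have "((\<lambda>\<phi>. norm (poly ?f (cis \<phi>)) ^ 2) has_integral 2 * pi * Re (\<Sum>p\<in>?I. if m p = 0 then a p else 0)) {0..2 * pi}"
    by (rule trig_poly_mean(1)[OF _ g]) simp
  hence "integral {0..2 * pi} (\<lambda>\<phi>. norm (poly ?f (cis \<phi>)) ^ 2) = 2 * pi * t" by (simp add: S integral_unique)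
  hence "poly_norm 2 ?f = real t powr (1 / 2)" by (simp add: poly_norm_def powr_numeral)
  thus ?thesis by (simp add: powr_half_sqrt) (simp add: power4_eq_xxxx power2_eq_square)
qed

text \<open>The fourth power of the modulus has frequencies of absolute value at most
  \<open>2 * (t - 1)\<close>, which is below \<open>N\<close>.\<close>

lemma poly_norm_4:
  assumes N: "N > 0" "2 * t \<le> N"
  shows "poly_norm 4 (\<Sum>j<t. Polynomial.monom (c j) j) ^ 4 =
    (\<Sum>l<N. norm (\<Sum>j<t. c j * root_unity N (int j * int l)) ^ 4) / N"
proof -
  let ?f = "\<Sum>j<t. Polynomial.monom (c j) j" let ?I = "({..<t} \<times> {..<t}) \<times> {..<t} \<times> {..<t}"
  define m where "m p = (case p of ((i, j), (i', j')) \<Rightarrow> int i - int j + (int i' - int j'))" for p :: "(nat \<times> nat) \<times> nat \<times> nat"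
  define a where "a p = (case p of ((i, j), (i', j')) \<Rightarrow> c i * cnj (c j) * (c i' * cnj (c j')))" for p
  have g: "complex_of_real (norm (poly ?f (cis \<phi>)) ^ 4) = (\<Sum>p\<in>?I. a p * cis (real_of_int (m p) * \<phi>))" for \<phi> :: real
  proof -
    have "norm (poly ?f (cis \<phi>)) ^ 4 = norm (poly ?f (cis \<phi>)) ^ 2 * norm (poly ?f (cis \<phi>)) ^ 2"
      by (simp flip: power_add)
    hence "complex_of_real (norm (poly ?f (cis \<phi>)) ^ 4) =
        (poly ?f (cis \<phi>) * cnj (poly ?f (cis \<phi>))) * (poly ?f (cis \<phi>) * cnj (poly ?f (cis \<phi>)))"
      by (simp only: of_real_mult complex_norm_square)
    also have "\<dots> = (\<Sum>p\<in>?I. a p * cis (real_of_int (m p) * \<phi>))"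
      unfolding poly_monom_sum_cis cnj_sum sum_product[of _ "{..<t}" _ "{..<t}"] sum.cartesian_product
      unfolding sum_product sum.cartesian_product
      by (intro sum.cong refl) (auto simp: a_def m_def cis_cnj cis_mult algebra_simps)
    finally show ?thesis .
  qed
  let ?S = "\<Sum>p\<in>?I. if m p = 0 then a p else 0"
  have "((\<lambda>\<phi>. norm (poly ?f (cis \<phi>)) ^ 4) has_integral 2 * pi * Re ?S) {0..2 * pi}"
    by (rule trig_poly_mean(1)[OF _ g]) simp
  hence "integral {0..2 * pi} (\<lambda>\<phi>. norm (poly ?f (cis \<phi>)) ^ 4) = 2 * pi * Re ?S" by (simp add: integral_unique)
  hence pn: "poly_norm 4 ?f = Re ?S powr (1 / 4)" by (simp add: poly_norm_def powr_numeral)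
  have small: "\<bar>m p\<bar> < int N" if "p \<in> ?I" for p
    using that N(2) by (auto simp: m_def)
  have "(\<Sum>l<N. norm (poly ?f (cis (2 * pi * real l / real N))) ^ 4) / real N = Re ?S"
    using trig_poly_mean(2)[OF _ g N(1) small] by (simp only: finite_cartesian_product finite_lessThan simp_thms)
  moreover have "poly ?f (cis (2 * pi * real l / real N)) = (\<Sum>j<t. c j * root_unity N (int j * int l))" for l
    unfolding poly_monom_sum_cis by (simp add: root_unity_def mult_ac)
  ultimately have S: "Re ?S = (\<Sum>l<N. norm (\<Sum>j<t. c j * root_unity N (int j * int l)) ^ 4) / N" by simp
  hence "Re ?S \<ge> 0" by (simp add: sum_nonneg)
  moreover have "(v powr (1 / 4)) ^ 4 = v" if "v \<ge> 0" for v :: real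
  proof (cases "v = 0")
    case False
    thus ?thesis using that powr_realpow[of "v powr (1 / 4)" 4] by (simp add: powr_powr)
  qed simp
  ultimately have "(Re ?S powr (1 / 4)) ^ 4 = Re ?S" by blast
  thus ?thesis unfolding pn by (simp only: S)
qed

text \<open>The nonzero multiples of \<open>n\<close> come in pairs of opposite sign. Truncation by
  \<open>max 0\<close> extends the sum to a range \<open>R\<close> that need not move with
  \<open>t\<close>, so that a limit can be taken term by term.\<close>

lemma sum_lag_weight_multiples:
  assumes n: "n > 0" and R: "t \<le> R * n" and t: "t > 0"
  shows "(\<Sum>\<delta>\<in>{\<delta> \<in> {- int t<..<int t}. int n dvd \<delta>}. (lag_weight t \<delta>)\<^sup>2) =
    (real t)\<^sup>2 + 2 * (\<Sum>m<R. (max 0 (real t - real (Suc m) * n))\<^sup>2)"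
proof -
  let ?S = "{\<delta> \<in> {- int t<..<int t}. int n dvd \<delta>}"
  define P where "P = {m \<in> {..<R}. Suc m * n < t}"
  have Rn: "m < R" if "Suc m * n < t" for m
  proof -
    have "Suc m * n < R * n" using that R by linarith
    hence "Suc m < R" by (rule mult_less_cancel2[THEN iffD1, THEN conjunct2])
    thus ?thesis by simp
  qed
  have P: "(\<Sum>m<R. (max 0 (real t - real (Suc m) * n))\<^sup>2) = (\<Sum>m\<in>P. (lag_weight t (int (Suc m * n)))\<^sup>2)"
  proof (rule sum.mono_neutral_cong_right)
    have c: "real (Suc m) * n = real (Suc m * n)" for m by (simp only: of_nat_mult)
    show "\<forall>m\<in>{..<R} - P. (max 0 (real t - real (Suc m) * n))\<^sup>2 = 0"
    proof
      fix m assume m: "m \<in> {..<R} - P"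
      hence "t \<le> Suc m * n" by (auto simp: P_def)
      hence "real t \<le> real (Suc m) * n" unfolding c of_nat_le_iff .
      thus "(max 0 (real t - real (Suc m) * n))\<^sup>2 = 0" by simp
    qed
    show "(max 0 (real t - real (Suc m) * n))\<^sup>2 = (lag_weight t (int (Suc m * n)))\<^sup>2" if "m \<in> P" for m
    proof -
      have "real (Suc m * n) < real t" using that unfolding P_def of_nat_less_iff by simp
      thus ?thesis unfolding c lag_weight_def by simp
    qed
  qed (auto simp: P_def)
  have S: "?S = {0} \<union> ((\<lambda>m. int (Suc m * n)) ` P \<union> (\<lambda>m. - int (Suc m * n)) ` P)"
  proof (intro equalityI subsetI)
    fix \<delta> assume \<delta>: "\<delta> \<in> ?S"
    then obtain k where k: "\<delta> = int n * k" by (auto elim: dvdE)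
    show "\<delta> \<in> {0} \<union> ((\<lambda>m. int (Suc m * n)) ` P \<union> (\<lambda>m. - int (Suc m * n)) ` P)"
    proof (cases k "0::int" rule: linorder_cases)
      case greater
      then obtain m where m: "k = int (Suc m)" by (metis gr0_conv_Suc zero_less_imp_eq_int)
      hence eq: "\<delta> = int (Suc m * n)" using k by (simp only: of_nat_mult mult.commute)
      have "int (Suc m * n) < int t" using \<delta> unfolding eq by (simp only: mem_Collect_eq greaterThanLessThan_iff)
      hence "Suc m * n < t" by (simp only: of_nat_less_iff)
      thus ?thesis using eq Rn[of m] unfolding P_def by blast
    next
      case less
      then obtain m where m: "- k = int (Suc m)" by (metis gr0_conv_Suc zero_less_imp_eq_int neg_0_less_iff_less)
      hence "k = - int (Suc m)" by simp
      hence eq: "\<delta> = - int (Suc m * n)" using k by (simp only: of_nat_mult mult.commute mult_minus_left)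
      have "int (Suc m * n) < int t" using \<delta> unfolding eq by (simp only: mem_Collect_eq greaterThanLessThan_iff neg_less_iff_less)
      hence "Suc m * n < t" by (simp only: of_nat_less_iff)
      thus ?thesis using eq Rn[of m] unfolding P_def by blast
    qed (use k in simp)
  next
    fix \<delta> assume "\<delta> \<in> {0} \<union> ((\<lambda>m. int (Suc m * n)) ` P \<union> (\<lambda>m. - int (Suc m * n)) ` P)"
    then consider "\<delta> = 0" | m where "m \<in> P" "\<delta> = int (Suc m * n) \<or> \<delta> = - int (Suc m * n)" by blast
    thus "\<delta> \<in> ?S"
    proof cases
      case 1
      thus ?thesis using t by simp
    next
      case 2
      have "int (Suc m * n) < int t" using 2(1) unfolding P_def of_nat_less_iff by blast
      moreover have "0 \<le> int (Suc m * n)" by (rule of_nat_0_le_iff)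
      moreover have "int n dvd int (Suc m * n)" by (simp only: int_dvd_int_iff dvd_triv_right)
      ultimately show ?thesis using 2(2) by (auto simp del: of_nat_Suc mult_Suc of_nat_mult)
    qed
  qed
  have inj: "inj_on (\<lambda>m. int (Suc m * n)) P" "inj_on (\<lambda>m. - int (Suc m * n)) P"
    using n by (auto simp: inj_on_def)
  have pos: "int (Suc m * n) > 0" for m
  proof -
    have "0 < Suc m * n" using n by simp
    thus ?thesis by (simp only: of_nat_0_less_iff)
  qed
  have ne: "int (Suc a * n) \<noteq> - int (Suc b * n)" "0 \<noteq> int (Suc a * n)" "0 \<noteq> - int (Suc a * n)" for a b
    using pos[of a] pos[of b] by linarith+
  have dj: "(\<lambda>m. int (Suc m * n)) ` P \<inter> (\<lambda>m. - int (Suc m * n)) ` P = {}"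
    "{0} \<inter> ((\<lambda>m. int (Suc m * n)) ` P \<union> (\<lambda>m. - int (Suc m * n)) ` P) = {}"
    using ne by blast+
  have fin: "finite P" by (simp add: P_def)
  have neg: "lag_weight t (- \<delta>) = lag_weight t \<delta>" for \<delta> by (simp add: lag_weight_def)
  have "(\<Sum>\<delta>\<in>?S. (lag_weight t \<delta>)\<^sup>2) = (lag_weight t 0)\<^sup>2 +
      ((\<Sum>m\<in>P. (lag_weight t (int (Suc m * n)))\<^sup>2) + (\<Sum>m\<in>P. (lag_weight t (- int (Suc m * n)))\<^sup>2))"
    unfolding S using fin dj
    by (subst sum.union_disjoint; (simp del: of_nat_Suc mult_Suc of_nat_mult)?)
      (subst sum.union_disjoint; (simp add: sum.reindex[OF inj(1)] sum.reindex[OF inj(2)] del: of_nat_Suc mult_Suc of_nat_mult)?)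
  thus ?thesis unfolding P neg by (simp add: lag_weight_def)
qed

lemma sum_lag_weight:
  assumes "t > 0"
  shows "(\<Sum>\<delta>\<in>{- int t<..<int t}. (lag_weight t \<delta>)\<^sup>2) = real t * (2 * (real t)\<^sup>2 + 1) / 3"
proof -
  have "{\<delta> \<in> {- int t<..<int t}. int 1 dvd \<delta>} = {- int t<..<int t}" by auto
  hence "(\<Sum>\<delta>\<in>{- int t<..<int t}. (lag_weight t \<delta>)\<^sup>2) = (real t)\<^sup>2 + 2 * (\<Sum>m<t. (max 0 (real t - real (Suc m) * 1))\<^sup>2)"
    using sum_lag_weight_multiples[of 1 t t] assms by simp
  also have "(\<Sum>m<t. (max 0 (real t - real (Suc m) * 1))\<^sup>2) = (\<Sum>m<t. (real m)\<^sup>2)"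
    by (rule sum.reindex_bij_witness[of _ "\<lambda>m. t - 1 - m" "\<lambda>m. t - 1 - m"]) (auto simp: of_nat_diff)
  also have "(\<Sum>m<k. (real m)\<^sup>2) = real k * (real k - 1) * (2 * real k - 1) / 6" for k
    by (induction k) (simp_all add: field_simps power2_eq_square)
  finally show ?thesis by (simp add: field_simps power2_eq_square)
qed

section \<open>The reciprocal of the limiting merit factor\<close>

definition inv_phi :: "real \<Rightarrow> real" where
  "inv_phi T = 1 - 2 * T / 3 + 4 * (\<Sum>m. (max 0 (1 - real (Suc m) / T))\<^sup>2)"

lemma phi_series_finite:
  assumes "T > 0" and "T \<le> real R"
  shows "(\<Sum>m. (max 0 (1 - real (Suc m) / T))\<^sup>2) = (\<Sum>m<R. (max 0 (1 - real (Suc m) / T))\<^sup>2)"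
proof -
  have zero: "(max 0 (1 - real (Suc m) / T))\<^sup>2 = 0" if "m \<notin> {..<R}" for m
  proof -
    have "real R \<le> real m" using that by simp
    hence "real (Suc m) / T \<ge> 1" using assms by (simp add: field_simps)
    thus ?thesis by simp
  qed
  show ?thesis by (rule suminf_finite[OF finite_lessThan zero])
qed

text \<open>This is the limit of the denominator of the merit factor after division by
  \<open>t\<^sup>2\<close>, so it must not vanish.\<close>

lemma inv_phi_pos:
  assumes T: "T > 0"
  shows "inv_phi T > 0"
proof -
  define R where "R = nat \<lceil>T\<rceil>"
  have R: "T \<le> real R" by (simp add: R_def real_nat_ceiling_ge)
  let ?\<Sigma> = "\<Sum>m<R. (max 0 (1 - real (Suc m) / T))\<^sup>2"
  have inv: "inv_phi T = 1 - 2 * T / 3 + 4 * ?\<Sigma>" by (simp only: inv_phi_def phi_series_finite[OF T R])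
  show ?thesis
  \<comment> \<open>Below \<open>3 / 2\<close> the linear part is positive by itself. From there on
    the series exceeds \<open>T / 3 - 1 / 2\<close>, and
    \<open>1 - 2 * T / 3 + 4 * (T / 3 - 1 / 2) = 2 * T / 3 - 1\<close> is nonnegative.\<close>
  proof (cases "T < 3 / 2")
    case True
    have "?\<Sigma> \<ge> 0" by (intro sum_nonneg) simp
    thus ?thesis using True inv by simp
  next
    case False
    define M where "M = nat \<lfloor>T\<rfloor>"
    define \<tau> where "\<tau> = T - real M"
    have M: "real M \<le> T" "T < real M + 1" using T by (simp_all add: M_def)
    have \<tau>: "0 \<le> \<tau>" "\<tau> < 1" "T = real M + \<tau>" using M by (simp_all add: \<tau>_def)
    have "real M > 0" using M False by linarith
    have "M \<le> R" using M(1) R by (metis of_nat_le_iff order.trans)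
    have "(\<Sum>m<k. (1 - real (Suc m) / T)\<^sup>2) = real k - real k * (real k + 1) / T + real k * (real k + 1) * (2 * real k + 1) / (6 * T\<^sup>2)" for k
      using T by (induction k) (simp_all add: field_simps power2_eq_square)
    \<comment> \<open>In terms of \<open>T = M + \<tau>\<close>, the excess over
      \<open>T / 3 - 1 / 2\<close> is
      \<open>(M + 3 * \<tau>\<^sup>2 - 2 * \<tau> ^ 3) / (6 * T\<^sup>2)\<close>, which is positive
      since \<open>0 \<le> \<tau> < 1\<close> and \<open>M > 0\<close>.\<close>
    hence "6 * T\<^sup>2 * (\<Sum>m<M. (1 - real (Suc m) / T)\<^sup>2) =
        6 * T\<^sup>2 * real M - 6 * T * (real M * (real M + 1)) + real M * (real M + 1) * (2 * real M + 1)"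
      using T by (simp add: field_simps power2_eq_square)
    also have "\<dots> = 6 * T\<^sup>2 * (T / 3 - 1 / 2) + (real M + 3 * \<tau>\<^sup>2 - 2 * \<tau> ^ 3)"
      unfolding \<tau>(3) by (simp add: field_simps power2_eq_square power3_eq_cube)
    finally have eq: "6 * T\<^sup>2 * (\<Sum>m<M. (1 - real (Suc m) / T)\<^sup>2) = 6 * T\<^sup>2 * (T / 3 - 1 / 2) + (real M + 3 * \<tau>\<^sup>2 - 2 * \<tau> ^ 3)" .
    have "\<tau> ^ 3 \<le> \<tau>\<^sup>2" using \<tau> by (intro power_decreasing) auto
    hence "real M + 3 * \<tau>\<^sup>2 - 2 * \<tau> ^ 3 > 0" using \<open>real M > 0\<close> zero_le_power2[of \<tau>] by linarith
    hence "6 * T\<^sup>2 * (\<Sum>m<M. (1 - real (Suc m) / T)\<^sup>2) > 6 * T\<^sup>2 * (T / 3 - 1 / 2)" using eq by linarith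
    hence "(\<Sum>m<M. (1 - real (Suc m) / T)\<^sup>2) > T / 3 - 1 / 2" using T by (simp only: mult_less_cancel_left_pos zero_less_mult_iff zero_less_power zero_less_numeral simp_thms)
    moreover have "(\<Sum>m<M. (1 - real (Suc m) / T)\<^sup>2) \<le> ?\<Sigma>"
    proof -
      have "(\<Sum>m<M. (1 - real (Suc m) / T)\<^sup>2) = (\<Sum>m<M. (max 0 (1 - real (Suc m) / T))\<^sup>2)"
      proof (intro sum.cong refl)
        fix m assume "m \<in> {..<M}"
        hence "real (Suc m) \<le> real M" by (simp only: of_nat_le_iff lessThan_iff Suc_le_eq)
        hence "real (Suc m) / T \<le> 1" using M(1) T by (simp add: divide_le_eq)
        thus "(1 - real (Suc m) / T)\<^sup>2 = (max 0 (1 - real (Suc m) / T))\<^sup>2" by simp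
      qed
      also have "\<dots> \<le> ?\<Sigma>" by (rule sum_mono2) (use \<open>M \<le> R\<close> in auto)
      finally show ?thesis .
    qed
    ultimately show ?thesis using inv False by simp
  qed
qed

lemma phi_eq: "phi 0 0 T = 1 / inv_phi T"
  by (simp add: phi_def inv_phi_def)

lemma harm_le_ln: "n > 0 \<Longrightarrow> harm n \<le> 1 + ln (real n)"
proof -
  assume "n > 0"
  then obtain m where m: "n = Suc m" by (cases n) auto
  have "harm (Suc m) - ln (Suc m) \<le> harm (Suc 0) - ln (Suc 0)"
    using decseq_harm_diff_ln by (rule decseqD) simp
  thus ?thesis by (simp add: m harm_expand)
qed

text \<open>After division by \<open>t\<^sup>2\<close> the main term is a continuous function of
  \<open>x = t / (q - 1)\<close>, up to a term that tends to zero. The error has exponent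
  \<open>11 / 4 + 4 - 5 - 2 = - 1 / 4\<close>, so the fourth power of the logarithm does no
  harm.\<close>

lemma merit_limit:
  fixes G :: "nat filter" and t :: "nat \<Rightarrow> nat" and E :: "nat \<Rightarrow> real"
  assumes G: "filterlim (\<lambda>q. q) at_top G" and T: "T > 0"
    and t: "((\<lambda>q. real (t q) / real q) \<longlongrightarrow> T) G"
    and E: "\<forall>\<^sub>F q in G. \<bar>E q -
      (2 * (\<Sum>\<delta>\<in>{\<delta> \<in> {- int (t q)<..<int (t q)}. int (q - 1) dvd \<delta>}. (lag_weight (t q) \<delta>)\<^sup>2)
        - (\<Sum>\<delta>\<in>{- int (t q)<..<int (t q)}. (lag_weight (t q) \<delta>)\<^sup>2) / real (q - 1))\<bar>
      \<le> 3 * (real q)\<^sup>2 * sqrt q * sqrt (sqrt q) * (2 * real (t q) + real (q - 1) * harm (q - 1)) ^ 4 / real (q - 1) ^ 5"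
  shows "((\<lambda>q. (real (t q))\<^sup>2 / (E q - (real (t q))\<^sup>2)) \<longlongrightarrow> phi 0 0 T) G"
proof -
  define n where "n q = real (q - 1)" for q :: nat
  define x where "x q = real (t q) / n q" for q
  have big: "\<forall>\<^sub>F q in G. q \<ge> k" for k using G by (simp add: filterlim_at_top)
  have real_G: "filterlim real at_top G" by (rule filterlim_compose[OF filterlim_real_sequentially G])
  have n_eq: "\<forall>\<^sub>F q in G. n q = real q - 1" using big[of 1] by eventually_elim (simp add: n_def of_nat_diff)
  have x_lim: "(x \<longlongrightarrow> T) G"
  proof -
    have "((\<lambda>y::real. y / (y - 1)) \<longlongrightarrow> 1) at_top" by real_asymp
    from filterlim_compose[OF this real_G] have "((\<lambda>q. real q / (real q - 1)) \<longlongrightarrow> 1) G" .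
    from tendsto_mult[OF t this] have "((\<lambda>q. real (t q) / real q * (real q / (real q - 1))) \<longlongrightarrow> T) G" by simp
    thus ?thesis
      by (rule Lim_transform_eventually) (use n_eq big[of 2] in eventually_elim, auto simp: x_def)
  qed
  have x_low: "\<forall>\<^sub>F q in G. x q > T / 2" by (rule order_tendstoD(1)[OF x_lim]) (use T in simp)
  have x_up: "\<forall>\<^sub>F q in G. x q < T + 1" by (rule order_tendstoD(2)[OF x_lim]) simp
  \<comment> \<open>A fixed number of lag terms is enough once \<open>x q < T + 1\<close>.\<close>
  define R where "R = nat \<lceil>T + 1\<rceil>"
  have R: "T + 1 \<le> real R" by (simp only: R_def real_nat_ceiling_ge)
  define main where "main y = 2 * (1 + 2 * (\<Sum>m<R. (max 0 (1 - real (Suc m) / y))\<^sup>2)) - 2 * y / 3" for y :: real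
  have main_lim: "((\<lambda>q. main (x q)) \<longlongrightarrow> main T) G"
    unfolding main_def using T by (intro tendsto_intros x_lim) auto
  have main_T: "main T = 1 + inv_phi T"
    using phi_series_finite[OF T, of R] R by (simp add: main_def inv_phi_def)
  \<comment> \<open>From \<open>t \<le> (T + 1) * n\<close> and
    \<open>harm n \<le> 1 + ln n\<close>.\<close>
  define C where "C = 2 * (T + 1) + 1"
  \<comment> \<open>Eventually \<open>t \<ge> T / 2 * n\<close>, so division by
    \<open>t\<^sup>2\<close> turns the factor \<open>3\<close> into \<open>12 / T\<^sup>2\<close>.
    The second summand dominates \<open>1 / (3 * t * n)\<close>, the lower-order part of the sum
    over all lags.\<close>
  define err where "err y = 12 / T\<^sup>2 * ((y + 1)\<^sup>2 * sqrt (y + 1) * sqrt (sqrt (y + 1)) * (C + ln y) ^ 4 / y ^ 3)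
      + 2 / (3 * T) * (1 / y\<^sup>2)" for y :: real
  have err_lim: "((\<lambda>q. err (n q)) \<longlongrightarrow> 0) G"
  proof -
    have "((\<lambda>y::real. (y + 1)\<^sup>2 * sqrt (y + 1) * sqrt (sqrt (y + 1)) * (C + ln y) ^ 4 / y ^ 3) \<longlongrightarrow> 0) at_top"
      by real_asymp
    moreover have "((\<lambda>y::real. 1 / y\<^sup>2) \<longlongrightarrow> 0) at_top" by real_asymp
    ultimately have "(err \<longlongrightarrow> 12 / T\<^sup>2 * 0 + 2 / (3 * T) * 0) at_top"
      unfolding err_def by (intro tendsto_intros)
    hence "(err \<longlongrightarrow> 0) at_top" by simp
    moreover have "filterlim n at_top G"
    proof -
      have "filterlim (\<lambda>y::real. y - 1) at_top at_top" by real_asymp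
      from filterlim_compose[OF this real_G] have "filterlim (\<lambda>q. real q - 1) at_top G" .
      thus ?thesis by (rule filterlim_mono_eventually) (use n_eq in \<open>auto elim: eventually_mono\<close>)
    qed
    ultimately show ?thesis by (rule filterlim_compose)
  qed
  have "\<forall>\<^sub>F q in G. \<bar>E q / (real (t q))\<^sup>2 - main (x q)\<bar> \<le> err (n q)"
    using E big[of 2] x_low x_up
  proof eventually_elim
    case (elim q)
    let ?t = "real (t q)" let ?n = "n q"
    have n: "?n > 0" "q - 1 > 0" using elim(2) by (simp_all add: n_def)
    have tx: "?t = x q * ?n" using n by (simp add: x_def)
    have x: "x q > 0" using elim(3) T by linarith
    have t0: "?t > 0" using tx x n by simp
    have "?t \<le> real R * ?n" unfolding tx using elim(4) R n by (intro mult_right_mono) auto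
    hence "real (t q) \<le> real (R * (q - 1))" by (simp add: n_def)
    hence tR: "t q \<le> R * (q - 1)" by (simp only: of_nat_le_iff)
    have A1: "(\<Sum>\<delta>\<in>{\<delta> \<in> {- int (t q)<..<int (t q)}. int (q - 1) dvd \<delta>}. (lag_weight (t q) \<delta>)\<^sup>2) =
        ?t\<^sup>2 * (1 + 2 * (\<Sum>m<R. (max 0 (1 - real (Suc m) / x q))\<^sup>2))"
    proof -
      have "(max 0 (?t - real (Suc m) * real (q - 1)))\<^sup>2 = ?t\<^sup>2 * (max 0 (1 - real (Suc m) / x q))\<^sup>2" for m
      proof -
        have "?t - real (Suc m) * real (q - 1) = ?t * (1 - real (Suc m) / x q)"
          using t0 n by (simp add: x_def n_def field_simps)
        hence "max 0 (?t - real (Suc m) * real (q - 1)) = ?t * max 0 (1 - real (Suc m) / x q)"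
          using t0 by (simp add: max_mult_distrib_left)
        thus ?thesis by (simp add: power_mult_distrib)
      qed
      thus ?thesis using sum_lag_weight_multiples[OF n(2) tR] t0
        by (simp add: sum_distrib_left[symmetric] algebra_simps)
    qed
    have A2: "(\<Sum>\<delta>\<in>{- int (t q)<..<int (t q)}. (lag_weight (t q) \<delta>)\<^sup>2) = ?t * (2 * ?t\<^sup>2 + 1) / 3"
      using sum_lag_weight[of "t q"] t0 by simp
    have A2': "?t * (2 * ?t\<^sup>2 + 1) / 3 / ?n = ?t\<^sup>2 * (2 * x q / 3) + ?t\<^sup>2 * (1 / (3 * ?t * ?n))"
      using t0 n by (simp add: x_def field_simps power2_eq_square)
    define e1 where "e1 = 3 * (real q)\<^sup>2 * sqrt q * sqrt (sqrt q) * (2 * ?t + ?n * harm (q - 1)) ^ 4 / ?n ^ 5"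
    have "\<bar>E q - ?t\<^sup>2 * main (x q)\<bar> \<le> e1 + ?t\<^sup>2 * (1 / (3 * ?t * ?n))"
    proof -
      have "\<bar>E q - (?t\<^sup>2 * main (x q) - ?t\<^sup>2 * (1 / (3 * ?t * ?n)))\<bar> \<le> e1"
        using elim(1) A2' unfolding A1 A2 e1_def n_def[symmetric] main_def by (simp add: algebra_simps)
      moreover have "0 \<le> ?t\<^sup>2 * (1 / (3 * ?t * ?n))" using t0 n by simp
      ultimately show ?thesis by linarith
    qed
    moreover have "E q / ?t\<^sup>2 - main (x q) = (E q - ?t\<^sup>2 * main (x q)) / ?t\<^sup>2" using t0 by (simp add: field_simps)
    ultimately have "\<bar>E q / ?t\<^sup>2 - main (x q)\<bar> \<le> (e1 + ?t\<^sup>2 * (1 / (3 * ?t * ?n))) / ?t\<^sup>2"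
      using t0 by (simp add: divide_right_mono)
    also have "\<dots> = e1 / ?t\<^sup>2 + 1 / (3 * ?t * ?n)" using t0 by (simp add: add_divide_distrib)
    also have "\<dots> \<le> err ?n"
      unfolding err_def
    proof (rule add_mono)
      have tl: "T / 2 * ?n \<le> ?t" unfolding tx using elim(3) n by (intro mult_right_mono) auto
      have "1 / (3 * ?t * ?n) \<le> 1 / (3 * (T / 2 * ?n) * ?n)"
        using tl T n t0 by (intro divide_left_mono mult_right_mono mult_left_mono mult_pos_pos) auto
      thus "1 / (3 * ?t * ?n) \<le> 2 / (3 * T) * (1 / ?n\<^sup>2)" by (simp add: power2_eq_square mult_ac)
      have hl: "harm (q - 1) \<le> 1 + ln ?n" using harm_le_ln[OF n(2)] by (simp add: n_def)
      have "2 * ?t + ?n * harm (q - 1) \<le> 2 * ((T + 1) * ?n) + ?n * (1 + ln ?n)"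
        unfolding tx using elim(4) n hl by (intro add_mono mult_left_mono mult_right_mono) auto
      also have "\<dots> = ?n * (C + ln ?n)" by (simp add: C_def algebra_simps)
      finally have "(2 * ?t + ?n * harm (q - 1)) ^ 4 \<le> (?n * (C + ln ?n)) ^ 4"
        using t0 n harm_nonneg[of "q - 1", where 'a = real] by (intro power_mono) auto
      hence pw: "(2 * ?t + ?n * harm (q - 1)) ^ 4 \<le> ?n ^ 4 * (C + ln ?n) ^ 4" by (simp add: power_mult_distrib)
      have rq: "real q = ?n + 1" using elim(2) by (simp add: n_def of_nat_diff)
      define K where "K = (?n + 1)\<^sup>2 * sqrt (?n + 1) * sqrt (sqrt (?n + 1))"
      have K0: "K \<ge> 0" using n by (simp add: K_def)
      have e1: "e1 = 3 * K * (2 * ?t + ?n * harm (q - 1)) ^ 4 / ?n ^ 5"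
        unfolding e1_def rq K_def by simp
      have "e1 \<le> 3 * K * (?n ^ 4 * (C + ln ?n) ^ 4) / ?n ^ 5"
        unfolding e1 using pw K0 n by (intro divide_right_mono mult_left_mono) auto
      also have "\<dots> = 3 * K * (C + ln ?n) ^ 4 / ?n" using n by (simp add: field_simps eval_nat_numeral)
      finally have "e1 / ?t\<^sup>2 \<le> (3 * K * (C + ln ?n) ^ 4 / ?n) / (T / 2 * ?n)\<^sup>2"
        using mult_pos_pos[of "T / 2" ?n] tl T n t0 K0
        by (intro frac_le power_mono divide_nonneg_nonneg mult_nonneg_nonneg zero_less_power) auto
      also have "\<dots> = 12 / T\<^sup>2 * (K * (C + ln ?n) ^ 4 / ?n ^ 3)"
        using T n by (simp add: field_simps power2_eq_square power3_eq_cube)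
      finally show "e1 / ?t\<^sup>2 \<le> 12 / T\<^sup>2 * ((?n + 1)\<^sup>2 * sqrt (?n + 1) * sqrt (sqrt (?n + 1)) * (C + ln ?n) ^ 4 / ?n ^ 3)"
        unfolding K_def .
    qed
    finally show ?case .
  qed
  hence "((\<lambda>q. E q / (real (t q))\<^sup>2 - main (x q)) \<longlongrightarrow> 0) G"
    by (intro Lim_null_comparison[OF _ err_lim]) simp
  from tendsto_add[OF this main_lim] have "((\<lambda>q. E q / (real (t q))\<^sup>2) \<longlongrightarrow> 1 + inv_phi T) G"
    by (simp add: main_T)
  hence "((\<lambda>q. 1 / (E q / (real (t q))\<^sup>2 - 1)) \<longlongrightarrow> 1 / (1 + inv_phi T - 1)) G"
    using inv_phi_pos[OF T] by (intro tendsto_intros) auto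
  hence "((\<lambda>q. 1 / (E q / (real (t q))\<^sup>2 - 1)) \<longlongrightarrow> phi 0 0 T) G" by (simp add: phi_eq)
  moreover have "\<forall>\<^sub>F q in G. 1 / (E q / (real (t q))\<^sup>2 - 1) = (real (t q))\<^sup>2 / (E q - (real (t q))\<^sup>2)"
    using x_low
  proof eventually_elim
    case (elim q)
    hence "x q \<noteq> 0" using T by linarith
    hence "real (t q) \<noteq> 0" by (auto simp: x_def)
    thus ?case by (simp add: field_simps)
  qed
  ultimately show ?thesis by (rule Lim_transform_eventually)
qed

section \<open>Embedding finite fields of characteristic two\<close>

context field
begin

text \<open>The element \<open>- 1\<close> has square \<open>1\<close> and also power
  \<open>1\<close> for the odd exponent \<open>2 ^ k - 1\<close>, the order of the multiplicative
  group; hence it equals \<open>1\<close>.\<close>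

lemma char2_of_card:
  assumes "card (carrier R) = 2 ^ k" and "k > 0"
  shows "\<one> \<oplus> \<one> = \<zero>"
proof -
  interpret G: group "mult_of R" by (rule field_mult_group)
  have fin: "finite (carrier R)" using assms by (metis card.infinite power_eq_0_iff zero_neq_numeral)
  define y where "y = \<ominus> \<one>"
  have y: "y \<in> carrier R" "y \<otimes> y = \<one>" by (simp_all add: y_def l_minus r_minus)
  hence "y \<noteq> \<zero>" by auto
  hence "y [^]\<^bsub>mult_of R\<^esub> Coset.order (mult_of R) = \<one>\<^bsub>mult_of R\<^esub>" using y by (intro G.pow_order_eq_1) simp
  hence 1: "y [^] (2 ^ k - 1 :: nat) = \<one>" using assms by (simp add: order_mult_of[OF fin] Coset.order_def Multiplicative_Group.nat_pow_mult_of)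
  obtain j where "k = Suc j" using assms(2) by (cases k) auto
  hence "2 ^ k = 2 * (2 ^ j :: nat)" by simp
  moreover have "1 \<le> (2 ^ j :: nat)" by simp
  ultimately have "2 ^ k - 1 = Suc (2 * (2 ^ j - 1) :: nat)" by linarith
  moreover have "y [^] (2 * i :: nat) = \<one>" for i
  proof -
    have "y [^] (2::nat) = \<one>" using y by (simp add: numeral_2_eq_2)
    thus ?thesis using nat_pow_pow[OF y(1), of 2 i] by simp
  qed
  ultimately have "y = \<one>" using 1 y by simp
  thus ?thesis using r_neg[of \<one>] by (simp add: y_def)
qed

definition bit_eval :: "'a \<Rightarrow> bit poly \<Rightarrow> 'a" where
  "bit_eval x p = fold_coeffs (\<lambda>c v. (if c = 1 then \<one> else \<zero>) \<oplus> x \<otimes> v) p \<zero>"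

lemma bit_eval_0 [simp]: "bit_eval x 0 = \<zero>"
  by (simp add: bit_eval_def)

lemma bit_eval_pCons [simp]:
  "x \<in> carrier R \<Longrightarrow> bit_eval x (pCons c p) = (if c = 1 then \<one> else \<zero>) \<oplus> x \<otimes> bit_eval x p"
  by (cases "p = 0 \<and> c = 0") (auto simp: bit_eval_def)

lemma bit_eval_closed [simp]: "x \<in> carrier R \<Longrightarrow> bit_eval x p \<in> carrier R"
  by (induction p) auto

lemma bit_eval_1 [simp]: "x \<in> carrier R \<Longrightarrow> bit_eval x 1 = \<one>"
  unfolding one_pCons by simp

lemma bit_eval_add:
  assumes "\<one> \<oplus> \<one> = \<zero>" and x: "x \<in> carrier R"
  shows "bit_eval x (p + q) = bit_eval x p \<oplus> bit_eval x q"
proof (induction p q rule: poly_induct2)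
  case (pCons a p b q)
  have "(if a + b = 1 then \<one> else \<zero>) = (if a = 1 then \<one> else \<zero>) \<oplus> (if b = 1 then \<one> else \<zero>)" for a b :: bit
    by (cases "a = 0"; cases "b = 0") (auto simp: assms(1) simp del: add_bit_eq_xor)
  thus ?case using x pCons by (simp add: r_distr a_ac del: add_bit_eq_xor)
qed simp

lemma bit_eval_mult:
  assumes "\<one> \<oplus> \<one> = \<zero>" and x: "x \<in> carrier R"
  shows "bit_eval x (p * q) = bit_eval x p \<otimes> bit_eval x q"
proof (induction p)
  case (pCons a p)
  have "bit_eval x (smult a q) = (if a = 1 then \<one> else \<zero>) \<otimes> bit_eval x q"
    using x by (cases "a = 0") auto
  thus ?case using x pCons by (simp add: mult_pCons_left bit_eval_add[OF assms] l_distr m_assoc)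
qed (use x in simp)

lemma bit_eval_monom: "x \<in> carrier R \<Longrightarrow> bit_eval x (Polynomial.monom 1 i) = x [^] i"
  by (induction i) (simp_all add: monom_0 monom_Suc m_comm)

text \<open>The powers of \<open>x\<close> exhaust the nonzero elements, so evaluation at
  \<open>x\<close> maps the polynomials over the two-element field onto the whole field. Its kernel
  consists of multiples of one polynomial \<open>g\<close>, and sending \<open>x\<close> to a root
  of \<open>g\<close> in the closure is well defined. Injectivity is automatic for a map of
  fields.\<close>

lemma embed_in_closure:
  assumes char2: "\<one> \<oplus> \<one> = \<zero>" and x: "x \<in> carrier R"
    and N: "N > 0" "x [^] (N::nat) = \<one>" and gen: "carrier R - {\<zero>} \<subseteq> range (\<lambda>i::nat. x [^] i)"
  obtains \<Phi> :: "'a \<Rightarrow> bit alg_closure"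
  where "\<Phi> \<one> = 1" and "\<And>y z. y \<in> carrier R \<Longrightarrow> z \<in> carrier R \<Longrightarrow> \<Phi> (y \<oplus> z) = \<Phi> y + \<Phi> z"
    and "\<And>y z. y \<in> carrier R \<Longrightarrow> z \<in> carrier R \<Longrightarrow> \<Phi> (y \<otimes> z) = \<Phi> y * \<Phi> z"
    and "inj_on \<Phi> (carrier R)"
proof -
  let ?e = "bit_eval x"
  note ev = bit_eval_add[OF char2 x] bit_eval_mult[OF char2 x] bit_eval_monom[OF x]
  define P where "P g \<longleftrightarrow> g \<noteq> 0 \<and> ?e g = \<zero>" for g :: "bit poly"
  \<comment> \<open>Since \<open>x\<close> has finite order, \<open>X ^ N + 1\<close> lies in the
    kernel, which is therefore nonzero.\<close>
  have "P (Polynomial.monom 1 N + 1)"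
  proof -
    have "poly.coeff (Polynomial.monom 1 N + 1 :: bit poly) N = 1" using N(1) by (simp add: coeff_1)
    hence "Polynomial.monom 1 N + 1 \<noteq> (0 :: bit poly)" by (metis coeff_0 zero_neq_one)
    thus ?thesis using N(2) x by (simp add: P_def ev char2)
  qed
  then obtain g where g: "P g" and gmin: "\<And>h. P h \<Longrightarrow> degree g \<le> degree h"
    using ex_has_least_nat[of P _ degree] by blast
  have g0: "g \<noteq> 0" and eg: "?e g = \<zero>" using g by (auto simp: P_def)
  have dvd: "g dvd h" if "?e h = \<zero>" for h
  proof -
    have "?e (g * (h div g) + h mod g) = \<zero>" using that by simp
    hence "?e (h mod g) = \<zero>" using x by (simp only: ev eg) simp
    hence "h mod g = 0" using gmin[of "h mod g"] degree_mod_less'[OF g0, of h] unfolding P_def by (metis not_le)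
    thus ?thesis by (simp add: dvd_eq_mod_eq_0)
  qed
  have "degree g > 0"
  proof (rule ccontr)
    assume "\<not> degree g > 0"
    then obtain c where "g = [:c:]" using degree_eq_zeroE by auto
    thus False using g0 eg x by (cases "c = 0") auto
  qed
  hence "degree (map_poly to_ac g) > 0" by (simp add: degree_map_poly)
  then obtain \<xi> where \<xi>: "poly (map_poly to_ac g) \<xi> = 0" using alg_closed_imp_poly_has_root by blast
  define E where "E p = poly (map_poly to_ac p) \<xi>" for p :: "bit poly"
  have E: "E 1 = 1" "E (p + h) = E p + E h" "E (p * h) = E p * E h" for p h
    unfolding E_def to_ac.map_poly_add to_ac.map_poly_mult by (simp_all add: map_poly_1)
  have E0: "E h = 0" if "?e h = \<zero>" for h
  proof -
    from dvd[OF that] obtain u where "h = g * u" by (rule dvdE)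
    moreover have "E g = 0" using \<xi> by (simp add: E_def)
    ultimately show ?thesis by (simp only: E mult_zero_left)
  qed
  \<comment> \<open>In characteristic two a sum serves as a difference: equal evaluations put
    \<open>p + h\<close> into the kernel.\<close>
  have "a + a = 0" for a :: bit by (cases "a = 0") auto
  hence dbl: "p + p = 0" for p :: "bit poly" by (intro poly_eqI) (simp only: coeff_add coeff_0)
  have uniq: "E p = E h" if "?e p = ?e h" for p h
  proof -
    have "?e (p + h) = ?e (h + h)" using that by (simp only: ev)
    hence "?e (p + h) = \<zero>" by (simp only: dbl bit_eval_0)
    hence "E p + E h = 0" unfolding E(2)[symmetric] by (rule E0)
    moreover have "E h + E h = 0" unfolding E(2)[symmetric] by (rule E0) (simp only: dbl bit_eval_0)
    ultimately show ?thesis by (metis add_right_cancel)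
  qed
  have surj: "\<exists>p. ?e p = y" if "y \<in> carrier R" for y
  proof (cases "y = \<zero>")
    case False
    hence "y \<in> range (\<lambda>i::nat. x [^] i)" using that by (intro subsetD[OF gen]) simp
    then obtain i :: nat where "y = x [^] i" by (rule rangeE)
    hence "?e (Polynomial.monom 1 i) = y" by (simp only: ev(3))
    thus ?thesis by (rule exI)
  next
    case True
    thus ?thesis by (intro exI[of _ 0]) simp
  qed
  define \<Phi> where "\<Phi> y = E (SOME p. ?e p = y)" for y
  have \<Phi>: "\<Phi> (?e p) = E p" for p unfolding \<Phi>_def
    by (rule uniq) (rule someI[of "\<lambda>p'. ?e p' = ?e p"], rule refl)
  have one: "\<Phi> \<one> = 1" using \<Phi>[of 1] x E(1) by simp
  have add: "\<Phi> (y \<oplus> z) = \<Phi> y + \<Phi> z" and mult: "\<Phi> (y \<otimes> z) = \<Phi> y * \<Phi> z"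
    if "y \<in> carrier R" "z \<in> carrier R" for y z
  proof -
    from surj[OF that(1)] obtain p where p: "?e p = y" by (rule exE)
    from surj[OF that(2)] obtain h where h: "?e h = z" by (rule exE)
    thus "\<Phi> (y \<oplus> z) = \<Phi> y + \<Phi> z" "\<Phi> (y \<otimes> z) = \<Phi> y * \<Phi> z"
      unfolding p[symmetric] h[symmetric] ev(1,2)[symmetric] \<Phi> by (simp_all only: E(2,3))
  qed
  have "\<Phi> \<zero> = \<Phi> \<zero> + \<Phi> \<zero>" using add[OF zero_closed zero_closed] by (simp only: l_zero zero_closed)
  hence zero: "\<Phi> \<zero> = 0" by (simp only: add_cancel_right_right)
  have "inj_on \<Phi> (carrier R)"
  proof (rule inj_onI)
    fix y z assume yz: "y \<in> carrier R" "z \<in> carrier R" "\<Phi> y = \<Phi> z"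
    have "\<Phi> (y \<ominus> z) + \<Phi> z = \<Phi> z"
      using add[of "y \<ominus> z" z] yz by (simp add: minus_eq a_assoc l_neg)
    hence 0: "\<Phi> (y \<ominus> z) = 0" by simp
    have "y \<ominus> z = \<zero>"
    proof (rule ccontr)
      assume nz: "y \<ominus> z \<noteq> \<zero>"
      hence u: "y \<ominus> z \<in> Units R" using yz by (simp add: field_Units)
      have "\<Phi> (y \<ominus> z) * \<Phi> (inv (y \<ominus> z)) = \<Phi> \<one>"
        using mult[of "y \<ominus> z" "inv (y \<ominus> z)"] yz u by simp
      thus False using 0 one by simp
    qed
    thus "y = z" using yz by simp
  qed
  from that[OF one add mult this] show ?thesis .
qed

text \<open>Induction along the construction of a space by adjoining lines: as \<open>v\<close> is
  not in \<open>E\<close>, the representation \<open>c \<otimes> v \<oplus> e\<close> is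
  unique.\<close>

lemma card_of_dimension:
  assumes S: "subfield S R" and fin: "finite (carrier R)" and dim: "dimension m S E"
  shows "card E = card S ^ m"
  using dim S
proof (induction)
  case (Suc_dim v E m S)
  note S = \<open>subfield S R\<close>
  note SR = subringE[OF subfieldE(1)[OF S]]
  interpret E: subalgebra S E R
    by (rule finite_dimension_imp_subalgebra[OF S finite_dimensionI[OF Suc_dim.hyps(3)]])
  have E_carrier: "E \<subseteq> carrier R" using E.subset by simp
  have inj: "inj_on (\<lambda>(c, e). c \<otimes> v \<oplus> e) (S \<times> E)"
  proof (rule inj_onI, clarify)
    fix c e c' e' assume A: "c \<in> S" "e \<in> E" "c' \<in> S" "e' \<in> E" "c \<otimes> v \<oplus> e = c' \<otimes> v \<oplus> e'"
    have cl: "c \<in> carrier R" "c' \<in> carrier R" "e \<in> carrier R" "e' \<in> carrier R" "v \<in> carrier R"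
      using A SR(1) E_carrier Suc_dim.hyps(1) by auto
    have eq: "(c \<ominus> c') \<otimes> v = e' \<ominus> e"
    proof -
      have "(c \<ominus> c') \<otimes> v = (c \<otimes> v \<oplus> e) \<oplus> \<ominus> (c' \<otimes> v) \<oplus> \<ominus> e"
        using cl by (simp add: minus_eq l_distr l_minus a_ac r_neg r_neg1 r_neg2)
      also have "\<dots> = e' \<ominus> e" unfolding A(5) using cl by (simp add: minus_eq a_ac r_neg r_neg1 r_neg2)
      finally show ?thesis .
    qed
    have "c \<ominus> c' = \<zero>"
    proof (rule ccontr)
      assume nz: "c \<ominus> c' \<noteq> \<zero>"
      have "c \<ominus> c' \<in> S" using A SR(5,7) by (simp add: minus_eq)
      from subfield_m_inv[OF S, of "c \<ominus> c'"] this nz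
      have inv: "inv (c \<ominus> c') \<in> S" "inv (c \<ominus> c') \<otimes> (c \<ominus> c') = \<one>" by auto
      have "e' \<ominus> e \<in> E" using A E.m_closed[of e' "\<ominus> e"] E.m_inv_closed[of e]
        by (simp add: minus_eq a_inv_def)
      hence "inv (c \<ominus> c') \<otimes> (e' \<ominus> e) \<in> E" using inv by (intro E.smult_closed)
      moreover have "inv (c \<ominus> c') \<otimes> (e' \<ominus> e) = (inv (c \<ominus> c') \<otimes> (c \<ominus> c')) \<otimes> v"
        unfolding eq[symmetric] using cl inv SR(1) by (intro m_assoc[symmetric]) auto
      ultimately show False using inv cl Suc_dim.hyps(2) by simp
    qed
    hence "c = c'" using cl by simp
    moreover have "e = e'" using A(5) cl unfolding \<open>c = c'\<close> by simp
    ultimately show "c = c' \<and> e = e'" by simp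
  qed
  have "line_extension S v E = (\<lambda>(c, e). c \<otimes> v \<oplus> e) ` (S \<times> E)"
    unfolding set_eq_iff line_extension_mem_iff image_iff by force
  hence "card (line_extension S v E) = card (S \<times> E)" using card_image[OF inj] by simp
  thus ?case using Suc_dim.IH S by (simp add: card_cartesian_product)
qed simp

lemma card_eq_power_dim:
  assumes S: "subfield S R" and fin: "finite (carrier R)"
  shows "card (carrier R) = card S ^ dim S (carrier R)"
proof -
  obtain Us where Us: "set Us = carrier R" using finite_list[OF fin] by blast
  have "Span S Us = carrier R"
    using Span_base_incl[OF S, of Us] Span_in_carrier[OF subfieldE(3)[OF S], of Us] Us by auto
  hence "finite_dimension S (carrier R)" using Span_finite_dimension[OF S, of Us] Us by simp
  then obtain m where m: "dimension m S (carrier R)" by (rule finite_dimensionE')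
  hence "dim S (carrier R) = m" using dimI[OF S] by (simp add: over_def)
  thus ?thesis using card_of_dimension[OF S fin m] by simp
qed

end

section \<open>Transfer to the given field\<close>

context gmw_field
begin

definition seq :: "int \<Rightarrow> complex" where "seq x = delta (Tr (\<theta> ^ nat (x mod int n)))"

lemma fourth_norm_estimate:
  "\<bar>poly_norm 4 (\<Sum>j<t. Polynomial.monom (seq (int j + r)) j) ^ 4 -
      (2 * (\<Sum>\<delta>\<in>{\<delta> \<in> {- int t<..<int t}. int n dvd \<delta>}. (lag_weight t \<delta>)\<^sup>2)
        - (\<Sum>\<delta>\<in>{- int t<..<int t}. (lag_weight t \<delta>)\<^sup>2) / n)\<bar>
    \<le> 3 * (real q)\<^sup>2 * sqrt q * sqrt (sqrt q) * (2 * real t + real n * harm n) ^ 4 / real n ^ 5"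
proof -
  \<comment> \<open>The number of sampling points must be a multiple of the period \<open>n\<close>
    and at least \<open>2 * t\<close>.\<close>
  define M where "M = 2 * t div n + 1"
  have "2 * t = n * (2 * t div n) + 2 * t mod n" by simp
  hence tM: "2 * t \<le> M * n" using mod_less_divisor[OF n_pos, of "2 * t"] unfolding M_def
    by (simp only: add_mult_distrib mult_1 mult.commute[of n])
  have M: "M > 0" by (simp add: M_def)
  have per: "seq x = seq y" if "int n dvd x - y" for x y
    using that by (simp add: seq_def mod_eq_dvd_iff[symmetric])
  have F: "ft k = (\<Sum>j<n. seq (int j) * root_unity n (k * int j))" for k
    unfolding ft_eq_dft by (intro sum.cong refl) (simp add: seq_def root_unity_def mult_ac flip: zmod_int)
  have N: "M * n > 0" using M n_pos by simp
  have mom: "norm ((\<Sum>k<n. ft (int k + a) * ft (int k + b) * cnj (ft (int k + c)) * cnj (ft (int k))) -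
        (if int n dvd a - c \<and> int n dvd b \<or> int n dvd a \<and> int n dvd b - c then of_nat n ^ 3 else 0))
      \<le> 3 * (real q)\<^sup>2 * sqrt q * sqrt (sqrt q)" for a b c
    using moment_estimate[of a b c] moment_estimate[of a c b] unfolding moment_def by simp
  from fourth_mean_estimate[OF n_pos M tM per F mom, of r] show ?thesis
    unfolding poly_norm_4[OF N tM] by simp
qed

end

lemma CHAR_bit: "CHAR(bit) = 2"
proof (rule CHAR_eqI)
  fix x :: nat assume "of_nat x = (0 :: bit)"
  hence "even (of_nat x :: bit)" by simp
  thus "2 dvd x" by (simp only: even_of_nat_iff)
qed simp

text \<open>This moves the difference set from a field given by its carrier into the algebraic
  closure, where the character sums live. The image \<open>\<xi>\<close> of the generator serves as
  primitive element, and integer exponents are reduced modulo its order so that natural powers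
  suffice.\<close>

lemma gmw_transfer:
  fixes R :: "('a, 'b) ring_scheme" (structure)
  assumes gmw: "gmw_difference_set R D" and x: "x \<in> carrier (mult_of R)"
    and gen: "generate (mult_of R) {x} = carrier (mult_of R)"
  obtains \<kappa> k m l and \<xi> :: "bit alg_closure" and B
  where "gmw_field \<kappa> \<xi> k m l B" and "card (carrier R) = 2 ^ \<kappa>"
    and "\<And>i::int. x [^]\<^bsub>mult_of R\<^esub> i \<in> D \<longleftrightarrow> (\<Sum>j<m. (\<xi> ^ nat (i mod int (2 ^ \<kappa> - 1))) ^ (2 ^ k) ^ j) \<in> B"
proof -
  from gmw have F: "field R" and c2: "card (carrier R) > 2" and "\<exists>\<kappa>. card (carrier R) = 2 ^ \<kappa>"
    unfolding gmw_difference_set_def by auto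
  then obtain \<kappa> where \<kappa>: "card (carrier R) = 2 ^ \<kappa>" by blast
  from gmw obtain S B kk l where S: "subfield S R" "S \<noteq> carrier R"
    and ds: "difference_set (mult_of (R\<lparr>carrier := S\<rparr>)) (card S - 1) kk l B" and kk: "2 * kk = card S"
    and D: "D = {a \<otimes> b | a b. a \<in> {a \<in> carrier R. field_trace R S a = \<one>} \<and> b \<in> B}"
    unfolding gmw_difference_set_def by blast
  interpret R: field R by (rule F)
  interpret G: group "mult_of R" by (rule R.field_mult_group)
  have fin: "finite (carrier R)" using c2 by (metis card.infinite not_less0)
  have \<kappa>0: "\<kappa> > 0" using c2 \<kappa> by (cases \<kappa>) auto
  note char2 = R.char2_of_card[OF \<kappa> \<kappa>0]
  define N where "N = card (carrier R) - 1"
  have N: "N = 2 ^ \<kappa> - 1" "N > 0" using c2 \<kappa> by (simp_all add: N_def)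
  have xc: "x \<in> carrier R" "x \<noteq> \<zero>" using x by auto
  have ordx: "G.ord x = N"
    using G.generate_pow_card[OF x] gen by (simp add: N_def card_Diff_singleton)
  have pow: "x [^]\<^bsub>mult_of R\<^esub> i = x [^] i" for i :: nat by (simp add: Multiplicative_Group.nat_pow_mult_of)
  have x_eq_1: "x [^] i = \<one> \<longleftrightarrow> N dvd i" for i :: nat
    using G.pow_eq_id[OF x, of i] ordx by (simp add: pow)
  have powers: "carrier R - {\<zero>} \<subseteq> range (\<lambda>i::nat. x [^] i)"
    using G.generate_pow_nat[OF x] ordx N(2) gen by (auto simp: pow)
  have xN: "x [^] N = \<one>" by (simp add: x_eq_1)
  obtain \<Phi> :: "'a \<Rightarrow> bit alg_closure" where one: "\<Phi> \<one> = 1"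
    and add: "\<And>y z. y \<in> carrier R \<Longrightarrow> z \<in> carrier R \<Longrightarrow> \<Phi> (y \<oplus> z) = \<Phi> y + \<Phi> z"
    and mult: "\<And>y z. y \<in> carrier R \<Longrightarrow> z \<in> carrier R \<Longrightarrow> \<Phi> (y \<otimes> z) = \<Phi> y * \<Phi> z"
    and inj: "inj_on \<Phi> (carrier R)"
    using R.embed_in_closure[OF char2 xc(1) N(2) xN powers] by blast
  have "\<Phi> \<zero> = \<Phi> \<zero> + \<Phi> \<zero>" using add[OF R.zero_closed R.zero_closed] by (simp only: R.l_zero R.zero_closed)
  hence zero: "\<Phi> \<zero> = 0" by (simp only: add_cancel_right_right)
  have \<Phi>_eq: "\<Phi> y = \<Phi> z \<longleftrightarrow> y = z" if "y \<in> carrier R" "z \<in> carrier R" for y z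
    using inj that by (auto simp: inj_on_def)
  have \<Phi>_pow: "\<Phi> (y [^] i) = \<Phi> y ^ i" if "y \<in> carrier R" for y and i :: nat
    by (induction i) (use that in \<open>simp_all add: one mult\<close>)
  define \<xi> where "\<xi> = \<Phi> x"
  have "char2_field \<kappa> \<xi>"
  proof
    show "CHAR(bit alg_closure) = 2" by (simp add: CHAR_bit)
    show "\<xi> ^ (2 ^ \<kappa> - 1) = 1" using \<Phi>_pow[OF xc(1), of N] xN one by (simp add: \<xi>_def N(1))
    fix i :: nat assume i: "0 < i" "i < 2 ^ \<kappa> - 1"
    show "\<xi> ^ i \<noteq> 1"
    proof
      assume "\<xi> ^ i = 1"
      hence "\<Phi> (x [^] i) = \<Phi> \<one>" using \<Phi>_pow[OF xc(1), of i] one by (simp add: \<xi>_def)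
      hence "x [^] i = \<one>" using \<Phi>_eq[of "x [^] i" \<one>] xc by simp
      hence "N dvd i" by (simp only: x_eq_1)
      thus False using i N(1) by (simp add: nat_dvd_not_less)
    qed
  qed (rule \<kappa>0)
  then interpret C: char2_field \<kappa> \<xi> .
  note SR = subringE[OF subfieldE(1)[OF S(1)]]
  have finS: "finite S" using SR(1) fin by (rule finite_subset)
  have "card S dvd 2 ^ \<kappa>"
  proof -
    have "subgroup S (add_monoid R)" using subfieldE(1)[OF S(1)] by (rule subring.axioms(1))
    from group.lagrange[OF R.a_group this] show ?thesis
      unfolding \<kappa>[symmetric] Coset.order_def by (metis dvd_triv_right partial_object.select_convs(1))
  qed
  then obtain k where k: "card S = 2 ^ k" using divides_primepow_nat[of 2 "card S" \<kappa>] by auto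
  have k0: "k > 0" using kk k by (cases k) auto
  \<comment> \<open>The trace runs over as many conjugates as the dimension; comparing cardinalities
    shows that this number is \<open>\<kappa> / k\<close>.\<close>
  define m where "m = ring.dim R S (carrier R)"
  have dim: "2 ^ \<kappa> = ((2::nat) ^ k) ^ m"
    using R.card_eq_power_dim[OF S(1) fin] unfolding \<kappa> k m_def .
  hence \<kappa>_eq: "\<kappa> = k * m" by (simp flip: power_mult)
  have m2: "m \<ge> 2"
  proof -
    have "m \<noteq> 0" using \<kappa>_eq \<kappa>0 by auto
    moreover have "m \<noteq> 1"
    proof
      assume "m = 1"
      hence "card S = card (carrier R)" using dim \<kappa> k by simp
      thus False using S(2) card_subset_eq[OF fin SR(1)] by simp
    qed
    ultimately show ?thesis by simp
  qed
  let ?H = "mult_of (R\<lparr>carrier := S\<rparr>)"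
  have H: "group ?H" "finite (carrier ?H)" "B \<subseteq> carrier ?H" "card B = kk"
    and diffs: "\<And>g. g \<in> carrier ?H - {\<one>\<^bsub>?H\<^esub>} \<Longrightarrow>
      card {(y, z). y \<in> B \<and> z \<in> B \<and> y \<otimes>\<^bsub>?H\<^esub> inv\<^bsub>?H\<^esub> z = g} = l"
    using ds unfolding difference_set_def by auto
  interpret H: group ?H by (rule H(1))
  have Hc: "carrier ?H = S - {\<zero>}" by simp
  have BS: "B \<subseteq> S - {\<zero>}" using H(3) by simp
  have BR: "B \<subseteq> carrier R" using BS SR(1) by blast
  have \<Phi>_nz: "\<Phi> b \<noteq> 0" if "b \<in> B" for b using \<Phi>_eq[of b \<zero>] that BS BR zero by auto
  \<comment> \<open>The order of the multiplicative group of \<open>S\<close> makes each image a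
    fixed point of the power \<open>2 ^ k\<close>, and there are only as many fixed points as
    elements of \<open>S\<close>.\<close>
  have \<Phi>S: "\<Phi> ` S = GF (2 ^ k)"
  proof (rule card_subset_eq[OF C.finite_GF_2[OF k0]])
    show "\<Phi> ` S \<subseteq> GF (2 ^ k)"
    proof (rule image_subsetI)
      fix y assume y: "y \<in> S"
      hence yR: "y \<in> carrier R" using SR(1) by blast
      have "\<Phi> y ^ (2 ^ k) = \<Phi> y"
      proof (cases "y = \<zero>")
        case False
        have "y [^]\<^bsub>?H\<^esub> Coset.order ?H = \<one>\<^bsub>?H\<^esub>" using y False by (intro H.pow_order_eq_1) simp
        moreover have "y [^]\<^bsub>?H\<^esub> i = y [^] i" for i :: nat by (simp add: nat_pow_def)
        moreover have "Coset.order ?H = 2 ^ k - 1"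
          unfolding Coset.order_def Hc using SR(2) by (simp add: card_Diff_singleton k)
        ultimately have "y [^] (2 ^ k - 1 :: nat) = \<one>" by simp
        hence "\<Phi> y ^ (2 ^ k - 1) = 1" using \<Phi>_pow[OF yR, of "2 ^ k - 1"] one by simp
        moreover have "\<Phi> y ^ (2 ^ k) = \<Phi> y ^ (2 ^ k - 1) * \<Phi> y" by (simp flip: power_Suc2)
        ultimately show ?thesis by simp
      qed (simp add: zero power_0_left)
      thus "\<Phi> y \<in> GF (2 ^ k)" by (simp add: GF_def)
    qed
    show "card (\<Phi> ` S) = card (GF (2 ^ k) :: bit alg_closure set)"
      using card_image[OF inj_on_subset[OF inj SR(1)]] by (simp only: C.card_GF_2[OF k0] k)
  qed
  have gmwf: "gmw_field \<kappa> \<xi> k m l (\<Phi> ` B)"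
  proof (intro gmw_field.intro gmw_field_axioms.intro C.char2_field_axioms k0 m2 \<kappa>_eq)
    show "\<Phi> ` B \<subseteq> GF (2 ^ k) - {0}" using BS \<Phi>S \<Phi>_nz by auto
    show "2 * card (\<Phi> ` B) = 2 ^ k"
      using card_image[OF inj_on_subset[OF inj BR]] H(4) kk k by simp
    fix g :: "bit alg_closure" assume g: "g \<in> GF (2 ^ k)" "g \<noteq> 0" "g \<noteq> 1"
    then obtain c where c: "c \<in> S" "g = \<Phi> c" using \<Phi>S by blast
    hence cR: "c \<in> carrier R" using SR(1) by blast
    have cH: "c \<in> carrier ?H - {\<one>\<^bsub>?H\<^esub>}" using c g zero one by auto
    let ?P = "{(y, z). y \<in> B \<and> z \<in> B \<and> y \<otimes>\<^bsub>?H\<^esub> inv\<^bsub>?H\<^esub> z = c}"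
    have iff: "y \<otimes>\<^bsub>?H\<^esub> inv\<^bsub>?H\<^esub> z = c \<longleftrightarrow> \<Phi> y / \<Phi> z = g" if yz: "y \<in> B" "z \<in> B" for y z
    proof -
      have yR: "y \<in> carrier R" and zR: "z \<in> carrier R" using yz BR by blast+
      have "c = y \<otimes>\<^bsub>?H\<^esub> inv\<^bsub>?H\<^esub> z \<longleftrightarrow> y = c \<otimes>\<^bsub>?H\<^esub> z"
        using yz cH H(3) by (intro H.inv_solve_right) auto
      also have "\<dots> \<longleftrightarrow> \<Phi> y = \<Phi> c * \<Phi> z"
        using \<Phi>_eq[OF yR R.m_closed[OF cR zR]] by (simp add: mult[OF cR zR])
      also have "\<dots> \<longleftrightarrow> \<Phi> y / \<Phi> z = g" using \<Phi>_nz[OF yz(2)] by (simp add: c(2) divide_eq_eq)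
      finally show ?thesis by auto
    qed
    have "{(y, z). y \<in> \<Phi> ` B \<and> z \<in> \<Phi> ` B \<and> y / z = g} = map_prod \<Phi> \<Phi> ` ?P"
    proof (intro equalityI subsetI)
      fix p assume "p \<in> {(y, z). y \<in> \<Phi> ` B \<and> z \<in> \<Phi> ` B \<and> y / z = g}"
      then obtain y z where "p = (\<Phi> y, \<Phi> z)" "y \<in> B" "z \<in> B" "\<Phi> y / \<Phi> z = g" by auto
      thus "p \<in> map_prod \<Phi> \<Phi> ` ?P" using iff by (intro image_eqI[of _ _ "(y, z)"]) auto
    qed (use iff in auto)
    moreover have "card (map_prod \<Phi> \<Phi> ` ?P) = card ?P"
      by (rule card_image, rule inj_on_subset[OF map_prod_inj_on[OF inj inj]]) (use BR in auto)
    moreover have "card ?P = l" by (rule diffs[OF cH])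
    ultimately show "card {(y, z). y \<in> \<Phi> ` B \<and> z \<in> \<Phi> ` B \<and> y / z = g} = l" by (simp only:)
  qed
  then interpret W: gmw_field \<kappa> \<xi> k m l "\<Phi> ` B" .
  have trace: "\<Phi> (field_trace R S a) = W.Tr (\<Phi> a)" if a: "a \<in> carrier R" for a
  proof -
    have "\<Phi> (\<Oplus>i\<in>{..<j}. a [^] (card S ^ i)) = (\<Sum>i<j. \<Phi> a ^ (2 ^ k) ^ i)" for j
      by (induction j) (use a in \<open>simp_all add: lessThan_Suc zero add \<Phi>_pow k\<close>)
    thus ?thesis unfolding field_trace_def W.Tr_def W.s_def m_def[symmetric] .
  qed
  have trace_closed: "field_trace R S a \<in> carrier R" if "a \<in> carrier R" for a
    unfolding field_trace_def using that by (intro R.finsum_closed) auto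
  have Tr_S: "W.Tr (\<Phi> b * y) = \<Phi> b * W.Tr y" if "b \<in> S" for b y
    by (rule W.Tr_mult) (use that \<Phi>S in \<open>auto simp: W.s_def\<close>)
  \<comment> \<open>The trace is linear over the subfield: a product of \<open>a\<close> with trace
    \<open>1\<close> and \<open>b\<close> in \<open>B\<close> has trace \<open>b\<close>.
    Conversely, if \<open>z\<close> has trace \<open>b\<close> in \<open>B\<close>, then
    \<open>z \<otimes> inv b\<close> has trace \<open>1\<close>.\<close>
  have D_iff: "z \<in> D \<longleftrightarrow> W.Tr (\<Phi> z) \<in> \<Phi> ` B" if z: "z \<in> carrier R" for z
  proof
    assume "z \<in> D"
    then obtain a b where ab: "z = a \<otimes> b" "a \<in> carrier R" "field_trace R S a = \<one>" "b \<in> B" unfolding D by blast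
    have b: "b \<in> S" "b \<in> carrier R" using ab BS BR by auto
    have "\<Phi> z = \<Phi> b * \<Phi> a" using ab b by (simp add: mult)
    hence "W.Tr (\<Phi> z) = \<Phi> b" using trace[OF ab(2)] Tr_S[OF b(1)] ab(3) one by simp
    thus "W.Tr (\<Phi> z) \<in> \<Phi> ` B" using ab(4) by simp
  next
    assume "W.Tr (\<Phi> z) \<in> \<Phi> ` B"
    then obtain b where b: "b \<in> B" "W.Tr (\<Phi> z) = \<Phi> b" by blast
    have bS: "b \<in> S - {\<zero>}" "b \<in> carrier R" using b BS BR by auto
    from R.subfield_m_inv[OF S(1) bS(1)]
    have i: "inv b \<in> S" "inv b \<otimes> b = \<one>" "inv b \<in> carrier R" using SR(1) by auto
    define a where "a = z \<otimes> inv b"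
    have a: "a \<in> carrier R" using z i by (simp add: a_def)
    have "\<Phi> a = \<Phi> (inv b) * \<Phi> z" using z i by (simp add: a_def mult)
    hence "W.Tr (\<Phi> a) = \<Phi> (inv b) * \<Phi> b" using Tr_S[OF i(1)] b(2) by simp
    also have "\<dots> = \<Phi> \<one>" using mult[OF i(3) bS(2)] i(2) by simp
    finally have "field_trace R S a = \<one>" using trace[OF a] \<Phi>_eq[OF trace_closed[OF a]] by simp
    moreover have "z = a \<otimes> b" using z i bS by (simp add: a_def R.m_assoc)
    ultimately show "z \<in> D" unfolding D using a b(1) by blast
  qed
  have int_pow: "x [^]\<^bsub>mult_of R\<^esub> i = x [^] nat (i mod int N)" for i :: int
  proof -
    have "x [^]\<^bsub>mult_of R\<^esub> i = x [^]\<^bsub>mult_of R\<^esub> (i mod int N)"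
      unfolding G.int_pow_eq[OF x] ordx by (simp add: mod_eq_dvd_iff[symmetric])
    also have "i mod int N = int (nat (i mod int N))" using N(2) by simp
    finally show ?thesis by (simp only: int_pow_int pow)
  qed
  have "x [^]\<^bsub>mult_of R\<^esub> i \<in> D \<longleftrightarrow> (\<Sum>j<m. (\<xi> ^ nat (i mod int (2 ^ \<kappa> - 1))) ^ (2 ^ k) ^ j) \<in> \<Phi> ` B" for i :: int
    using D_iff[of "x [^] nat (i mod int N)"] xc(1) \<Phi>_pow[OF xc(1)]
    unfolding int_pow W.Tr_def W.s_def N(1) by (simp add: \<xi>_def)
  from that[OF gmwf \<kappa> this] show ?thesis .
qed

lemma gmw_fourth_norm:
  fixes R :: "('a, 'b) ring_scheme" and r :: int
  assumes gmw: "gmw_difference_set R D" and f: "characteristic_poly (mult_of R) D x f"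
    and q: "card (carrier R) = q"
  shows "\<bar>poly_norm 4 (shifted_poly (mult_of R) D x r t) ^ 4 -
      (2 * (\<Sum>\<delta>\<in>{\<delta> \<in> {- int t<..<int t}. int (q - 1) dvd \<delta>}. (lag_weight t \<delta>)\<^sup>2)
        - (\<Sum>\<delta>\<in>{- int t<..<int t}. (lag_weight t \<delta>)\<^sup>2) / real (q - 1))\<bar>
    \<le> 3 * (real q)\<^sup>2 * sqrt q * sqrt (sqrt q) * (2 * real t + real (q - 1) * harm (q - 1)) ^ 4 / real (q - 1) ^ 5"
proof -
  have x: "x \<in> carrier (mult_of R)" "generate (mult_of R) {x} = carrier (mult_of R)"
    using f unfolding characteristic_poly_def by auto
  show ?thesis
  proof (rule gmw_transfer[OF gmw x])
    fix \<kappa> k m l and \<xi> :: "bit alg_closure" and B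
    assume W: "gmw_field \<kappa> \<xi> k m l B" and \<kappa>: "card (carrier R) = 2 ^ \<kappa>"
      and D: "\<And>i::int. x [^]\<^bsub>mult_of R\<^esub> i \<in> D \<longleftrightarrow> (\<Sum>j<m. (\<xi> ^ nat (i mod int (2 ^ \<kappa> - 1))) ^ (2 ^ k) ^ j) \<in> B"
    interpret W: gmw_field \<kappa> \<xi> k m l B by (rule W)
    have Wq: "W.q = q" "W.n = q - 1" using \<kappa> q by (simp_all add: W.q_def W.n_def)
    have "pm_indicator D (x [^]\<^bsub>mult_of R\<^esub> i) = W.seq i" for i :: int
      unfolding pm_indicator_def W.seq_def W.delta_def W.Tr_def W.s_def W.n_def W.q_def D by (rule refl)
    hence "shifted_poly (mult_of R) D x r t = (\<Sum>j<t. Polynomial.monom (W.seq (int j + r)) j)"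
      unfolding shifted_poly_def by (simp only:)
    with W.fourth_norm_estimate[of r t] show ?thesis unfolding Wq by (simp only:)
  qed
qed

lemma merit_factor_shifted_poly:
  "merit_factor (shifted_poly G D x r t) =
    (real t)\<^sup>2 / (poly_norm 4 (shifted_poly G D x r t) ^ 4 - (real t)\<^sup>2)"
  unfolding merit_factor_def shifted_poly_def
  by (subst (1 2) poly_norm_2) (simp_all add: pm_indicator_def)

theorem theorem2p1:
  fixes Q :: "nat set"
    and K :: "nat \<Rightarrow> ('a, 'b) ring_scheme"
    and D :: "nat \<Rightarrow> 'a set"
    and \<theta> :: "nat \<Rightarrow> 'a"
    and f :: "nat \<Rightarrow> complex poly"
    and r :: "nat \<Rightarrow> int"
    and t :: "nat \<Rightarrow> nat"
    and T :: real
  assumes "infinite Q"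
    and "\<And>q. q \<in> Q \<Longrightarrow> q > 2 \<and> (\<exists>k. q = 2 ^ k)"
    and "\<And>q. q \<in> Q \<Longrightarrow> field (K q) \<and> card (carrier (K q)) = q"
    and "\<And>q. q \<in> Q \<Longrightarrow> gmw_difference_set (K q) (D q)"
    and "\<And>q. q \<in> Q \<Longrightarrow> characteristic_poly (mult_of (K q)) (D q) (\<theta> q) (f q)"
    and "T > 0"
    and "((\<lambda>q. real (t q) / real q) \<longlongrightarrow> T) (inf at_top (principal Q))"
  shows "((\<lambda>q. merit_factor (shifted_poly (mult_of (K q)) (D q) (\<theta> q) (r q) (t q)))
           \<longlongrightarrow> phi 0 0 T) (inf at_top (principal Q))"
  unfolding merit_factor_shifted_poly
proof (rule merit_limit[OF _ assms(6) assms(7)])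
  show "filterlim (\<lambda>q. q) at_top (inf at_top (principal Q))"
    by (rule filterlim_mono[OF filterlim_ident order_refl inf_le1])
qed (use gmw_fourth_norm[OF assms(4) assms(5)] assms(3) in \<open>auto simp: eventually_inf_principal\<close>)

end
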